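(* Let $d\ge2$ and $\alpha\in(0,d)$. There exists a constant $Q_0=Q_0(\alpha,d)>0$ such that, for every $\delta>0$, $m\ge\omega_d\delta^d$ and $Q>0$ with $$\frac{Q}{m^{\frac{d-1+\alpha}{2d}}}\le Q_0\,\frac{\delta^d}{m},$$ the problem $$\min\left\{\mathcal F_{\alpha,Q}(E):\ |E|=m,\ E\in\mathcal K_\delta\right\}$$ has a solution.
   Context: $|E|$ is Lebesgue measure in $\mathbb R^d$ and $\omega_d$ is the volume of the unit ball. $P(E)$ is the perimeter of $E$ in $\mathbb R^d$ in the sense of De Giorgi (equal to $\mathcal H^{d-1}(\partial E)$ when $E$ has smooth boundary). For $\alpha\in(0,d)$, $$\mathcal I_\alpha(E)=\inf\left\{\int_{\mathbb R^d\times\mathbb R^d}\frac{d\mu(x)\,d\mu(y)}{|x-y|^\alpha}:\ \mu \text{ non-negative Borel measure on }\mathbb R^d,\ \mu(E)=1\right\},$$ and $\mathcal F_{\alpha,Q}(E)=P(E)+Q^2\,\mathcal I_\alpha(E)$. A set $E$ satisfies the $\delta$-ball condition if for every $x\in\partial E$ there are a ball of radius $\delta$ contained in $E$ and tangent to $\partial E$ at $x$ (an open ball $B_\delta(y)\subset E$ with $|x-y|=\delta$), and a ball of radius $\delta$ contained in $E^c=\mathbb R^d\setminus E$ and tangent to $\partial E$ at $x$ (an open ball $B_\delta(z)\subset E^c$ with $|x-z|=\delta$). $\mathcal K_\delta$ is the class of all closed subsets of $\mathbb R^d$ satisfying the $\delta$-ball condition. *)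

theory Defs
  imports "HOL-Analysis.Analysis"
begin

definition compactly_supported_C1 :: "('a::euclidean_space \<Rightarrow> 'a) \<Rightarrow> bool" where
  "compactly_supported_C1 \<phi> \<longleftrightarrow>
     (\<exists>\<phi>' :: 'a \<Rightarrow> 'a \<Rightarrow>\<^sub>L 'a.
        (\<forall>x. (\<phi> has_derivative blinfun_apply (\<phi>' x)) (at x)) \<and> continuous_on UNIV \<phi>') \<and>
     compact (closure {x. \<phi> x \<noteq> 0})"

definition divergence :: "('a::euclidean_space \<Rightarrow> 'a) \<Rightarrow> 'a \<Rightarrow> real" where
  "divergence \<phi> x = (\<Sum>b\<in>Basis. frechet_derivative \<phi> (at x) b \<bullet> b)"

text \<open>
  De Giorgi perimeter of a Lebesgue measurable set. The truncation of negative reals by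
  \<^const>\<open>ennreal\<close> does not change the supremum, since the zero field is admissible.
\<close>

definition perimeter :: "'a::euclidean_space set \<Rightarrow> ennreal" where
  "perimeter E =
     (SUP \<phi> \<in> {\<phi> :: 'a \<Rightarrow> 'a. compactly_supported_C1 \<phi> \<and> (\<forall>x. norm (\<phi> x) \<le> 1)}.
        ennreal (LINT x:E|lebesgue. divergence \<phi> x))"

text \<open>
  In \<^typ>\<open>ennreal\<close> the kernel equals \<open>\<infinity>\<close> on the diagonal. The double integral is
  iterated because the library's product measure is meaningful only for sigma-finite measures,
  which is not required of \<open>\<mu>\<close>.
\<close>

definition riesz_energy :: "real \<Rightarrow> 'a::euclidean_space set \<Rightarrow> ennreal" where
  "riesz_energy \<alpha> E =
     (INF \<mu> \<in> {\<mu> :: 'a measure. sets \<mu> = sets borel \<and> emeasure \<mu> E = 1}.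
        \<integral>\<^sup>+ x. (\<integral>\<^sup>+ y. 1 / ennreal (norm (x - y) powr \<alpha>) \<partial>\<mu>) \<partial>\<mu>)"

definition charged_energy :: "real \<Rightarrow> real \<Rightarrow> 'a::euclidean_space set \<Rightarrow> ennreal" where
  "charged_energy \<alpha> Q E = perimeter E + ennreal (Q\<^sup>2) * riesz_energy \<alpha> E"

definition ball_condition :: "real \<Rightarrow> 'a::euclidean_space set \<Rightarrow> bool" where
  "ball_condition \<delta> E \<longleftrightarrow>
     (\<forall>x \<in> frontier E.
        (\<exists>y. ball y \<delta> \<subseteq> E \<and> norm (x - y) = \<delta>) \<and>
        (\<exists>z. ball z \<delta> \<subseteq> - E \<and> norm (x - z) = \<delta>))"

definition ball_class :: "real \<Rightarrow> 'a::euclidean_space set set" where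
  "ball_class \<delta> = {E. closed E \<and> ball_condition \<delta> E}"

end

theory Submission
  imports Defs "HOL-Complex_Analysis.Great_Picard"
begin

text \<open>
  Let \<open>B\<close> be the ball of volume \<open>m\<close> and radius \<open>R\<close>. Every connected component of a competitor \<open>E\<close>
  contains a ball of radius \<open>\<delta>\<close>, so for disconnected \<open>E\<close> the isoperimetric inequality, applied to two
  separated pieces, gives \<open>P(E) - P(B) \<ge> c \<delta>^(d-1)\<close>. For small charge this gap exceeds the Riesz energy
  of \<open>B\<close>, so \<open>E\<close> is no better than \<open>B\<close>. Connected competitors have bounded diameter, since they contain
  many disjoint balls of radius \<open>\<delta>\<close> otherwise; after translations their signed distance functions are
  compact by Arzela and Ascoli. The zero sublevel set of a limit again satisfies the ball condition,
  and both parts of the energy are lower semicontinuous along the sequence.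

  The isoperimetric inequality in De Giorgi's sense is obtained from the Brunn--Minkowski inequality
  (Hadwiger--Ohmann cuts of finite unions of boxes), used on the level sets of a mollified indicator
  function \<open>f\<close>: the total variation of \<open>f\<close> is bounded by the perimeter through the test field
  \<open>k * (- sgn (grad f))\<close>. Lower semicontinuity of the Riesz energy needs no compactness of measures: a
  neighbourhood of the limit set is pushed into it by a map that shrinks distances at most by a factor
  close to 1.
\<close>

text \<open>The charge condition is a scaling count: the Riesz energy of a ball of radius
  \<open>R\<close> is a constant times \<open>R powr (- \<alpha>)\<close>, and squaring the
  hypothesis and inserting \<open>m = w * R ^ d\<close> leaves a multiple of
  \<open>\<delta> ^ (d - 1)\<close> as soon as \<delta> \<le> \<open>R\<close>. The factor
  \<open>1 - 2 powr (- 1 / d)\<close> in the gap arises because, of two balls of total volume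
  \<open>m\<close>, the smaller has radius at most \<open>2 powr (- 1 / d) * R\<close>. De Giorgi's
  perimeter is a supremum over test fields, so its additivity on separated pieces is not immediate.
  Hence the isoperimetric inequality is proved for both pieces at once, with one mollifier so narrow
  that the two smoothed gradients have disjoint supports. A mollified indicator equals 1 only at
  some depth inside the set, so each piece is exhausted by inner parallel sets, and this requires a
  null boundary. The ball condition supplies it: near a boundary point, every ray from the centre of
  the inner tangent ball meets the boundary at most once. The same fact makes volumes and test
  integrals pass to the limit. The limit set may be disconnected; connectedness serves only to
  confine the minimising sequence.\<close>

section \<open>The Brunn-Minkowski inequality for bounded open sets\<close>

text \<open>For side lengths \<open>u\<close> and \<open>v\<close> this is Brunn-Minkowski for two
  boxes. Dividing by the right side turns the two terms into geometric means of
  \<open>u i / (u i + v i)\<close> and \<open>v i / (u i + v i)\<close>; the corresponding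
  arithmetic means add up to 1.\<close>

lemma geom_mean_superadditive:
  fixes u v :: "'i \<Rightarrow> real"
  assumes "finite S" "S \<noteq> {}" and pos: "\<And>i. i \<in> S \<Longrightarrow> 0 < u i" "\<And>i. i \<in> S \<Longrightarrow> 0 < v i"
  shows "(prod u S) powr (1 / card S) + (prod v S) powr (1 / card S) \<le> (\<Prod>i\<in>S. u i + v i) powr (1 / card S)"
proof -
  let ?n = "real (card S)" and ?w = "\<lambda>i. u i + v i"
  have n: "?n > 0" using assms by (simp add: card_gt_0_iff)
  have w: "?w i > 0" if "i \<in> S" for i using pos[OF that] by simp
  have W: "prod ?w S > 0" using w by (intro prod_pos) auto
  have *: "(prod f S) powr (1 / ?n) / (prod ?w S) powr (1 / ?n) \<le> (\<Sum>i\<in>S. (f i / ?w i) / ?n)"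
    if f: "\<And>i. i \<in> S \<Longrightarrow> f i > 0" for f
  proof -
    have "(\<Prod>i\<in>S. f i / ?w i) powr (1 / ?n) \<le> (\<Sum>i\<in>S. (f i / ?w i) / ?n)"
      using assms f w by (intro arith_geom_mean) (auto intro!: divide_nonneg_pos simp: less_imp_le)
    moreover have "(\<Prod>i\<in>S. f i / ?w i) = prod f S / prod ?w S" by (rule prod_dividef)
    ultimately show ?thesis
      using f W by (simp add: powr_divide prod_nonneg less_imp_le)
  qed
  have "(prod u S) powr (1 / ?n) / (prod ?w S) powr (1 / ?n) + (prod v S) powr (1 / ?n) / (prod ?w S) powr (1 / ?n)
     \<le> (\<Sum>i\<in>S. (u i / ?w i) / ?n) + (\<Sum>i\<in>S. (v i / ?w i) / ?n)"
    using *[of u] *[of v] pos by (intro add_mono) auto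
  also have "\<dots> = (\<Sum>i\<in>S. 1 / ?n)"
    unfolding sum.distrib[symmetric] using w by (intro sum.cong refl) (simp add: add_divide_distrib[symmetric] less_imp_neq[THEN not_sym])
  also have "\<dots> = 1" using n by simp
  finally show ?thesis
    using W by (simp add: add_divide_distrib[symmetric] divide_le_eq)
qed

abbreviation (input) measure_root :: "'a::euclidean_space set \<Rightarrow> real" where
  "measure_root A \<equiv> measure lebesgue A powr (1 / real DIM('a))"

text \<open>Open boxes are stable under cuts by axis-parallel hyperplanes, and a cut loses only a
  null set. Empty boxes are excluded because the number of boxes is the induction measure of
  \<open>brunn_minkowski_boxes\<close> and has to drop when a half-space misses a box.\<close>

definition box_family :: "'a::euclidean_space set set \<Rightarrow> bool" where
  "box_family \<D> \<longleftrightarrow> finite \<D> \<and> disjoint \<D> \<and> (\<forall>D\<in>\<D>. D \<noteq> {} \<and> (\<exists>a b. D = box a b))"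

lemma box_Int_halfspaces:
  fixes a b :: "'a::euclidean_space"
  assumes "i \<in> Basis"
  shows "\<exists>c d. box a b \<inter> {x. x \<bullet> i < s} = box c d" "\<exists>c d. box a b \<inter> {x. x \<bullet> i > s} = box c d"
proof -
  have "box a b \<inter> {x. x \<bullet> i < s} = box a (\<Sum>j\<in>Basis. (if j = i then min (b \<bullet> i) s else b \<bullet> j) *\<^sub>R j)"
    using assms by (auto simp: mem_box split: if_splits)
  then show "\<exists>c d. box a b \<inter> {x. x \<bullet> i < s} = box c d" by blast
  have "box a b \<inter> {x. x \<bullet> i > s} = box (\<Sum>j\<in>Basis. (if j = i then max (a \<bullet> i) s else a \<bullet> j) *\<^sub>R j) b"
    using assms by (auto simp: mem_box split: if_splits)
  then show "\<exists>c d. box a b \<inter> {x. x \<bullet> i > s} = box c d" by blast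
qed

lemma box_family_cut:
  fixes \<D> :: "'a::euclidean_space set set"
  assumes "box_family \<D>" "i \<in> Basis" and H: "H = {x. x \<bullet> i < s} \<or> H = {x. x \<bullet> i > s}"
  shows "\<exists>\<E>. box_family \<E> \<and> \<Union>\<E> = \<Union>\<D> \<inter> H \<and> card \<E> \<le> card \<D> \<and>
    (\<forall>D\<in>\<D>. D \<inter> H = {} \<longrightarrow> card \<E> < card \<D>)"
proof (intro exI conjI ballI impI)
  let ?E = "(\<lambda>D. D \<inter> H) ` \<D> - {{}}"
  have fin: "finite \<D>" using assms by (auto simp: box_family_def)
  show "box_family ?E"
    unfolding box_family_def
  proof (intro conjI ballI)
    show "finite ?E" using fin by simp
    show "disjoint ?E" using assms(1) by (fastforce simp: box_family_def disjoint_def)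
    fix D assume "D \<in> ?E"
    then obtain a b where "D = box a b \<inter> H" "D \<noteq> {}"
      using assms(1) unfolding box_family_def by blast
    then show "D \<noteq> {}" "\<exists>a b. D = box a b"
      using H box_Int_halfspaces[OF assms(2)] by auto
  qed
  show "\<Union>?E = \<Union>\<D> \<inter> H" by auto
  have "card ?E \<le> card ((\<lambda>D. D \<inter> H) ` \<D>)" using fin by (intro card_mono) auto
  also have "\<dots> \<le> card \<D>" using fin by (rule card_image_le)
  finally show "card ?E \<le> card \<D>" .
  fix D assume D: "D \<in> \<D>" "D \<inter> H = {}"
  have "?E \<subseteq> (\<lambda>D. D \<inter> H) ` (\<D> - {D})" using D by auto
  then have "card ?E \<le> card ((\<lambda>D. D \<inter> H) ` (\<D> - {D}))" using fin by (intro card_mono) auto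
  also have "\<dots> \<le> card (\<D> - {D})" using fin by (intro card_image_le) auto
  also have "\<dots> < card \<D>" using fin D(1) by (rule card_Diff1_less)
  finally show "card ?E < card \<D>" .
qed

lemma box_family_Union:
  assumes "box_family \<D>"
  shows "open (\<Union>\<D>)" "bounded (\<Union>\<D>)" "\<Union>\<D> \<in> lmeasurable"
proof -
  show 1: "open (\<Union>\<D>)" using assms unfolding box_family_def by (metis open_Union open_box)
  show 2: "bounded (\<Union>\<D>)" using assms unfolding box_family_def by (metis bounded_Union bounded_box)
  show "\<Union>\<D> \<in> lmeasurable" using 1 2 by (rule lmeasurable_open[rotated])
qed

lemma measure_open_pos:
  fixes A :: "'a::euclidean_space set"
  assumes "open A" "bounded A" "A \<noteq> {}"
  shows "measure lebesgue A > 0"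
  using open_not_negligible[OF assms(1,3)] negligible_iff_measure[of A] lmeasurable_open[OF assms(2,1)]
  by (simp add: zero_less_measure_iff measure_nonneg order_neq_le_trans)

text \<open>The intermediate value theorem applies because the measure below height \<open>s\<close>
  is Lipschitz in \<open>s\<close>: moving the hyperplane sweeps a slab of a cube that contains
  \<open>B\<close>. Above the hyperplane lies the complementary measure, since a hyperplane is
  null.\<close>

lemma bounded_slab_cut:
  fixes B :: "'a::euclidean_space set"
  assumes B: "B \<in> lmeasurable" "bounded B" and i: "i \<in> Basis" and c: "0 \<le> c" "c \<le> measure lebesgue B"
  obtains s where "measure lebesgue (B \<inter> {x. x \<bullet> i < s}) = c"
    "measure lebesgue (B \<inter> {x. x \<bullet> i > s}) = measure lebesgue B - c"
proof -
  obtain N where N: "N > 0" "B \<subseteq> cbox (- N *\<^sub>R One) (N *\<^sub>R One)"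
  proof -
    obtain a where "B \<subseteq> cbox (-a) a" using bounded_subset_cbox_symmetric[OF B(2)] by blast
    moreover obtain N where "bounded B" "N > 0" "\<forall>x\<in>B. norm x \<le> N" using B(2) bounded_pos by blast
    moreover have "B \<subseteq> cbox (- N *\<^sub>R One) (N *\<^sub>R One)"
    proof
      fix x assume "x \<in> B"
      then have "\<bar>x \<bullet> j\<bar> \<le> N" if "j \<in> Basis" for j
        using Basis_le_norm[OF that, of x] \<open>\<forall>x\<in>B. norm x \<le> N\<close> by force
      then show "x \<in> cbox (- N *\<^sub>R One) (N *\<^sub>R One)" by (force simp: mem_box abs_le_iff)
    qed
    ultimately show thesis using that by blast
  qed
  let ?g = "\<lambda>s. measure lebesgue (B \<inter> {x. x \<bullet> i < s})"
  let ?C = "(2 * N) ^ card (Basis - {i})"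
  have hs: "{x::'a. x \<bullet> i < s} \<in> sets lebesgue" for s
    using open_halfspace_component_lt[of i s] by simp
  have hs': "{x::'a. x \<bullet> i > s} \<in> sets lebesgue" for s
    using open_halfspace_component_gt[of s i] by simp
  have m: "B \<inter> {x. x \<bullet> i < s} \<in> lmeasurable" "B \<inter> {x. x \<bullet> i > s} \<in> lmeasurable" for s
    using B hs hs' by (auto intro: fmeasurable_Int_fmeasurable)
  have lip: "?g t - ?g s \<le> ?C * (t - s)" "?g s \<le> ?g t" if "s \<le> t" for s t
  proof -
    let ?l = "\<Sum>j\<in>Basis. (if j = i then s else - N) *\<^sub>R j" and ?u = "\<Sum>j\<in>Basis. (if j = i then t else N) *\<^sub>R j"
    show "?g s \<le> ?g t" using m that by (intro measure_mono_fmeasurable) auto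
    have "?g t - ?g s = measure lebesgue (B \<inter> {x. x \<bullet> i < t} - B \<inter> {x. x \<bullet> i < s})"
      using m that by (subst measurable_measure_Diff) auto
    also have "\<dots> \<le> measure lebesgue (cbox ?l ?u)"
    proof (rule measure_mono_fmeasurable)
      show "B \<inter> {x. x \<bullet> i < t} - B \<inter> {x. x \<bullet> i < s} \<subseteq> cbox ?l ?u"
        using N(2) i by (auto simp: mem_box subset_iff not_less split: if_splits)
    qed (use m in auto)
    also have "\<dots> = (\<Prod>j\<in>Basis. ?u \<bullet> j - ?l \<bullet> j)"
      unfolding measure_completion[OF sets_lborel[THEN equalityD2, THEN subsetD, OF borel_closed[OF closed_cbox]]]
      using that N by (intro content_cbox) auto
    also have "\<dots> = (?u \<bullet> i - ?l \<bullet> i) * (\<Prod>j\<in>Basis - {i}. ?u \<bullet> j - ?l \<bullet> j)"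
      using i by (intro prod.remove) auto
    also have "(\<Prod>j\<in>Basis - {i}. ?u \<bullet> j - ?l \<bullet> j) = (\<Prod>j\<in>Basis - {i}. 2 * N)"
      by (intro prod.cong) auto
    finally show "?g t - ?g s \<le> ?C * (t - s)" using i by (simp add: mult.commute)
  qed
  have "?C-lipschitz_on UNIV ?g"
  proof (rule lipschitz_onI)
    fix s t :: real
    show "dist (?g s) (?g t) \<le> ?C * dist s t"
      using lip[of s t] lip[of t s] by (cases "s \<le> t") (auto simp: dist_real_def)
  qed (use N in auto)
  then have cont: "continuous_on {-N-1..N+1} ?g"
    by (rule continuous_on_subset[OF lipschitz_on_continuous_on]) auto
  \<comment> \<open>The half-spaces are open and \<open>B\<close> may touch the face of the cube at
    height \<open>N\<close>, so the upper end of the interval has to lie beyond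
    \<open>N\<close>.\<close>
  have "B \<inter> {x. x \<bullet> i < -N-1} = {}" "B \<inter> {x. x \<bullet> i < N+1} = B"
    using N i by (force simp: mem_box subset_iff)+
  then obtain s where s: "?g s = c"
    using IVT'[of ?g "-N-1" c "N+1"] cont c N by auto
  have "measure lebesgue B = measure lebesgue ((B \<inter> {x. x \<bullet> i < s} \<union> B \<inter> {x. x \<bullet> i > s}))"
  proof (rule measure_negligible_symdiff[OF B(1), symmetric])
    show "negligible ((B - (B \<inter> {x. x \<bullet> i < s} \<union> B \<inter> {x. x \<bullet> i > s})) \<union> (B \<inter> {x. x \<bullet> i < s} \<union> B \<inter> {x. x \<bullet> i > s} - B))"
      by (rule negligible_subset[OF negligible_standard_hyperplane[OF i, of s]]) auto
  qed
  also have "\<dots> = ?g s + measure lebesgue (B \<inter> {x. x \<bullet> i > s})"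
    using m by (intro measure_Un2[THEN trans]) (auto intro!: arg_cong[where f="measure lebesgue"])
  finally show thesis using that s by simp
qed

text \<open>The union of singletons is the form in which \<open>open_sums\<close> and
  \<open>bounded_sums\<close> are stated.\<close>

abbreviation (input) minkowski_sum :: "'a::euclidean_space set \<Rightarrow> 'a set \<Rightarrow> 'a set" where
  "minkowski_sum A B \<equiv> (\<Union>x\<in>A. \<Union>y\<in>B. {x + y})"

lemma measure_box_prod:
  fixes a b :: "'a::euclidean_space"
  assumes "box a b \<noteq> {}"
  shows "measure lebesgue (box a b) = (\<Prod>i\<in>Basis. b \<bullet> i - a \<bullet> i)"
  using assms by (auto simp: box_ne_empty measure_lborel_box_eq less_imp_le inner_diff_left)

lemma brunn_minkowski_box:
  fixes a b c d :: "'a::euclidean_space"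
  assumes "box a b \<noteq> {}" "box c d \<noteq> {}"
  shows "(measure_root (box a b) + measure_root (box c d)) ^ DIM('a)
    \<le> measure lebesgue (minkowski_sum (box a b) (box c d))"
proof -
  have pos: "b \<bullet> i - a \<bullet> i > 0" "d \<bullet> i - c \<bullet> i > 0" if "i \<in> Basis" for i
    using assms that by (auto simp: box_ne_empty)
  have sub: "box (a + c) (b + d) \<subseteq> minkowski_sum (box a b) (box c d)"
  proof
    fix z assume z: "z \<in> box (a + c) (b + d)"
    \<comment> \<open>In each coordinate, \<open>x\<close> takes the same relative position between
      \<open>a\<close> and \<open>b\<close> as \<open>z\<close> takes between \<open>a + c\<close>
      and \<open>b + d\<close>. Then \<open>z - x\<close> has this relative position between
      \<open>c\<close> and \<open>d\<close>.\<close>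
    define x where "x = (\<Sum>i\<in>Basis. (a \<bullet> i + (z \<bullet> i - a \<bullet> i - c \<bullet> i) / ((b \<bullet> i - a \<bullet> i) + (d \<bullet> i - c \<bullet> i)) * (b \<bullet> i - a \<bullet> i)) *\<^sub>R i)"
    have "a \<bullet> i < x \<bullet> i \<and> x \<bullet> i < b \<bullet> i \<and> c \<bullet> i < z \<bullet> i - x \<bullet> i \<and> z \<bullet> i - x \<bullet> i < d \<bullet> i" if i: "i \<in> Basis" for i
    proof -
      let ?u = "b \<bullet> i - a \<bullet> i" and ?v = "d \<bullet> i - c \<bullet> i"
      define t where "t = (z \<bullet> i - a \<bullet> i - c \<bullet> i) / (?u + ?v)"
      have t: "0 < t" "t < 1" using pos[OF i] z i by (auto simp: t_def mem_box inner_add_left field_simps)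
      have x: "x \<bullet> i = a \<bullet> i + t * ?u" using i by (simp add: x_def t_def)
      have z: "z \<bullet> i = a \<bullet> i + c \<bullet> i + t * (?u + ?v)" using pos[OF i] by (simp add: t_def)
      have "0 < t * ?u" "t * ?u < ?u" "0 < t * ?v" "t * ?v < ?v"
        using t pos[OF i] by (auto simp del: right_diff_distrib)
      then show ?thesis unfolding x z by (simp add: algebra_simps)
    qed
    then have "x \<in> box a b" "z - x \<in> box c d" by (auto simp: mem_box inner_diff_left)
    then show "z \<in> minkowski_sum (box a b) (box c d)" by (intro UN_I[of x] UN_I[of "z - x"]) simp_all
  qed
  have "(a + c) \<bullet> i < (b + d) \<bullet> i" if "i \<in> Basis" for i using pos[OF that] by (simp add: inner_add_left)
  then have ne: "box (a + c) (b + d) \<noteq> {}" by (simp add: box_ne_empty)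
  let ?p = "1 / real DIM('a)"
  have "measure_root (box a b) + measure_root (box c d) \<le> measure_root (box (a + c) (b + d))"
    unfolding measure_box_prod[OF assms(1)] measure_box_prod[OF assms(2)] measure_box_prod[OF ne]
    using geom_mean_superadditive[of "Basis :: 'a set" "\<lambda>i. b \<bullet> i - a \<bullet> i" "\<lambda>i. d \<bullet> i - c \<bullet> i"] pos
    by (simp add: inner_add_left algebra_simps)
  then have "(measure_root (box a b) + measure_root (box c d)) ^ DIM('a) \<le> measure_root (box (a + c) (b + d)) ^ DIM('a)"
    by (intro power_mono add_nonneg_nonneg powr_ge_zero)
  also have "\<dots> = measure lebesgue (box (a + c) (b + d))"
    using measure_open_pos[OF open_box bounded_box ne] by (simp add: powr_power)
  also have "\<dots> \<le> measure lebesgue (minkowski_sum (box a b) (box c d))"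
    using sub by (intro measure_mono_fmeasurable) (auto intro!: lmeasurable_open open_sums bounded_sums bounded_box open_box)
  finally show ?thesis .
qed

lemma minkowski_sum_commute: "minkowski_sum A B = minkowski_sum B A"
  by (simp add: set_eq_iff) (metis add.commute)

text \<open>Disjoint boxes have disjoint projections onto some coordinate axis. A cut at the
  separating height leaves fewer boxes on either side.\<close>

lemma box_family_separated:
  fixes \<D> :: "'a::euclidean_space set set"
  assumes "box_family \<D>" "card \<D> \<ge> 2"
  obtains i s D1 D2 where "i \<in> Basis" "D1 \<in> \<D>" "D2 \<in> \<D>" "D1 \<subseteq> {x. x \<bullet> i < s}" "D2 \<subseteq> {x. x \<bullet> i > s}"
proof -
  obtain E1 E2 where E: "E1 \<in> \<D>" "E2 \<in> \<D>" "E1 \<noteq> E2"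
  proof -
    have "finite \<D>" using assms(1) by (simp add: box_family_def)
    then have "\<not> (\<forall>x\<in>\<D>. \<forall>y\<in>\<D>. x = y)" using assms(2) card_le_Suc0_iff_eq[of \<D>] by linarith
    then show thesis using that by blast
  qed
  have "E1 \<inter> E2 = {}" using assms(1) E unfolding box_family_def disjoint_def by simp
  moreover obtain a b where a: "E1 = box a b" "E1 \<noteq> {}" using assms(1) E unfolding box_family_def by blast
  moreover obtain c d where c: "E2 = box c d" "E2 \<noteq> {}" using assms(1) E unfolding box_family_def by blast
  ultimately have ab: "E1 = box a b" "E2 = box c d" "E1 \<noteq> {}" "E2 \<noteq> {}" "E1 \<inter> E2 = {}" by auto
  then obtain i where i: "i \<in> Basis" "b \<bullet> i \<le> a \<bullet> i \<or> d \<bullet> i \<le> c \<bullet> i \<or> b \<bullet> i \<le> c \<bullet> i \<or> d \<bullet> i \<le> a \<bullet> i"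
    using disjoint_interval(4)[of a b c d] by auto
  moreover have "a \<bullet> i < b \<bullet> i" "c \<bullet> i < d \<bullet> i" using ab i(1) by (auto simp: box_ne_empty)
  ultimately have i: "i \<in> Basis" "b \<bullet> i \<le> c \<bullet> i \<or> d \<bullet> i \<le> a \<bullet> i" by auto
  show thesis
  proof (cases "b \<bullet> i \<le> c \<bullet> i")
    case True
    then have "E1 \<subseteq> {x. x \<bullet> i < b \<bullet> i}" "E2 \<subseteq> {x. x \<bullet> i > b \<bullet> i}"
      unfolding ab(1,2) using i(1) by (auto simp: mem_box intro: le_less_trans)
    then show thesis by (rule that[OF i(1) E(1,2)])
  next
    case False
    then have "d \<bullet> i \<le> a \<bullet> i" using i by blast
    then have "E2 \<subseteq> {x. x \<bullet> i < d \<bullet> i}" "E1 \<subseteq> {x. x \<bullet> i > d \<bullet> i}"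
      unfolding ab(1,2) using i(1) by (auto simp: mem_box intro: le_less_trans)
    then show thesis by (rule that[OF i(1) E(2,1)])
  qed
qed

text \<open>Homogeneity of the Brunn-Minkowski bound. It lets the bounds for two halves add up
  exactly when both sets are cut in the same proportion, and it absorbs the loss in the inner
  approximation of open sets.\<close>

lemma root_sum_power_scale:
  fixes r x y :: real
  assumes "r > 0" "x \<ge> 0" "y \<ge> 0" "d > 0"
  shows "((r * x) powr (1 / real d) + (r * y) powr (1 / real d)) ^ d = r * (x powr (1 / real d) + y powr (1 / real d)) ^ d"
proof -
  have "((r * x) powr (1 / d) + (r * y) powr (1 / d)) = r powr (1 / d) * (x powr (1 / d) + y powr (1 / d))"
    using assms by (simp add: powr_mult algebra_simps)
  then show ?thesis using assms by (simp add: power_mult_distrib powr_power)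
qed

text \<open>The Hadwiger-Ohmann cut. A hyperplane between two boxes of \<open>\<A>\<close> lowers
  the number of boxes in both halves; a parallel hyperplane cuts \<open>\<B>\<close> in the same
  proportion and does not raise its number. The sums of corresponding halves lie strictly on
  different sides of height \<open>s + t\<close>, so their measures add.\<close>

lemma brunn_minkowski_step:
  fixes \<A> \<B> :: "'a::euclidean_space set set"
  defines "BM \<equiv> \<lambda>\<A> \<B> :: 'a set set. (measure_root (\<Union>\<A>) + measure_root (\<Union>\<B>)) ^ DIM('a)
      \<le> measure lebesgue (minkowski_sum (\<Union>\<A>) (\<Union>\<B>))"
  assumes IH: "\<And>\<A>' \<B>'. \<lbrakk>box_family \<A>'; box_family \<B>'; \<A>' \<noteq> {}; \<B>' \<noteq> {}; card \<A>' + card \<B>' < card \<A> + card \<B>\<rbrakk> \<Longrightarrow> BM \<A>' \<B>'"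
    and A: "box_family \<A>" "card \<A> \<ge> 2" and B: "box_family \<B>" "\<B> \<noteq> {}"
  shows "BM \<A> \<B>"
proof -
  let ?d = "DIM('a)" and ?A = "\<Union>\<A>" and ?B = "\<Union>\<B>"
  obtain i s D1 D2 where i: "i \<in> Basis" and D: "D1 \<in> \<A>" "D2 \<in> \<A>" "D1 \<subseteq> {x. x \<bullet> i < s}" "D2 \<subseteq> {x. x \<bullet> i > s}"
    by (rule box_family_separated[OF A])
  have Dne: "D1 \<noteq> {}" "D2 \<noteq> {}" using D A by (auto simp: box_family_def)
  obtain \<A>1 where A1: "box_family \<A>1 \<and> \<Union>\<A>1 = ?A \<inter> {x. x \<bullet> i < s} \<and> card \<A>1 \<le> card \<A> \<and>
      (\<forall>D\<in>\<A>. D \<inter> {x. x \<bullet> i < s} = {} \<longrightarrow> card \<A>1 < card \<A>)"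
    using box_family_cut[OF A(1) i, of "{x. x \<bullet> i < s}" s, OF disjI1[OF refl]] by (rule exE)
  obtain \<A>2 where A2: "box_family \<A>2 \<and> \<Union>\<A>2 = ?A \<inter> {x. x \<bullet> i > s} \<and> card \<A>2 \<le> card \<A> \<and>
      (\<forall>D\<in>\<A>. D \<inter> {x. x \<bullet> i > s} = {} \<longrightarrow> card \<A>2 < card \<A>)"
    using box_family_cut[OF A(1) i, of "{x. x \<bullet> i > s}" s, OF disjI2[OF refl]] by (rule exE)
  have dis: "D2 \<inter> {x. x \<bullet> i < s} = {}" "D1 \<inter> {x. x \<bullet> i > s} = {}" using D(3,4) by fastforce+
  have "card \<A>1 < card \<A>" using bspec[OF conjunct2[OF conjunct2[OF conjunct2[OF A1]]] D(2)] dis by simp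
  moreover have "card \<A>2 < card \<A>" using bspec[OF conjunct2[OF conjunct2[OF conjunct2[OF A2]]] D(1)] dis by simp
  ultimately have A1: "box_family \<A>1" "\<Union>\<A>1 = ?A \<inter> {x. x \<bullet> i < s}" "card \<A>1 < card \<A>"
    and A2: "box_family \<A>2" "\<Union>\<A>2 = ?A \<inter> {x. x \<bullet> i > s}" "card \<A>2 < card \<A>"
    using A1 A2 by simp_all
  have mA: "?A \<in> lmeasurable" "bounded ?A" and mB: "?B \<in> lmeasurable" "bounded ?B"
    using box_family_Union A B by auto
  have "\<Union>\<A>1 \<noteq> {}" "\<Union>\<A>2 \<noteq> {}" using A1 A2 D Dne by blast+
  then have pos: "measure lebesgue (\<Union>\<A>1) > 0" "measure lebesgue (\<Union>\<A>2) > 0"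
    using measure_open_pos box_family_Union A1 A2 by blast+
  have Bne: "?B \<noteq> {}" using B by (auto simp: box_family_def)
  then have posB: "measure lebesgue ?B > 0" using measure_open_pos box_family_Union B by blast
  have "?A \<noteq> {}" using Dne D by auto
  then have posA: "measure lebesgue ?A > 0" using measure_open_pos box_family_Union A by blast
  have sumA: "measure lebesgue (\<Union>\<A>1) + measure lebesgue (\<Union>\<A>2) = measure lebesgue ?A"
  proof -
    have "measure lebesgue ?A = measure lebesgue (\<Union>\<A>1 \<union> \<Union>\<A>2)"
    proof (rule measure_negligible_symdiff[OF mA(1), symmetric])
      show "negligible (sym_diff ?A (\<Union>\<A>1 \<union> \<Union>\<A>2))"
        by (rule negligible_subset[OF negligible_standard_hyperplane[OF i, of s]]) (auto simp: A1 A2)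
    qed
    also have "\<dots> = measure lebesgue (\<Union>\<A>1) + measure lebesgue (\<Union>\<A>2)"
    proof -
      have "\<Union>\<A>1 \<inter> \<Union>\<A>2 = {}" unfolding A1(2) A2(2) by auto
      then show ?thesis
        using box_family_Union(3)[OF A1(1)] box_family_Union(3)[OF A2(1)] by (simp add: measure_Un3)
    qed
    finally show ?thesis by simp
  qed
  define l where "l = measure lebesgue (\<Union>\<A>1) / measure lebesgue ?A"
  have l: "0 < l" "l < 1" "measure lebesgue (\<Union>\<A>1) = l * measure lebesgue ?A"
    using pos posA sumA by (auto simp: l_def)
  then have l': "measure lebesgue (\<Union>\<A>2) = (1 - l) * measure lebesgue ?A"
    using sumA by (simp add: left_diff_distrib)
  \<comment> \<open>The proportion \<open>l\<close> is copied from \<open>\<A>\<close>: with unequal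
    proportions the two inductive bounds would not recombine to the bound for the whole
    sets.\<close>
  obtain t where t: "measure lebesgue (?B \<inter> {x. x \<bullet> i < t}) = l * measure lebesgue ?B"
    "measure lebesgue (?B \<inter> {x. x \<bullet> i > t}) = (1 - l) * measure lebesgue ?B"
    using bounded_slab_cut[OF mB i, of "l * measure lebesgue ?B"] l posB by (auto simp: algebra_simps)
  obtain \<B>1 where "box_family \<B>1 \<and> \<Union>\<B>1 = ?B \<inter> {x. x \<bullet> i < t} \<and> card \<B>1 \<le> card \<B> \<and>
      (\<forall>D\<in>\<B>. D \<inter> {x. x \<bullet> i < t} = {} \<longrightarrow> card \<B>1 < card \<B>)"
    using box_family_cut[OF B(1) i, of "{x. x \<bullet> i < t}" t, OF disjI1[OF refl]] by (rule exE)
  then have B1: "box_family \<B>1" "\<Union>\<B>1 = ?B \<inter> {x. x \<bullet> i < t}" "card \<B>1 \<le> card \<B>" by simp_all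
  obtain \<B>2 where "box_family \<B>2 \<and> \<Union>\<B>2 = ?B \<inter> {x. x \<bullet> i > t} \<and> card \<B>2 \<le> card \<B> \<and>
      (\<forall>D\<in>\<B>. D \<inter> {x. x \<bullet> i > t} = {} \<longrightarrow> card \<B>2 < card \<B>)"
    using box_family_cut[OF B(1) i, of "{x. x \<bullet> i > t}" t, OF disjI2[OF refl]] by (rule exE)
  then have B2: "box_family \<B>2" "\<Union>\<B>2 = ?B \<inter> {x. x \<bullet> i > t}" "card \<B>2 \<le> card \<B>" by simp_all
  have ne: "\<A>1 \<noteq> {}" "\<A>2 \<noteq> {}" "\<B>1 \<noteq> {}" "\<B>2 \<noteq> {}"
    using pos posB l t B1(2) B2(2) by auto

  let ?S1 = "minkowski_sum (\<Union>\<A>1) (\<Union>\<B>1)" and ?S2 = "minkowski_sum (\<Union>\<A>2) (\<Union>\<B>2)"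
  have S: "minkowski_sum (\<Union>\<C>) (\<Union>\<D>) \<in> lmeasurable" if "box_family \<C>" "box_family \<D>" for \<C> \<D> :: "'a set set"
    using box_family_Union[OF that(1)] box_family_Union[OF that(2)]
    by (intro lmeasurable_open open_sums bounded_sums) auto
  have "(measure_root ?A + measure_root ?B) ^ ?d
      = l * (measure_root ?A + measure_root ?B) ^ ?d + (1 - l) * (measure_root ?A + measure_root ?B) ^ ?d"
    by (simp add: algebra_simps)
  also have "\<dots> = (measure_root (\<Union>\<A>1) + measure_root (\<Union>\<B>1)) ^ ?d + (measure_root (\<Union>\<A>2) + measure_root (\<Union>\<B>2)) ^ ?d"
    using l l' t by (simp add: root_sum_power_scale B1 B2)
  also have "\<dots> \<le> measure lebesgue ?S1 + measure lebesgue ?S2"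
    using IH[OF A1(1) B1(1) ne(1,3)] IH[OF A2(1) B2(1) ne(2,4)] A1(3) A2(3) B1(3) B2(3)
    unfolding BM_def by (intro add_mono) linarith+
  also have "\<dots> = measure lebesgue (?S1 \<union> ?S2)"
  proof -
    have "x \<bullet> i < s + t" if "x \<in> ?S1" for x using that A1(2) B1(2) by (auto simp: inner_add_left intro: add_strict_mono)
    moreover have "x \<bullet> i > s + t" if "x \<in> ?S2" for x using that A2(2) B2(2) by (auto simp: inner_add_left intro: add_strict_mono)
    ultimately have "?S1 \<inter> ?S2 = {}" by (metis (no_types, lifting) Int_emptyI less_asym)
    then show ?thesis
      by (simp only: measure_Un3[OF S[OF A1(1) B1(1)] S[OF A2(1) B2(1)]] measure_empty diff_zero)
  qed
  also have "\<dots> \<le> measure lebesgue (minkowski_sum ?A ?B)"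
  proof (rule measure_mono_fmeasurable)
    have sub: "\<Union>\<A>1 \<subseteq> ?A" "\<Union>\<A>2 \<subseteq> ?A" "\<Union>\<B>1 \<subseteq> ?B" "\<Union>\<B>2 \<subseteq> ?B"
      unfolding A1(2) A2(2) B1(2) B2(2) by simp_all
    show "?S1 \<union> ?S2 \<subseteq> minkowski_sum ?A ?B"
      by (intro Un_least UN_mono sub subset_refl)
    show "?S1 \<union> ?S2 \<in> sets lebesgue"
      by (intro sets.Un fmeasurableD S A1(1) A2(1) B1(1) B2(1))
    show "minkowski_sum ?A ?B \<in> lmeasurable" by (rule S[OF A(1) B(1)])
  qed
  finally show ?thesis unfolding BM_def .
qed

lemma brunn_minkowski_boxes:
  fixes \<A> \<B> :: "'a::euclidean_space set set"
  assumes "box_family \<A>" "\<A> \<noteq> {}" "box_family \<B>" "\<B> \<noteq> {}"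
  shows "(measure_root (\<Union>\<A>) + measure_root (\<Union>\<B>)) ^ DIM('a)
      \<le> measure lebesgue (minkowski_sum (\<Union>\<A>) (\<Union>\<B>))"
  using assms
proof (induction "card \<A> + card \<B>" arbitrary: \<A> \<B> rule: less_induct)
  case less
  have fin: "card \<A> > 0" "card \<B> > 0" using less.prems by (auto simp: box_family_def card_gt_0_iff)
  consider "card \<A> \<ge> 2" | "card \<B> \<ge> 2" | "card \<A> = 1" "card \<B> = 1" using fin by linarith
  then show ?case
  proof cases
    case 1
    show ?thesis by (rule brunn_minkowski_step) (use less 1 in auto)
  next
    case 2
    have "(measure_root (\<Union>\<B>) + measure_root (\<Union>\<A>)) ^ DIM('a)
      \<le> measure lebesgue (minkowski_sum (\<Union>\<B>) (\<Union>\<A>))"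
      by (rule brunn_minkowski_step) (use less 2 in \<open>auto simp: add.commute\<close>)
    then show ?thesis by (subst minkowski_sum_commute) (simp only: add.commute)
  next
    case 3
    then obtain D E where DE: "\<A> = {D}" "\<B> = {E}" by (auto simp: card_1_singleton_iff)
    then have "\<exists>a b. D = box a b" "\<exists>c d. E = box c d" "D \<noteq> {}" "E \<noteq> {}" using less.prems by (simp_all add: box_family_def)
    then obtain a b c d where "D = box a b" "E = box c d" "D \<noteq> {}" "E \<noteq> {}" by blast
    then have *: "box a b \<noteq> {}" "box c d \<noteq> {}" "D = box a b" "E = box c d" by auto
    show ?thesis
      using brunn_minkowski_box[OF *(1,2)] unfolding DE ccpo_Sup_singleton *(3,4) .
  qed
qed

text \<open>\<open>A\<close> is a countable union of closed boxes with disjoint interiors. The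
  interiors miss only a countable union of box boundaries, which is null, so finitely many of them
  already carry measure more than \<open>c\<close>.\<close>

lemma open_inner_box_family:
  fixes A :: "'a::euclidean_space set"
  assumes A: "open A" "bounded A" "A \<noteq> {}" and c: "c < measure lebesgue A"
  shows "\<exists>\<E>. box_family \<E> \<and> \<Union>\<E> \<subseteq> A \<and> c < measure lebesgue (\<Union>\<E>)"
proof -
  obtain a where a: "A \<subseteq> box (-a) a" using bounded_subset_box_symmetric[OF A(2)] by blast
  then have ne: "box (-a) a \<noteq> {}" using A(3) by auto
  have Aa: "A \<subseteq> cbox (-a) a" using a box_subset_cbox by blast
  \<comment> \<open>With this gauge, the condition of \<open>covering_lemma\<close> on the tags,
    which lie in \<open>A\<close>, says that every box of the covering is contained in
    \<open>A\<close>.\<close>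
  have gauge: "gauge (\<lambda>x. if x \<in> A then A else UNIV)"
    using A(1) by (auto simp: gauge_def)
  obtain \<D> where D: "countable \<D>" "\<Union>\<D> \<subseteq> cbox (-a) a"
    "\<And>K. K \<in> \<D> \<Longrightarrow> interior K \<noteq> {} \<and> (\<exists>c d. K = cbox c d)"
    "pairwise (\<lambda>A B. interior A \<inter> interior B = {}) \<D>"
    "\<And>K. K \<in> \<D> \<Longrightarrow> \<exists>x \<in> A \<inter> K. K \<subseteq> (if x \<in> A then A else UNIV)"
    "\<And>u v. cbox u v \<in> \<D> \<Longrightarrow> \<exists>n. \<forall>i \<in> Basis. v \<bullet> i - u \<bullet> i = (a \<bullet> i - (-a) \<bullet> i) / 2^n"
    "A \<subseteq> \<Union>\<D>"
    by (rule covering_lemma[OF Aa ne gauge], rule that)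
  have "K \<subseteq> A" if "K \<in> \<D>" for K using D(5)[OF that] by auto
  then have DA: "\<Union>\<D> = A" using D(7) by (intro equalityI Union_least)
  have Dne: "\<D> \<noteq> {}" using DA A(3) by auto
  \<comment> \<open>If \<open>\<D>\<close> is finite, the enumeration \<open>from_nat_into\<close>
    repeats boxes. As \<open>\<F> n\<close> is a set of boxes, repetitions do not spoil
    disjointness.\<close>
  define \<F> where "\<F> n = interior ` (from_nat_into \<D> ` {..n})" for n :: nat
  have in\<D>: "from_nat_into \<D> n \<in> \<D>" for n using Dne by (rule from_nat_into)
  have fam: "box_family (\<F> n)" for n
    unfolding box_family_def
  proof (intro conjI ballI)
    show "finite (\<F> n)" by (simp add: \<F>_def)
    show "disjoint (\<F> n)"
      unfolding disjoint_def
    proof (intro ballI impI)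
      fix K L assume "K \<in> \<F> n" "L \<in> \<F> n" and ne: "K \<noteq> L"
      then obtain k l where "K = interior (from_nat_into \<D> k)" "L = interior (from_nat_into \<D> l)"
        by (auto simp: \<F>_def)
      moreover from this ne have "from_nat_into \<D> k \<noteq> from_nat_into \<D> l" by auto
      ultimately show "K \<inter> L = {}" using pairwiseD[OF D(4) in\<D> in\<D>] by simp
    qed
    fix K assume "K \<in> \<F> n"
    then obtain k where "K = interior (from_nat_into \<D> k)" by (auto simp: \<F>_def)
    moreover obtain c d where "from_nat_into \<D> k = cbox c d" using D(3)[OF in\<D>[of k]] by (elim conjE exE)
    ultimately have "K = box c d" by simp
    then show "\<exists>a b. K = box a b" by (intro exI)
    show "K \<noteq> {}" using D(3)[OF in\<D>[of k]] \<open>K = interior _\<close> by simp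
  qed
  let ?U = "\<Union>n. \<Union>(\<F> n)"
  have U: "?U = (\<Union>K\<in>\<D>. interior K)"
  proof -
    have "(\<Union>K\<in>\<D>. interior K) = (\<Union>K\<in>range (from_nat_into \<D>). interior K)"
      by (simp only: range_from_nat_into[OF Dne D(1)])
    also have "\<dots> = (\<Union>n. interior (from_nat_into \<D> n))" by (simp only: image_image)
    also have "\<dots> = (\<Union>n. \<Union>k\<in>{..n}. interior (from_nat_into \<D> k))" by auto
    finally show ?thesis by (simp only: \<F>_def image_image)
  qed
  have "interior K \<subseteq> A" if "K \<in> \<D>" for K
    using interior_subset[of K] Union_upper[OF that] unfolding DA by (rule subset_trans)
  then have sub: "?U \<subseteq> A" unfolding U by (rule UN_least)
  have "A - ?U \<subseteq> (\<Union>K\<in>\<D>. frontier K)"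
  proof
    fix x assume "x \<in> A - ?U"
    then have "x \<in> \<Union>\<D>" "x \<notin> (\<Union>K\<in>\<D>. interior K)" unfolding DA U by simp_all
    then obtain K where "K \<in> \<D>" "x \<in> K" "x \<notin> interior K" by auto
    then show "x \<in> (\<Union>K\<in>\<D>. frontier K)"
      using closure_subset[of K] unfolding frontier_def by (intro UN_I[of K] DiffI) (auto)
  qed
  moreover have "negligible (\<Union>K\<in>\<D>. frontier K)"
  proof (rule negligible_countable_Union)
    show "countable (frontier ` \<D>)" using D(1) by simp
    show "negligible T" if "T \<in> frontier ` \<D>" for T
      using that D(3) by (auto intro!: negligible_convex_frontier) (metis convex_box(1))
  qed
  ultimately have "negligible (sym_diff A ?U)" using sub by (metis Diff_eq_empty_iff negligible_subset sup_bot.right_neutral)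
  then have mU: "measure lebesgue ?U = measure lebesgue A"
    using measure_negligible_symdiff lmeasurable_open[OF A(2,1)] by blast
  have "(\<lambda>n. measure lebesgue (\<Union>(\<F> n))) \<longlonglongrightarrow> measure lebesgue ?U"
  proof (rule Lim_measure_incseq)
    show "range (\<lambda>n. \<Union>(\<F> n)) \<subseteq> sets lebesgue" using box_family_Union(3)[OF fam] by auto
    show "incseq (\<lambda>n. \<Union>(\<F> n))" by (force simp: incseq_def \<F>_def)
    have "open ?U" using box_family_Union(1)[OF fam] by (intro open_UN) simp
    moreover have "bounded ?U" by (rule bounded_subset[OF A(2) sub])
    ultimately have "?U \<in> lmeasurable" by (simp add: lmeasurable_open)
    then show "emeasure lebesgue ?U \<noteq> \<infinity>" by (auto simp: fmeasurable_def simp del: emeasure_completion)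
  qed
  then have "\<forall>\<^sub>F n in sequentially. c < measure lebesgue (\<Union>(\<F> n))"
    using c mU by (auto dest: order_tendstoD)
  then obtain n where "c < measure lebesgue (\<Union>(\<F> n))"
    using eventually_happens trivial_limit_sequentially by blast
  moreover have "\<Union>(\<F> n) \<subseteq> A" using UN_upper[of n UNIV "\<lambda>n. \<Union>(\<F> n)"] sub by simp
  ultimately show ?thesis using fam[of n] by (intro exI conjI)
qed

lemma brunn_minkowski_open:
  fixes A B :: "'a::euclidean_space set"
  assumes A: "open A" "bounded A" "A \<noteq> {}" and B: "open B" "bounded B" "B \<noteq> {}"
  shows "(measure_root A + measure_root B) ^ DIM('a) \<le> measure lebesgue (minkowski_sum A B)"
proof (rule field_le_mult_one_interval)
  \<comment> \<open>Inner box families reach the measures of \<open>A\<close> and \<open>B\<close>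
    only up to a factor \<open>t < 1\<close>; by homogeneity the same factor then multiplies the
    whole bound.\<close>
  fix t :: real assume t: "0 < t" "t < 1"
  have pos: "measure lebesgue A > 0" "measure lebesgue B > 0"
    by (rule measure_open_pos[OF A] measure_open_pos[OF B])+
  have lt: "t * x < x" if "x > 0" for x :: real using t that by simp
  obtain \<A> where \<A>: "box_family \<A> \<and> \<Union>\<A> \<subseteq> A \<and> t * measure lebesgue A < measure lebesgue (\<Union>\<A>)"
    using open_inner_box_family[OF A, of "t * measure lebesgue A", OF lt[OF pos(1)]] by (rule exE)
  obtain \<B> where \<B>: "box_family \<B> \<and> \<Union>\<B> \<subseteq> B \<and> t * measure lebesgue B < measure lebesgue (\<Union>\<B>)"
    using open_inner_box_family[OF B, of "t * measure lebesgue B", OF lt[OF pos(2)]] by (rule exE)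
  have "0 < t * measure lebesgue A" "0 < t * measure lebesgue B"
    by (rule mult_pos_pos[OF t(1) pos(1)] mult_pos_pos[OF t(1) pos(2)])+
  then have ne: "\<A> \<noteq> {}" "\<B> \<noteq> {}" using \<A> \<B> by auto
  have "t * (measure_root A + measure_root B) ^ DIM('a)
      = ((t * measure lebesgue A) powr (1 / DIM('a)) + (t * measure lebesgue B) powr (1 / DIM('a))) ^ DIM('a)"
    using t pos by (intro root_sum_power_scale[symmetric]) auto
  also have "\<dots> \<le> (measure_root (\<Union>\<A>) + measure_root (\<Union>\<B>)) ^ DIM('a)"
    using \<A> \<B> t pos by (intro power_mono add_mono powr_mono2) auto
  also have "\<dots> \<le> measure lebesgue (minkowski_sum (\<Union>\<A>) (\<Union>\<B>))"
    using \<A> \<B> ne by (intro brunn_minkowski_boxes) auto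
  also have "\<dots> \<le> measure lebesgue (minkowski_sum A B)"
  proof (rule measure_mono_fmeasurable)
    show "minkowski_sum (\<Union>\<A>) (\<Union>\<B>) \<subseteq> minkowski_sum A B"
      using \<A> \<B> by (intro UN_mono) auto
    show "minkowski_sum (\<Union>\<A>) (\<Union>\<B>) \<in> sets lebesgue"
      using \<A> \<B> box_family_Union(1) by (intro fmeasurableD lmeasurable_open open_sums bounded_sums box_family_Union disjI1) auto
    show "minkowski_sum A B \<in> lmeasurable"
      using A B by (intro lmeasurable_open bounded_sums open_sums) auto
  qed
  finally show "t * (measure_root A + measure_root B) ^ DIM('a) \<le> measure lebesgue (minkowski_sum A B)" .
qed

section \<open>Total variation bounded below through superlevel sets\<close>

lemma power_add_ge_first_order:
  fixes a e :: real
  assumes "a \<ge> 0" "e \<ge> 0"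
  shows "(a + e) ^ n \<ge> a ^ n + n * a ^ (n - 1) * e"
proof (induction n)
  case (Suc n)
  have "a ^ Suc n + Suc n * a ^ n * e \<le> (a ^ n + n * a ^ (n - 1) * e) * (a + e)"
  proof (cases n)
    case (Suc k)
    have "0 \<le> n * a ^ (n - 1) * e * e" using assms by simp
    then show ?thesis using Suc by (simp add: algebra_simps)
  qed (simp add: algebra_simps)
  also have "\<dots> \<le> (a + e) ^ n * (a + e)" using Suc assms by (intro mult_right_mono) auto
  finally show ?case by (simp add: mult.commute)
qed simp

lemma powr_inverse_power:
  fixes x :: real
  assumes "x \<ge> 0" "n > 0"
  shows "(x powr (1 / real n)) ^ n = x" "(x ^ n) powr (1 / real n) = x"
proof -
  show "(x powr (1 / real n)) ^ n = x"
    using assms by (cases "x = 0") (simp_all add: powr_powr flip: powr_realpow)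
  show "(x ^ n) powr (1 / real n) = x"
    using assms by (cases "x = 0") (simp_all add: powr_powr flip: powr_realpow)
qed

lemma measure_ball:
  fixes c :: "'a::euclidean_space"
  assumes "r \<ge> 0"
  shows "measure lebesgue (ball c r) = unit_ball_vol (real DIM('a)) * r ^ DIM('a)"
  using content_ball[OF assms, of c] by simp

text \<open>Brunn-Minkowski against a small ball, expanded to first order in
  \<open>\<epsilon>\<close>, where the coefficient is the surface area of a ball. The radius
  \<open>r\<close> may be any number up to the volume radius of \<open>A\<close>, so one constant
  serves for all superlevel sets that contain a fixed set.\<close>

lemma measure_add_ball_ge:
  fixes A :: "'a::euclidean_space set"
  assumes A: "open A" "bounded A" and r: "r > 0" "unit_ball_vol (real DIM('a)) * r ^ DIM('a) \<le> measure lebesgue A" and "\<epsilon> > 0"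
  shows "measure lebesgue A + DIM('a) * unit_ball_vol (real DIM('a)) * r ^ (DIM('a) - 1) * \<epsilon>
    \<le> measure lebesgue (minkowski_sum A (ball 0 \<epsilon>))"
proof -
  let ?d = "DIM('a)" and ?w = "unit_ball_vol (real DIM('a))"
  have w: "?w > 0" by (rule unit_ball_vol_pos) simp
  then have w0: "?w \<noteq> 0" by linarith
  have pos: "0 < ?w * r ^ ?d" using r w by simp
  then have mA: "measure lebesgue A > 0" using r by linarith
  then have ne: "A \<noteq> {}" by auto
  define a where "a = (measure lebesgue A / ?w) powr (1 / ?d)"
  have "a ^ ?d = measure lebesgue A / ?w" unfolding a_def
    by (rule powr_inverse_power) (use w mA in auto)
  then have a: "?w * a ^ ?d = measure lebesgue A" using w0 by (simp del: measure_completion)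
  have "r = (r ^ ?d) powr (1 / ?d)" using r by (simp add: powr_inverse_power)
  also have "\<dots> \<le> a" unfolding a_def using r w by (intro powr_mono2) (auto simp: field_simps)
  finally have ra: "r \<le> a" .
  have "measure lebesgue A + ?d * ?w * r ^ (?d - 1) * \<epsilon> \<le> ?w * (a ^ ?d + ?d * a ^ (?d - 1) * \<epsilon>)"
  proof -
    have "?d * ?w * \<epsilon> * r ^ (?d - 1) \<le> ?d * ?w * \<epsilon> * a ^ (?d - 1)"
      using ra r w assms by (intro mult_left_mono power_mono) auto
    then show ?thesis using a by (simp add: algebra_simps)
  qed
  also have "\<dots> \<le> ?w * (a + \<epsilon>) ^ ?d"
    using w ra r assms by (intro mult_left_mono power_add_ge_first_order) auto
  also have "\<dots> = (measure_root A + measure_root (ball (0::'a) \<epsilon>)) ^ ?d"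
  proof -
    have 1: "measure_root A = ?w powr (1 / ?d) * a"
    proof -
      have "?w powr (1 / ?d) \<noteq> 0" using w0 by (metis powr_eq_0_iff)
      moreover have "a = measure_root A / ?w powr (1 / ?d)"
        unfolding a_def by (rule powr_divide)
      ultimately show ?thesis by (metis nonzero_mult_div_cancel_left times_divide_eq_right)
    qed
    have "(?w * \<epsilon> ^ ?d) powr (1 / ?d) = ?w powr (1 / ?d) * ((\<epsilon> ^ ?d) powr (1 / ?d))"
      using w assms by (simp add: powr_mult)
    also have "(\<epsilon> ^ ?d) powr (1 / ?d) = \<epsilon>"
      using assms by (simp add: powr_inverse_power)
    finally have 2: "measure_root (ball (0::'a) \<epsilon>) = ?w powr (1 / ?d) * \<epsilon>"
      using assms by (simp only: measure_ball less_imp_le)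
    have "?w powr (1 / ?d) * a + ?w powr (1 / ?d) * \<epsilon> = ?w powr (1 / ?d) * (a + \<epsilon>)"
      by (simp add: algebra_simps)
    moreover have "(?w powr (1 / ?d)) ^ ?d = ?w" using w by (simp add: powr_inverse_power)
    ultimately show ?thesis unfolding 1 2 by (simp only: power_mult_distrib)
  qed
  also have "\<dots> \<le> measure lebesgue (minkowski_sum A (ball 0 \<epsilon>))"
    using assms ne by (intro brunn_minkowski_open) auto
  finally show ?thesis .
qed

lemma layer_cake:
  fixes f :: "'a::euclidean_space \<Rightarrow> real"
  assumes [measurable]: "f \<in> borel_measurable lborel"
  shows "(\<integral>\<^sup>+x. ennreal (f x) \<partial>lborel) = (\<integral>\<^sup>+t. emeasure lborel {x. t < f x} * indicator {0<..} t \<partial>lborel)"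
proof -

  have "(\<integral>\<^sup>+x. ennreal (f x) \<partial>lborel) = (\<integral>\<^sup>+x. \<integral>\<^sup>+t. indicator {0<..} t * indicator {p. snd p < f (fst p)} (x, t) \<partial>lborel \<partial>lborel)"
  proof (rule nn_integral_cong)
    fix x :: 'a
    have "(\<integral>\<^sup>+t. indicator {0<..} t * indicator {p. snd p < f (fst p)} (x, t) \<partial>lborel) = (\<integral>\<^sup>+t. indicator {0<..<f x} t \<partial>lborel)"
      by (intro nn_integral_cong) (auto simp: indicator_def)
    also have "\<dots> = ennreal (f x)" by (cases "f x \<ge> 0") (auto simp: ennreal_neg)
    finally show "ennreal (f x) = (\<integral>\<^sup>+t. indicator {0<..} t * indicator {p. snd p < f (fst p)} (x, t) \<partial>lborel)" ..
  qed
  also have "\<dots> = (\<integral>\<^sup>+t. \<integral>\<^sup>+x. indicator {0<..} t * indicator {p. snd p < f (fst p)} (x, t) \<partial>lborel \<partial>lborel)"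
    by (rule lborel_pair.Fubini'[symmetric]) measurable
  also have "\<dots> = (\<integral>\<^sup>+t. emeasure lborel {x. t < f x} * indicator {0<..} t \<partial>lborel)"
  proof (rule nn_integral_cong)
    fix t :: real
    have "(\<integral>\<^sup>+x. indicator {0<..} t * indicator {p. snd p < f (fst p)} (x, t) \<partial>lborel)
       = indicator {0<..} t * (\<integral>\<^sup>+x. indicator {x. t < f x} x \<partial>lborel)"
      by (subst nn_integral_cmult[symmetric]) (auto simp: indicator_def intro!: nn_integral_cong)
    then show "(\<integral>\<^sup>+x. indicator {0<..} t * indicator {p. snd p < f (fst p)} (x, t) \<partial>lborel)
       = emeasure lborel {x. t < f x} * indicator {0<..} t"
      by (simp add: mult.commute)
  qed
  finally show ?thesis .
qed

text \<open>This replaces the coarea formula. The function \<open>h\<close> in the proof adds to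
  \<open>f\<close> what it can gain within distance \<open>\<epsilon>\<close>, so the level set
  \<open>{x. t < h x}\<close> contains the \<open>\<epsilon>\<close>-neighbourhood of
  \<open>{x. t < f x}\<close>. For \<open>0 < t < 1\<close> the latter contains \<open>C\<close>,
  and the measure grows by at least \<open>?c * \<epsilon>\<close>. Integration over
  \<open>t\<close>, division by \<open>\<epsilon>\<close> and the limit \<open>\<epsilon>\<close> to
  0 give the claim.\<close>

lemma integral_gradient_ge:
  fixes f :: "'a::euclidean_space \<Rightarrow> real" and g :: "'a \<Rightarrow> 'a"
  assumes cont: "continuous_on UNIV f" "continuous_on UNIV g"
    and supp: "\<And>x. norm x > R \<Longrightarrow> f x = 0" "\<And>x. norm x > R \<Longrightarrow> g x = 0"
    and nonneg: "\<And>x. f x \<ge> 0" and "L \<ge> 0" "R \<ge> 0"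
    and taylor: "\<And>x y. \<bar>f y - f x - g x \<bullet> (y - x)\<bar> \<le> L * (norm (y - x))\<^sup>2"
    and C: "C \<in> lmeasurable" "\<And>x. x \<in> C \<Longrightarrow> f x \<ge> 1" "unit_ball_vol (real DIM('a)) * r ^ DIM('a) \<le> measure lebesgue C" "r > 0"
  shows "DIM('a) * unit_ball_vol (real DIM('a)) * r ^ (DIM('a) - 1) \<le> (\<integral>x. norm (g x) \<partial>lborel)"
proof -
  let ?c = "DIM('a) * unit_ball_vol (real DIM('a)) * r ^ (DIM('a) - 1)"
  let ?V = "measure lborel (cball (0::'a) (R + 1))"
  have w: "unit_ball_vol (real DIM('a)) > 0" by (rule unit_ball_vol_pos) simp
  have [measurable]: "f \<in> borel_measurable borel" "g \<in> borel_measurable borel"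
    using cont by (auto intro: borel_measurable_continuous_onI)
  have [measurable]: "cball (0::'a) (R + 1) \<in> sets borel" by simp
  have [simp]: "emeasure lborel (cball (0::'a) (R + 1)) < top"
    using emeasure_lborel_cball_finite[of "0::'a" "R + 1"] by simp
  have int: "integrable lborel u" if "continuous_on UNIV u" "\<And>x. norm x > R \<Longrightarrow> u x = 0" for u :: "'a \<Rightarrow> real"
  proof -
    have "integrable lborel (\<lambda>x. indicator (cball 0 R) x *\<^sub>R u x)"
      using that(1) continuous_on_subset by (intro borel_integrable_compact) auto
    moreover have "(\<lambda>x. indicator (cball 0 R) x *\<^sub>R u x) = u"
      using that(2) by (auto simp: fun_eq_iff indicator_def)
    ultimately show ?thesis by simp
  qed
  have intf: "integrable lborel f" and intg: "integrable lborel (\<lambda>x. norm (g x))"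
    using supp cont by (auto intro!: int continuous_intros)
  have main: "?c \<le> (\<integral>x. norm (g x) \<partial>lborel) + L * \<epsilon> * ?V" if \<epsilon>: "0 < \<epsilon>" "\<epsilon> < 1" for \<epsilon>
  proof -
    \<comment> \<open>The error \<open>L * \<epsilon>\<close> is cut off by an indicator to keep
      \<open>h\<close> integrable. Radius \<open>R + 1\<close> suffices since
      \<open>\<epsilon> < 1\<close> and \<open>f\<close> vanishes beyond \<open>R\<close>.\<close>
    define h where "h x = f x + \<epsilon> * (norm (g x) + L * \<epsilon> * indicator (cball 0 (R + 1)) x)" for x
    have [measurable]: "h \<in> borel_measurable borel" unfolding h_def by measurable
    have inth: "integrable lborel h"
      unfolding h_def using intf intg
      by (intro Bochner_Integration.integrable_add integrable_mult_right integrable_real_indicator) auto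
    have sub: "minkowski_sum {x. t < f x} (ball 0 \<epsilon>) \<subseteq> {x. t < h x}" if t: "t > 0" for t
    proof clarify
      fix x y :: 'a assume x: "t < f x" and y: "y \<in> ball 0 \<epsilon>"
      have "norm x \<le> R" using supp(1)[of x] x t by force
      then have xy: "x + y \<in> cball 0 (R + 1)" using norm_triangle_ineq[of x y] y \<epsilon> by simp
      \<comment> \<open>The expansion is taken at the shifted point \<open>x + y\<close>, so that
        the gradient appears where \<open>h\<close> is evaluated.\<close>
      have "g (x + y) \<bullet> (- y) \<ge> - (norm (g (x + y)) * norm y)"
        using Cauchy_Schwarz_ineq2[of "g (x + y)" y] by (simp add: abs_le_iff)
      moreover have "f x - f (x + y) - g (x + y) \<bullet> (x - (x + y)) \<le> L * (norm y)\<^sup>2"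
        using taylor[of x "x + y"] by (simp add: abs_le_iff)
      moreover have "norm (g (x + y)) * norm y \<le> norm (g (x + y)) * \<epsilon>" using y by (intro mult_left_mono) auto
      moreover have "L * (norm y)\<^sup>2 \<le> L * \<epsilon>\<^sup>2" using y \<open>L \<ge> 0\<close> by (intro mult_left_mono power_mono) auto
      ultimately have "f x \<le> f (x + y) + \<epsilon> * norm (g (x + y)) + L * \<epsilon>\<^sup>2"
        using Cauchy_Schwarz_ineq2[of "g (x + y)" y] by (simp add: abs_le_iff mult.commute)
      also have "\<dots> = h (x + y)" using xy by (simp add: h_def algebra_simps power2_eq_square)
      finally show "t < h (x + y)" using x by simp
    qed
    have opn: "open {x. t < f x}" for t using cont by (intro open_Collect_less) auto
    have bnd: "bounded {x. t < f x}" if "t > 0" for t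
      using supp(1) that by (intro boundedI[of _ R]) (metis mem_Collect_eq less_asym not_le)
    have level: "emeasure lborel {x. t < f x} + ennreal (?c * \<epsilon>) * indicator {..<1} t \<le> emeasure lborel {x. t < h x}" if t: "t > 0" for t
    proof (cases "t < 1")
      case True
      have A: "{x. t < f x} \<in> lmeasurable" using opn bnd t by (intro lmeasurable_open) auto
      have "C \<subseteq> {x. t < f x}" using C(2) True by force
      then have "measure lebesgue C \<le> measure lebesgue {x. t < f x}"
        using A C(1) by (intro measure_mono_fmeasurable) auto
      then have "measure lebesgue {x. t < f x} + ?c * \<epsilon> \<le> measure lebesgue (minkowski_sum {x. t < f x} (ball 0 \<epsilon>))"
        using C \<epsilon> opn bnd[OF t] by (intro measure_add_ball_ge) auto
      then have "ennreal (measure lebesgue {x. t < f x} + ?c * \<epsilon>) \<le> ennreal (measure lebesgue (minkowski_sum {x. t < f x} (ball 0 \<epsilon>)))"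
        by (rule ennreal_leI)
      also have "\<dots> = emeasure lebesgue (minkowski_sum {x. t < f x} (ball 0 \<epsilon>))"
        using opn bnd[OF t] by (intro emeasure_eq_measure2[symmetric] lmeasurable_open open_sums bounded_sums) auto
      also have "\<dots> \<le> emeasure lebesgue {x. t < h x}"
        using sub[OF t] by (intro emeasure_mono) auto
      also have "ennreal (measure lebesgue {x. t < f x} + ?c * \<epsilon>) = ennreal (measure lebesgue {x. t < f x}) + ennreal (?c * \<epsilon>)"
        using w \<epsilon> C(4) by (intro ennreal_plus) auto
      also have "ennreal (measure lebesgue {x. t < f x}) = emeasure lebesgue {x. t < f x}"
        by (rule emeasure_eq_measure2[OF A, symmetric])
      finally show ?thesis using True by simp
    next
      case False
      have "0 \<in> ball 0 \<epsilon>" using \<epsilon> by simp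
      have "{x. t < f x} \<subseteq> {x. t < h x}"
      proof
        fix x assume "x \<in> {x. t < f x}"
        with \<open>0 \<in> ball 0 \<epsilon>\<close> have "x \<in> minkowski_sum {x. t < f x} (ball 0 \<epsilon>)"
          by (intro UN_I[of x] UN_I[of 0]) simp_all
        then show "x \<in> {x. t < h x}" by (rule subsetD[OF sub[OF t]])
      qed
      then show ?thesis using False by (auto intro!: emeasure_mono)
    qed
    have "ennreal (integral\<^sup>L lborel f + ?c * \<epsilon>) = (\<integral>\<^sup>+x. ennreal (f x) \<partial>lborel) + ennreal (?c * \<epsilon>)"
      using intf nonneg w \<epsilon> C(4) by (simp add: nn_integral_eq_integral ennreal_plus)
    also have "(\<integral>\<^sup>+x. ennreal (f x) \<partial>lborel) = (\<integral>\<^sup>+t. emeasure lborel {x. t < f x} * indicator {0<..} t \<partial>lborel)"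
      by (rule layer_cake) simp
    also have "\<dots> + ennreal (?c * \<epsilon>) = (\<integral>\<^sup>+t. emeasure lborel {x. t < f x} * indicator {0<..} t \<partial>lborel) + (\<integral>\<^sup>+t. ennreal (?c * \<epsilon>) * indicator {0<..<1::real} t \<partial>lborel)"
      by (subst nn_integral_cmult_indicator) auto
    also have "\<dots> = (\<integral>\<^sup>+t. emeasure lborel {x. t < f x} * indicator {0<..} t + ennreal (?c * \<epsilon>) * indicator {0<..<1::real} t \<partial>lborel)"
      by (rule nn_integral_add[symmetric]) measurable
    also have "\<dots> \<le> (\<integral>\<^sup>+t. emeasure lborel {x. t < h x} * indicator {0<..} t \<partial>lborel)"
    proof (rule nn_integral_mono)
      fix t :: real
      show "emeasure lborel {x. t < f x} * indicator {0<..} t + ennreal (?c * \<epsilon>) * indicator {0<..<1::real} t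
         \<le> emeasure lborel {x. t < h x} * indicator {0<..} t"
        using level[of t] by (auto simp: indicator_def split: if_splits)
    qed
    also have "\<dots> = (\<integral>\<^sup>+x. ennreal (h x) \<partial>lborel)" by (rule layer_cake[symmetric]) simp
    also have "\<dots> = ennreal (integral\<^sup>L lborel h)"
      using inth nonneg \<epsilon> \<open>L \<ge> 0\<close> by (intro nn_integral_eq_integral[OF inth]) (auto simp: h_def)
    finally have "integral\<^sup>L lborel f + ?c * \<epsilon> \<le> integral\<^sup>L lborel h"
      using nonneg \<epsilon> \<open>L \<ge> 0\<close> by (subst (asm) ennreal_le_iff) (auto simp: h_def intro!: integral_nonneg)
    also have "integral\<^sup>L lborel h = integral\<^sup>L lborel f + \<epsilon> * ((\<integral>x. norm (g x) \<partial>lborel) + L * \<epsilon> * ?V)"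
      unfolding h_def using intf intg
      by (subst Bochner_Integration.integral_add) auto
    finally have "\<epsilon> * ?c \<le> \<epsilon> * ((\<integral>x. norm (g x) \<partial>lborel) + L * \<epsilon> * ?V)" by (simp add: mult.commute)
    then show ?thesis using \<epsilon> by (simp only: mult_le_cancel_left_pos)
  qed
  show ?thesis
  proof (rule tendsto_lowerbound)
    show "((\<lambda>\<epsilon>. (\<integral>x. norm (g x) \<partial>lborel) + L * \<epsilon> * ?V) \<longlongrightarrow> (\<integral>x. norm (g x) \<partial>lborel)) (at_right 0)"
      by (auto intro!: tendsto_eq_intros)
    show "\<forall>\<^sub>F \<epsilon> in at_right 0. ?c \<le> (\<integral>x. norm (g x) \<partial>lborel) + L * \<epsilon> * ?V"
      using main by (intro eventually_at_rightI[of 0 1]) auto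
  qed simp
qed

section \<open>Mollifiers and convolution\<close>

lemma has_derivative_if_quadratic:
  fixes f :: "'a::real_normed_vector \<Rightarrow> 'b::real_normed_vector"
  assumes "bounded_linear D" and quad: "\<And>y. norm (f y - f x - D (y - x)) \<le> L * (norm (y - x))\<^sup>2"
  shows "(f has_derivative D) (at x)"
  unfolding has_derivative_at_alt
proof (intro conjI allI impI)
  fix e :: real assume e: "e > 0"
  show "\<exists>d>0. \<forall>y. norm (y - x) < d \<longrightarrow> norm (f y - f x - D (y - x)) \<le> e * norm (y - x)"
  proof (intro exI[of _ "e / (\<bar>L\<bar> + 1)"] conjI allI impI)
    fix y assume y: "norm (y - x) < e / (\<bar>L\<bar> + 1)"
    have "norm (f y - f x - D (y - x)) \<le> L * norm (y - x) * norm (y - x)"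
      using quad[of y] by (simp add: power2_eq_square)
    also have "L * norm (y - x) \<le> (\<bar>L\<bar> + 1) * norm (y - x)" by (intro mult_right_mono) auto
    also have "\<dots> \<le> e" using y by (simp add: field_simps)
    finally show "norm (f y - f x - D (y - x)) \<le> e * norm (y - x)"
      by (smt (verit) mult_right_mono norm_ge_zero)
  qed (use e in auto)
qed (fact assms(1))

lemma taylor_if_lipschitz_gradient:
  fixes k :: "'a::euclidean_space \<Rightarrow> real" and G :: "'a \<Rightarrow> 'a"
  assumes der: "\<And>x. (k has_derivative (\<lambda>h. G x \<bullet> h)) (at x)"
    and lip: "\<And>x y. norm (G x - G y) \<le> L * norm (x - y)" and "L \<ge> 0"
  shows "\<bar>k y - k x - G x \<bullet> (y - x)\<bar> \<le> L * (norm (y - x))\<^sup>2"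
proof -
  have "norm ((k y - G x \<bullet> y) - (k x - G x \<bullet> x)) \<le> (L * norm (y - x)) * norm (y - x)"
  proof (rule differentiable_bound[of "closed_segment x y" "\<lambda>u. k u - G x \<bullet> u" "\<lambda>u h. G u \<bullet> h - G x \<bullet> h"])
    show "((\<lambda>u. k u - G x \<bullet> u) has_derivative (\<lambda>h. G u \<bullet> h - G x \<bullet> h)) (at u within closed_segment x y)" for u
      by (intro has_derivative_diff has_derivative_at_withinI[OF der] has_derivative_inner_right has_derivative_ident)
    show "onorm (\<lambda>h. G u \<bullet> h - G x \<bullet> h) \<le> L * norm (y - x)" if u: "u \<in> closed_segment x y" for u
    proof (rule onorm_le)
      fix h :: 'a
      have "norm (u - x) \<le> norm (y - x)" using segment_bound(1)[OF u] by (simp add: norm_minus_commute)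
      then have "norm (G u - G x) \<le> L * norm (y - x)"
        using lip[of u x] mult_left_mono[OF _ \<open>L \<ge> 0\<close>] by (meson order_trans)
      then have "norm (G u - G x) * norm h \<le> L * norm (y - x) * norm h" by (rule mult_right_mono) simp
      then show "norm (G u \<bullet> h - G x \<bullet> h) \<le> L * norm (y - x) * norm h"
        using Cauchy_Schwarz_ineq2[of "G u - G x" h] by (simp add: inner_diff_left)
    qed
  qed auto
  then show ?thesis by (simp add: inner_diff_right power2_eq_square algebra_simps)
qed

text \<open>A truncated polynomial takes the place of the usual exponential bump: test fields have
  to be C1 only, and here the gradient has an explicit Lipschitz constant.\<close>

definition bump :: "real \<Rightarrow> 'a::euclidean_space \<Rightarrow> real" where
  "bump \<eta> x = (max 0 (\<eta>\<^sup>2 - x \<bullet> x))\<^sup>2"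

definition bump_gradient :: "real \<Rightarrow> 'a::euclidean_space \<Rightarrow> 'a" where
  "bump_gradient \<eta> x = (- 4 * max 0 (\<eta>\<^sup>2 - x \<bullet> x)) *\<^sub>R x"

lemma bump_has_derivative: "(bump \<eta> has_derivative (\<lambda>h. bump_gradient \<eta> x \<bullet> h)) (at x)"
proof -
  have quad: "\<bar>(max 0 v)\<^sup>2 - (max 0 u)\<^sup>2 - 2 * max 0 u * (v - u)\<bar> \<le> 1 * \<bar>v - u\<bar>\<^sup>2" for u v :: real
  proof -
    consider "u \<ge> 0" "v \<ge> 0" | "u < 0" "v < 0" | "u \<ge> 0" "v < 0" | "u < 0" "v \<ge> 0" by linarith
    then show ?thesis
    proof cases
      case 1
      have "v\<^sup>2 - u\<^sup>2 - 2 * u * (v - u) = (v - u)\<^sup>2" by (simp add: power2_eq_square algebra_simps)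
      then show ?thesis using 1 by simp
    next
      case 3
      have "u * v \<le> 0" using 3 by (intro mult_nonneg_nonpos) auto
      then have "2 * u * v \<le> u\<^sup>2" using zero_le_power2[of u] by linarith
      then have "\<bar>u\<^sup>2 - 2 * u * v\<bar> = u\<^sup>2 - 2 * u * v" by simp
      moreover have "(v - u)\<^sup>2 = u\<^sup>2 - 2 * u * v + v\<^sup>2" by (simp add: power2_eq_square algebra_simps)
      ultimately show ?thesis using 3 by (simp add: power2_eq_square algebra_simps)
    next
      case 4
      then have "v\<^sup>2 \<le> (v - u)\<^sup>2" by (intro power_mono) auto
      then show ?thesis using 4 by simp
    qed simp
  qed
  have 1: "((\<lambda>u::real. (max 0 u)\<^sup>2) has_derivative (\<lambda>h. 2 * max 0 u * h)) (at u)" for u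
    using quad by (intro has_derivative_if_quadratic[where L=1] bounded_linear_mult_right) (simp only: real_norm_def)
  have 2: "((\<lambda>x::'a. \<eta>\<^sup>2 - x \<bullet> x) has_derivative (\<lambda>h. 0 - (x \<bullet> h + h \<bullet> x))) (at x)"
    by (intro has_derivative_diff has_derivative_const has_derivative_inner has_derivative_ident)
  have "(bump \<eta> has_derivative (\<lambda>h. 2 * max 0 (\<eta>\<^sup>2 - x \<bullet> x) * (0 - (x \<bullet> h + h \<bullet> x)))) (at x)"
    unfolding bump_def by (rule has_derivative_compose[OF 2 1])
  moreover have "(\<lambda>h. 2 * max 0 (\<eta>\<^sup>2 - x \<bullet> x) * (0 - (x \<bullet> h + h \<bullet> x))) = (\<lambda>h. bump_gradient \<eta> x \<bullet> h)"
    by (rule ext) (simp add: bump_gradient_def inner_commute)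
  ultimately show ?thesis by simp
qed

text \<open>The constant is 4 times 3. The 4 is the prefactor of the gradient; for points inside the
  ball of radius \<open>\<eta>\<close>, varying the truncated factor contributes 2 and varying the
  vector contributes 1, each times \<open>\<eta>\<^sup>2\<close>.\<close>

lemma bump_gradient_lipschitz:
  assumes "\<eta> > 0"
  shows "norm (bump_gradient \<eta> x - bump_gradient \<eta> y) \<le> 12 * \<eta>\<^sup>2 * norm (x - y)"
proof -
  let ?m = "\<lambda>x::'a. max 0 (\<eta>\<^sup>2 - x \<bullet> x)"
  have out: "?m x = 0" if "norm x \<ge> \<eta>" for x
    using that assms power_mono[of \<eta> "norm x" 2] by (simp add: power2_norm_eq_inner)
  have inn: "?m x = (\<eta> - norm x) * (\<eta> + norm x)" "?m x \<le> \<eta>\<^sup>2" "0 \<le> ?m x" if "norm x \<le> \<eta>" for x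
  proof -
    have "x \<bullet> x \<le> \<eta>\<^sup>2" using that power_mono[of "norm x" \<eta> 2] by (simp add: power2_norm_eq_inner)
    then show "?m x = (\<eta> - norm x) * (\<eta> + norm x)"
      by (simp add: power2_eq_square algebra_simps flip: power2_norm_eq_inner)
  qed auto
  have key: "norm (?m x *\<^sub>R x - ?m y *\<^sub>R y) \<le> 3 * \<eta>\<^sup>2 * norm (x - y)" if le: "norm x \<le> norm y" for x y
  proof -
    consider "norm y \<le> \<eta>" | "norm x \<le> \<eta>" "\<eta> \<le> norm y" | "\<eta> \<le> norm x" using le by linarith
    then show ?thesis
    proof cases
      case 1
      then have x: "norm x \<le> \<eta>" using le by linarith
      have "?m x - ?m y = (norm y - norm x) * (norm x + norm y)"
        using inn(1)[OF 1] inn(1)[OF x] by (simp add: algebra_simps)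
      also have "\<dots> \<le> norm (x - y) * (2 * \<eta>)"
        using norm_triangle_ineq2[of y x] 1 x le by (intro mult_mono) (auto simp: norm_minus_commute)
      finally have a: "\<bar>?m x - ?m y\<bar> \<le> norm (x - y) * (2 * \<eta>)"
        using \<open>?m x - ?m y = _\<close> le by (smt (verit) mult_nonneg_nonneg norm_ge_zero)
      have "norm (?m x *\<^sub>R x - ?m y *\<^sub>R y) = norm ((?m x - ?m y) *\<^sub>R x + ?m y *\<^sub>R (x - y))"
        by (simp add: algebra_simps)
      also have "\<dots> \<le> \<bar>?m x - ?m y\<bar> * norm x + \<bar>?m y\<bar> * norm (x - y)"
        by (rule norm_triangle_le) (simp only: norm_scaleR order_refl)
      also have "\<dots> \<le> norm (x - y) * (2 * \<eta>) * \<eta> + \<eta>\<^sup>2 * norm (x - y)"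
        using a x inn(2,3)[OF 1] assms by (intro add_mono mult_mono) auto
      finally show ?thesis by (simp add: power2_eq_square algebra_simps)
    next
      case 2
      have "norm (?m x *\<^sub>R x - ?m y *\<^sub>R y) = ?m x * norm x" using out[OF 2(2)] by simp
      also have "\<dots> \<le> (\<eta> - norm x) * (\<eta> + norm x) * \<eta>"
        unfolding inn(1)[OF 2(1)] using 2 assms by (intro mult_left_mono) auto
      also have "\<dots> \<le> norm (x - y) * (2 * \<eta>) * \<eta>"
        using norm_triangle_ineq2[of y x] 2 assms by (intro mult_right_mono mult_mono) (auto simp: norm_minus_commute)
      also have "\<dots> \<le> 3 * \<eta>\<^sup>2 * norm (x - y)" using assms by (simp add: power2_eq_square algebra_simps)
      finally show ?thesis .
    next
      case 3
      then show ?thesis using out[OF 3] out[of y] le by simp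
    qed
  qed
  have "norm (?m x *\<^sub>R x - ?m y *\<^sub>R y) \<le> 3 * \<eta>\<^sup>2 * norm (x - y)"
    using key[of x y] key[of y x] by (cases "norm x \<le> norm y") (auto simp: norm_minus_commute)
  moreover have "bump_gradient \<eta> x - bump_gradient \<eta> y = (- 4) *\<^sub>R (?m x *\<^sub>R x - ?m y *\<^sub>R y)"
    by (simp add: bump_gradient_def scaleR_diff_right)
  ultimately show ?thesis by (simp add: ac_simps)
qed

text \<open>\<open>G\<close> is the gradient of \<open>k\<close>, recorded through a uniform Taylor
  estimate instead of a derivative. This estimate and the Lipschitz bound on \<open>G\<close> can be
  integrated directly against any integrable function. The parities of \<open>k\<close> and
  \<open>G\<close> allow the arguments in \<open>x - y\<close> to be exchanged.\<close>

locale mollifier =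
  fixes \<eta> :: real and k :: "'a::euclidean_space \<Rightarrow> real" and G :: "'a \<Rightarrow> 'a" and L :: real
  assumes \<eta>_pos: "\<eta> > 0" and L_nonneg: "L \<ge> 0"
    and nonneg: "k x \<ge> 0"
    and support: "norm x \<ge> \<eta> \<Longrightarrow> k x = 0" "norm x \<ge> \<eta> \<Longrightarrow> G x = 0"
    and even: "k (- x) = k x" and odd: "G (- x) = - G x"
    and continuous: "continuous_on UNIV k" "continuous_on UNIV G"
    and taylor: "\<bar>k y - k x - G x \<bullet> (y - x)\<bar> \<le> L * (norm (y - x))\<^sup>2"
    and lipschitz: "norm (G x - G y) \<le> L * norm (x - y)"
    and integral_1: "(\<integral>x. k x \<partial>lborel) = 1"

lemma mollifier_exists:
  assumes "\<eta> > 0"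
  shows "\<exists>(k :: 'a::euclidean_space \<Rightarrow> real) G L. mollifier \<eta> k G L"
proof -
  let ?b = "bump \<eta> :: 'a \<Rightarrow> real"
  have out: "\<eta>\<^sup>2 - x \<bullet> x \<le> 0" if "norm x \<ge> \<eta>" for x :: 'a
    using that assms power_mono[of \<eta> "norm x" 2] by (simp add: power2_norm_eq_inner)
  have contb: "continuous_on UNIV ?b" unfolding bump_def by (intro continuous_intros)
  have int: "integrable lborel ?b"
  proof -
    have "integrable lborel (\<lambda>x. indicator (cball 0 \<eta>) x *\<^sub>R ?b x)"
      using contb continuous_on_subset by (intro borel_integrable_compact) auto
    moreover have "(\<lambda>x. indicator (cball 0 \<eta>) x *\<^sub>R ?b x) = ?b"
      using out by (auto simp: fun_eq_iff indicator_def bump_def)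
    ultimately show ?thesis by simp
  qed
  define I where "I = (\<integral>x. ?b x \<partial>lborel)"
  have "I > 0"
  proof -
    \<comment> \<open>On the ball of radius \<open>\<eta> / 2\<close> one has
      \<open>\<eta>\<^sup>2 - x \<bullet> x \<ge> 3 * \<eta>\<^sup>2 / 4\<close>, which makes the
      integral of the bump positive.\<close>
    let ?m = "(3 * \<eta>\<^sup>2 / 4)\<^sup>2"
    have "?m * indicator (ball 0 (\<eta> / 2)) x \<le> ?b x" for x
    proof (cases "x \<in> ball 0 (\<eta> / 2)")
      case True
      then have "x \<bullet> x \<le> (\<eta> / 2)\<^sup>2" using power_mono[of "norm x" "\<eta> / 2" 2] by (simp add: power2_norm_eq_inner)
      then have "3 * \<eta>\<^sup>2 / 4 \<le> \<eta>\<^sup>2 - x \<bullet> x" by (simp add: power2_eq_square)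
      also have "\<dots> \<le> max 0 (\<eta>\<^sup>2 - x \<bullet> x)" by simp
      finally have "3 * \<eta>\<^sup>2 / 4 \<le> max 0 (\<eta>\<^sup>2 - x \<bullet> x)" .
      then show ?thesis using True unfolding bump_def by (auto intro!: power_mono)
    qed (simp add: bump_def)
    then have "(\<integral>x. ?m * indicator (ball (0::'a) (\<eta> / 2)) x \<partial>lborel) \<le> I"
      unfolding I_def using int
      using emeasure_lborel_ball_finite[of "0::'a" "\<eta> / 2"]
      by (intro integral_mono integrable_mult_right integrable_real_indicator) auto
    moreover have "(\<integral>x. ?m * indicator (ball (0::'a) (\<eta> / 2)) x \<partial>lborel) = ?m * measure lborel (ball (0::'a) (\<eta> / 2))"
      by simp
    moreover have "0 < ?m * measure lborel (ball (0::'a) (\<eta> / 2))"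
      using assms content_ball_pos[of "\<eta> / 2" "0::'a"] by (intro mult_pos_pos) auto
    ultimately show ?thesis by linarith
  qed
  let ?L = "12 * \<eta>\<^sup>2"
  have tay: "\<bar>?b y - ?b x - bump_gradient \<eta> x \<bullet> (y - x)\<bar> \<le> ?L * (norm (y - x))\<^sup>2" for x y :: 'a
    by (rule taylor_if_lipschitz_gradient[OF bump_has_derivative bump_gradient_lipschitz[OF assms]]) simp
  have "mollifier \<eta> (\<lambda>x::'a. ?b x / I) (\<lambda>x. (1 / I) *\<^sub>R bump_gradient \<eta> x) (?L / I)"
  proof
    show "\<eta> > 0" by fact
    show "0 \<le> ?L / I" using \<open>I > 0\<close> by simp
    show "0 \<le> ?b x / I" for x using \<open>I > 0\<close> by (simp add: bump_def)
    show "?b x / I = 0" "(1 / I) *\<^sub>R bump_gradient \<eta> x = 0" if "norm x \<ge> \<eta>" for x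
      using out[OF that] by (auto simp: bump_def bump_gradient_def)
    show "?b (- x) / I = ?b x / I" "(1 / I) *\<^sub>R bump_gradient \<eta> (- x) = - ((1 / I) *\<^sub>R bump_gradient \<eta> x)" for x
      by (simp_all add: bump_def bump_gradient_def)
    show "continuous_on UNIV (\<lambda>x. ?b x / I)" using contb \<open>I > 0\<close> by (intro continuous_intros) auto
    show "continuous_on UNIV (\<lambda>x. (1 / I) *\<^sub>R bump_gradient \<eta> x :: 'a)"
      unfolding bump_gradient_def by (intro continuous_intros)
    show "\<bar>?b y / I - ?b x / I - ((1 / I) *\<^sub>R bump_gradient \<eta> x) \<bullet> (y - x)\<bar> \<le> ?L / I * (norm (y - x))\<^sup>2" for x y
    proof -
      have "?b y / I - ?b x / I - ((1 / I) *\<^sub>R bump_gradient \<eta> x) \<bullet> (y - x) = (?b y - ?b x - bump_gradient \<eta> x \<bullet> (y - x)) / I"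
        by (simp add: diff_divide_distrib)
      then show ?thesis using divide_right_mono[OF tay[of y x], of I] \<open>I > 0\<close> by simp
    qed
    show "norm ((1 / I) *\<^sub>R bump_gradient \<eta> x - (1 / I) *\<^sub>R bump_gradient \<eta> y) \<le> ?L / I * norm (x - y)" for x y :: 'a
    proof -
      have "norm ((1 / I) *\<^sub>R bump_gradient \<eta> x - (1 / I) *\<^sub>R bump_gradient \<eta> y) = norm (bump_gradient \<eta> x - bump_gradient \<eta> y) / I"
        using \<open>I > 0\<close> by (simp flip: scaleR_diff_right)
      then show ?thesis using divide_right_mono[OF bump_gradient_lipschitz[OF assms, of x y], of I] \<open>I > 0\<close> by simp
    qed
    show "(\<integral>x. ?b x / I \<partial>lborel) = 1" using \<open>I > 0\<close> by (simp add: I_def)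
  qed
  then show ?thesis by blast
qed

context mollifier begin

lemma kernel_borel [measurable]: "k \<in> borel_measurable borel" "G \<in> borel_measurable borel"
  using continuous by (auto intro: borel_measurable_continuous_onI)

lemma kernel_bounded: "\<exists>M. (\<forall>x. k x \<le> M) \<and> (\<forall>x. norm (G x) \<le> M)"
proof -
  have "compact (k ` cball 0 \<eta>)" "compact (G ` cball 0 \<eta>)"
    using continuous by (auto intro!: compact_continuous_image intro: continuous_on_subset)
  then have "bounded (k ` cball 0 \<eta>)" "bounded (G ` cball 0 \<eta>)" by (auto intro: compact_imp_bounded)
  then obtain A B where A: "\<forall>x\<in>cball 0 \<eta>. norm (k x) \<le> A" and B: "\<forall>x\<in>cball 0 \<eta>. norm (G x) \<le> B"
    unfolding bounded_iff by auto
  have "k x \<le> max 0 (max A B)" "norm (G x) \<le> max 0 (max A B)" for x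
    using A B support[of x] by (cases "norm x \<le> \<eta>"; force)+
  then show ?thesis by blast
qed

lemma integrable_conv:
  fixes V :: "'a \<Rightarrow> 'b::euclidean_space"
  assumes V: "integrable lborel V"
  shows "integrable lborel (\<lambda>y. k (x - y) *\<^sub>R V y)" "integrable lborel (\<lambda>y. (G (x - y) \<bullet> h) *\<^sub>R V y)"
proof -
  obtain M where M: "\<And>x. k x \<le> M" "\<And>x. norm (G x) \<le> M" using kernel_bounded by blast
  have [measurable]: "V \<in> borel_measurable borel" using V by auto
  have "integrable lborel (\<lambda>y. M *\<^sub>R norm (V y))" using V by auto
  then show "integrable lborel (\<lambda>y. k (x - y) *\<^sub>R V y)"
  proof (rule Bochner_Integration.integrable_bound)
    have "\<bar>k (x - y)\<bar> * norm (V y) \<le> \<bar>M\<bar> * norm (V y)" for y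
      using M(1)[of "x - y"] nonneg[of "x - y"] by (intro mult_right_mono) auto
    then show "AE y in lborel. norm (k (x - y) *\<^sub>R V y) \<le> norm (M *\<^sub>R norm (V y))" by (simp add: abs_mult)
  qed measurable
  have "integrable lborel (\<lambda>y. (M * norm h) *\<^sub>R norm (V y))" using V by auto
  then show "integrable lborel (\<lambda>y. (G (x - y) \<bullet> h) *\<^sub>R V y)"
  proof (rule Bochner_Integration.integrable_bound)
    have "\<bar>G (x - y) \<bullet> h\<bar> \<le> M * norm h" for y
      using Cauchy_Schwarz_ineq2[of "G (x - y)" h] mult_right_mono[OF M(2)[of "x - y"] norm_ge_zero[of h]] by linarith
    then have "\<bar>G (x - y) \<bullet> h\<bar> * norm (V y) \<le> \<bar>M * norm h\<bar> * norm (V y)" for y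
      by (intro mult_right_mono) (auto intro: order_trans[OF _ abs_ge_self])
    then show "AE y in lborel. norm ((G (x - y) \<bullet> h) *\<^sub>R V y) \<le> norm ((M * norm h) *\<^sub>R norm (V y))"
      by (simp add: abs_mult)
  qed measurable
qed

definition conv :: "('a \<Rightarrow> 'b::euclidean_space) \<Rightarrow> 'a \<Rightarrow> 'b" where
  "conv V x = (\<integral>y. k (x - y) *\<^sub>R V y \<partial>lborel)"

definition conv_deriv :: "('a \<Rightarrow> 'b::euclidean_space) \<Rightarrow> 'a \<Rightarrow> 'a \<Rightarrow> 'b" where
  "conv_deriv V x h = (\<integral>y. (G (x - y) \<bullet> h) *\<^sub>R V y \<partial>lborel)"

text \<open>The Taylor error of the kernel is uniform in its base point, so integrating it against
  \<open>V\<close> yields the Taylor error of the convolution. Differentiability follows without a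
  theorem on differentiation under the integral.\<close>

lemma conv_taylor:
  fixes V :: "'a \<Rightarrow> 'b::euclidean_space"
  assumes V: "integrable lborel V"
  shows "norm (conv V z - conv V x - conv_deriv V x (z - x)) \<le> (L * (\<integral>y. norm (V y) \<partial>lborel)) * (norm (z - x))\<^sup>2"
proof -
  have "conv V z - conv V x - conv_deriv V x (z - x)
      = (\<integral>y. (k (z - y) - k (x - y) - G (x - y) \<bullet> (z - x)) *\<^sub>R V y \<partial>lborel)"
    unfolding conv_def conv_deriv_def scaleR_diff_left
    using integrable_conv[OF V] by (simp add: Bochner_Integration.integral_diff)
  also have "norm \<dots> \<le> (\<integral>y. L * (norm (z - x))\<^sup>2 * norm (V y) \<partial>lborel)"
  proof (rule Bochner_Integration.integral_norm_bound_integral)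
    show "integrable lborel (\<lambda>y. (k (z - y) - k (x - y) - G (x - y) \<bullet> (z - x)) *\<^sub>R V y)"
      unfolding scaleR_diff_left using integrable_conv[OF V] by auto
    show "norm ((k (z - y) - k (x - y) - G (x - y) \<bullet> (z - x)) *\<^sub>R V y) \<le> L * (norm (z - x))\<^sup>2 * norm (V y)" for y
      using taylor[of "z - y" "x - y"] by (auto intro!: mult_right_mono)
  qed (use V in auto)
  finally show ?thesis by (simp add: mult.commute mult.left_commute mult.assoc)
qed

lemma conv_deriv_linear:
  fixes V :: "'a \<Rightarrow> 'b::euclidean_space"
  assumes V: "integrable lborel V"
  shows "bounded_linear (conv_deriv V x)"
  unfolding linear_conv_bounded_linear[symmetric] conv_deriv_def
proof (rule linearI)
  show "(\<integral>y. (G (x - y) \<bullet> (h + h')) *\<^sub>R V y \<partial>lborel) = (\<integral>y. (G (x - y) \<bullet> h) *\<^sub>R V y \<partial>lborel) + (\<integral>y. (G (x - y) \<bullet> h') *\<^sub>R V y \<partial>lborel)" for h h'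
    unfolding inner_add_right scaleR_add_left using integrable_conv[OF V] by (intro Bochner_Integration.integral_add)
  show "(\<integral>y. (G (x - y) \<bullet> (r *\<^sub>R h)) *\<^sub>R V y \<partial>lborel) = r *\<^sub>R (\<integral>y. (G (x - y) \<bullet> h) *\<^sub>R V y \<partial>lborel)" for r h
    unfolding inner_scaleR_right scaleR_scaleR[symmetric] by (rule integral_scaleR_right)
qed

lemma conv_has_derivative:
  fixes V :: "'a \<Rightarrow> 'b::euclidean_space"
  assumes V: "integrable lborel V"
  shows "(conv V has_derivative conv_deriv V x) (at x)"
  by (rule has_derivative_if_quadratic[OF conv_deriv_linear[OF V] conv_taylor[OF V]])

lemma conv_deriv_lipschitz:
  fixes V :: "'a \<Rightarrow> 'b::euclidean_space"
  assumes V: "integrable lborel V"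
  shows "norm (conv_deriv V x h - conv_deriv V z h) \<le> (L * (\<integral>y. norm (V y) \<partial>lborel)) * norm (x - z) * norm h"
proof -
  have "conv_deriv V x h - conv_deriv V z h = (\<integral>y. ((G (x - y) - G (z - y)) \<bullet> h) *\<^sub>R V y \<partial>lborel)"
    unfolding conv_deriv_def inner_diff_left scaleR_diff_left
    using integrable_conv[OF V] by (simp add: Bochner_Integration.integral_diff)
  also have "norm \<dots> \<le> (\<integral>y. L * norm (x - z) * norm h * norm (V y) \<partial>lborel)"
  proof (rule Bochner_Integration.integral_norm_bound_integral)
    show "integrable lborel (\<lambda>y. ((G (x - y) - G (z - y)) \<bullet> h) *\<^sub>R V y)"
      unfolding inner_diff_left scaleR_diff_left using integrable_conv[OF V] by auto
    fix y
    have "\<bar>(G (x - y) - G (z - y)) \<bullet> h\<bar> \<le> norm (G (x - y) - G (z - y)) * norm h" by (rule Cauchy_Schwarz_ineq2)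
    also have "\<dots> \<le> L * norm (x - z) * norm h" using lipschitz[of "x - y" "z - y"] by (intro mult_right_mono) auto
    finally show "norm (((G (x - y) - G (z - y)) \<bullet> h) *\<^sub>R V y) \<le> L * norm (x - z) * norm h * norm (V y)"
      by (auto intro!: mult_right_mono)
  qed (use V in auto)
  finally show ?thesis by (simp add: mult.commute mult.left_commute mult.assoc)
qed

lemma integral_kernel_shift: "(\<integral>y. k (x - y) \<partial>lborel) = 1" "integrable lborel (\<lambda>y. k (x - y))"
proof -
  have eq: "k (x - y) = k ((- x) + y)" for y using even[of "x - y"] by (simp add: algebra_simps)
  have ik: "integrable lborel k" using integral_1 not_integrable_integral_eq by force
  show "(\<integral>y. k (x - y) \<partial>lborel) = 1"
    unfolding eq integral_1[symmetric]
    by (subst (2) lborel_distr_plus[symmetric, of "- x"], subst integral_distr) auto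
  have "integrable (distr lborel borel ((+) (- x))) k" unfolding lborel_distr_plus by (rule ik)
  then show "integrable lborel (\<lambda>y. k (x - y))"
    unfolding eq by (subst (asm) integrable_distr_eq) auto
qed

lemma conv_support:
  assumes "\<And>y. norm y > R \<Longrightarrow> V y = 0" "norm x \<ge> R + \<eta>"
  shows "conv V x = 0" "conv_deriv V x h = 0"
proof -
  have "k (x - y) = 0 \<and> G (x - y) = 0 \<or> V y = 0" for y
  proof (cases "norm y > R")
    case False
    then have "norm (x - y) \<ge> \<eta>" using norm_triangle_ineq2[of x y] assms(2) by linarith
    then show ?thesis using support by blast
  qed (use assms in auto)
  then have "(\<lambda>y. k (x - y) *\<^sub>R V y) = (\<lambda>_. 0)" "(\<lambda>y. (G (x - y) \<bullet> h) *\<^sub>R V y) = (\<lambda>_. 0)"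
    by (auto simp: fun_eq_iff) (metis inner_zero_left)
  then show "conv V x = 0" "conv_deriv V x h = 0" by (auto simp: conv_def conv_deriv_def)
qed

lemma norm_conv_le_1:
  fixes V :: "'a \<Rightarrow> 'b::euclidean_space"
  assumes V: "integrable lborel V" "\<And>y. norm (V y) \<le> 1"
  shows "norm (conv V x) \<le> 1"
proof -
  have "norm (conv V x) \<le> (\<integral>y. k (x - y) \<partial>lborel)"
    unfolding conv_def
    by (rule Bochner_Integration.integral_norm_bound_integral)
      (use integrable_conv[OF V(1)] integral_kernel_shift V(2) nonneg in \<open>auto intro: mult_left_le\<close>)
  then show ?thesis using integral_kernel_shift by simp
qed

lemma conv_compactly_supported_C1:
  fixes V :: "'a \<Rightarrow> 'a"
  assumes V: "integrable lborel V" "\<And>y. norm y > R \<Longrightarrow> V y = 0"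
  shows "compactly_supported_C1 (conv V)"
  unfolding compactly_supported_C1_def
proof (intro conjI exI allI)
  let ?D = "\<lambda>x. Blinfun (conv_deriv V x)" and ?C = "L * (\<integral>y. norm (V y) \<partial>lborel)"
  have D: "blinfun_apply (?D x) = conv_deriv V x" for x
    by (rule bounded_linear_Blinfun_apply[OF conv_deriv_linear[OF V(1)]])
  show "(conv V has_derivative ?D x) (at x)" for x
    unfolding D by (rule conv_has_derivative[OF V(1)])
  have "?C-lipschitz_on UNIV ?D"
  proof (rule lipschitz_onI)
    show C: "0 \<le> ?C" using L_nonneg by simp
    fix x y
    have "norm (?D x - ?D y) \<le> ?C * norm (x - y)"
      using C conv_deriv_lipschitz[OF V(1)]
      by (intro norm_blinfun_bound) (auto simp: blinfun.diff_left D)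
    then show "dist (?D x) (?D y) \<le> ?C * dist x y" by (simp add: dist_norm)
  qed
  then show "continuous_on UNIV ?D" by (rule lipschitz_on_continuous_on)
  have "{x. conv V x \<noteq> 0} \<subseteq> cball 0 (R + \<eta>)"
    using conv_support(1)[of R V, OF V(2)] by force
  then have "closure {x. conv V x \<noteq> 0} \<subseteq> cball 0 (R + \<eta>)" by (intro closure_minimal) auto
  then show "compact (closure {x. conv V x \<noteq> 0})"
    by (meson bounded_cball bounded_subset closed_closure compact_eq_bounded_closed)
qed

text \<open>The gradient of the mollified indicator of \<open>E\<close>, as a vector;
  \<open>conv_deriv\<close> gives the same derivative as a linear map, and
  \<open>smoothed_gradient_inner\<close> links the two.\<close>

definition smoothed_gradient :: "'a set \<Rightarrow> 'a \<Rightarrow> 'a" where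
  "smoothed_gradient E y = (\<integral>x. indicator E x *\<^sub>R G (y - x) \<partial>lborel)"

lemma integrable_smoothed_gradient:
  assumes "E \<in> sets borel" "bounded E"
  shows "integrable lborel (\<lambda>x. indicator E x *\<^sub>R G (y - x))"
proof -
  obtain M where M: "\<And>x. norm (G x) \<le> M" using kernel_bounded by blast
  have "emeasure lborel E < \<infinity>" using emeasure_bounded_finite[OF assms(2)] by simp
  then have "integrable lborel (\<lambda>x. M * indicator E x)" using assms by (intro integrable_mult_right integrable_real_indicator) auto
  then show ?thesis
    by (rule Bochner_Integration.integrable_bound)
      (use assms M in \<open>auto simp: indicator_def intro: order_trans[OF _ abs_ge_self]\<close>)
qed

lemma smoothed_gradient_inner:
  assumes "E \<in> sets borel" "bounded E"
  shows "smoothed_gradient E y \<bullet> h = conv_deriv (indicator E :: 'a \<Rightarrow> real) y h"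
  unfolding smoothed_gradient_def conv_deriv_def
  by (subst integral_inner_left[symmetric]) (use integrable_smoothed_gradient[OF assms] in \<open>auto simp: mult.commute\<close>)

lemma smoothed_gradient_support:
  assumes "\<And>x. x \<in> E \<Longrightarrow> norm (y - x) \<ge> \<eta>"
  shows "smoothed_gradient E y = 0"
proof -
  have "(\<lambda>x. indicator E x *\<^sub>R G (y - x)) = (\<lambda>_. 0)" using assms support(2) by (auto simp: fun_eq_iff indicator_def)
  then show ?thesis by (simp add: smoothed_gradient_def)
qed

lemma integrable_indicator_bounded:
  fixes E :: "'a set"
  assumes "E \<in> sets borel" "bounded E"
  shows "integrable lborel (indicator E :: 'a \<Rightarrow> real)"
  using assms emeasure_bounded_finite[OF assms(2)] by (intro integrable_real_indicator) auto

lemma smoothed_gradient_lipschitz: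
  assumes E: "E \<in> sets borel" "bounded E"
  shows "norm (smoothed_gradient E x - smoothed_gradient E z) \<le> (L * (\<integral>y. norm (indicator E y :: real) \<partial>lborel)) * norm (x - z)"
proof -
  let ?u = "smoothed_gradient E x - smoothed_gradient E z" and ?C = "L * (\<integral>y. norm (indicator E y :: real) \<partial>lborel)"
  \<comment> \<open>The Lipschitz bound for directional derivatives is applied in the direction of
    the difference \<open>?u\<close> itself.\<close>
  have "norm ?u * norm ?u = norm (conv_deriv (indicator E :: 'a \<Rightarrow> real) x ?u - conv_deriv (indicator E) z ?u)"
    unfolding smoothed_gradient_inner[OF E, symmetric] inner_diff_left[symmetric]
    by (simp add: dot_square_norm power2_eq_square)
  also have "\<dots> \<le> ?C * norm (x - z) * norm ?u"
    by (rule conv_deriv_lipschitz[OF integrable_indicator_bounded[OF E]])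
  finally have "norm ?u * norm ?u \<le> ?C * norm (x - z) * norm ?u" .
  moreover have "0 \<le> ?C * norm (x - z)" using L_nonneg by simp
  ultimately show ?thesis by (metis mult_right_le_imp_le norm_ge_zero less_le)
qed

end

section \<open>Lower bounds for the perimeter by mollification\<close>

context mollifier begin

text \<open>The optimal field, minus the direction of the smoothed gradient, is only bounded and
  measurable. Convolution with the kernel makes it C1 and keeps its norm below 1. Fubini's theorem
  then moves the kernel gradient from the field to the indicator of \<open>E\<close>, where it
  produces the smoothed gradient again.\<close>

lemma perimeter_ge_smoothed_gradient:
  assumes E: "E \<in> sets borel" "bounded E"
  shows "ennreal (\<integral>y. norm (smoothed_gradient E y) \<partial>lborel) \<le> perimeter E"
proof -
  let ?g = "smoothed_gradient E"
  obtain R where R: "\<And>x. x \<in> E \<Longrightarrow> norm x \<le> R" using E(2) bounded_iff by blast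
  have g0: "?g y = 0" if "norm y > R + \<eta>" for y
  proof (rule smoothed_gradient_support)
    fix x assume "x \<in> E"
    then show "\<eta> \<le> norm (y - x)" using R[of x] that norm_triangle_ineq2[of y x] by linarith
  qed
  define C where "C = L * (\<integral>y. norm (indicator E y :: real) \<partial>lborel)"
  have "C-lipschitz_on UNIV ?g"
    using smoothed_gradient_lipschitz[OF E] L_nonneg unfolding C_def[symmetric]
    by (intro lipschitz_onI) (auto simp: dist_norm C_def)
  then have contg: "continuous_on UNIV ?g" by (rule lipschitz_on_continuous_on)
  then have [measurable]: "?g \<in> borel_measurable borel" by (rule borel_measurable_continuous_onI)
  \<comment> \<open>The minus sign compensates the oddness of \<open>G\<close> under exchange of
    \<open>x\<close> and \<open>y\<close>. As \<open>sgn 0 = 0\<close>, the field vanishes outside a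
    ball, hence its convolution has compact support.\<close>
  define V where "V y = - sgn (?g y)" for y
  have [measurable]: "V \<in> borel_measurable borel" unfolding V_def by measurable
  have V1: "norm (V y) \<le> 1" for y by (simp add: V_def norm_sgn)
  have V0: "V y = 0" if "norm y > R + \<eta>" for y using g0[OF that] by (simp add: V_def)
  have V0': "norm y \<le> R + \<eta>" if "u \<bullet> V y \<noteq> 0" for u y using V0[of y] that by force
  have fin: "emeasure lborel (cball (0::'a) (R + \<eta>)) < \<infinity>"
    using emeasure_lborel_cball_finite[of "0::'a" "R + \<eta>"] by simp
  have "integrable lborel (indicator (cball 0 (R + \<eta>)) :: 'a \<Rightarrow> real)"
    using fin by (intro integrable_real_indicator) auto
  then have intV: "integrable lborel V"
    by (rule Bochner_Integration.integrable_bound)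
      (use V0 V1 in \<open>auto simp: indicator_def not_le intro!: AE_I2\<close>)
  have div: "divergence (conv V) x = (\<integral>y. G (x - y) \<bullet> V y \<partial>lborel)" for x
  proof -
    have int: "integrable lborel (\<lambda>y. (G (x - y) \<bullet> b) * (V y \<bullet> b))" for b
    proof -
      have "integrable lborel (\<lambda>y. ((G (x - y) \<bullet> b) *\<^sub>R V y) \<bullet> b)"
        by (rule integrable_inner_left) (rule integrable_conv(2)[OF intV])
      then show ?thesis by simp
    qed
    have "divergence (conv V) x = (\<Sum>b\<in>Basis. conv_deriv V x b \<bullet> b)"
      unfolding divergence_def using frechet_derivative_at[OF conv_has_derivative[OF intV, of x]] by simp
    also have "\<dots> = (\<Sum>b\<in>Basis. (\<integral>y. (G (x - y) \<bullet> b) * (V y \<bullet> b) \<partial>lborel))"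
      unfolding conv_deriv_def
      by (intro sum.cong refl) (subst integral_inner_left[symmetric], use integrable_conv(2)[OF intV] in auto)
    also have "\<dots> = (\<integral>y. (\<Sum>b\<in>Basis. (G (x - y) \<bullet> b) * (V y \<bullet> b)) \<partial>lborel)"
      using int by (intro Bochner_Integration.integral_sum[symmetric]) auto
    also have "\<dots> = (\<integral>y. G (x - y) \<bullet> V y \<partial>lborel)"
      by (intro Bochner_Integration.integral_cong refl) (rule euclidean_inner[symmetric])
    finally show ?thesis .
  qed
  obtain M where M: "\<And>x. norm (G x) \<le> M" using kernel_bounded by blast
  let ?F = "\<lambda>x y. indicator E x * (G (x - y) \<bullet> V y)"
  have intF: "integrable (lborel \<Otimes>\<^sub>M lborel) (\<lambda>(x, y). ?F x y)"
  proof -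
    have [measurable]: "cball (0::'a) (R + \<eta>) \<in> sets borel" "E \<in> sets borel" using E by auto
    have "emeasure (lborel \<Otimes>\<^sub>M lborel) (E \<times> cball (0::'a) (R + \<eta>)) < \<infinity>"
      using fin emeasure_bounded_finite[OF E(2)] E
      by (subst lborel.emeasure_pair_measure_Times) (auto simp: ennreal_mult_less_top)
    then have "integrable (lborel \<Otimes>\<^sub>M lborel) (\<lambda>p. M * indicator (E \<times> cball (0::'a) (R + \<eta>)) p)"
      using E by (intro integrable_mult_right integrable_real_indicator) auto
    then show ?thesis
    proof (rule Bochner_Integration.integrable_bound)
      show "(\<lambda>(x, y). ?F x y) \<in> borel_measurable (lborel \<Otimes>\<^sub>M lborel)" by measurable
      have "\<bar>G (x - y) \<bullet> V y\<bar> \<le> \<bar>M\<bar>" for x y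
      proof -
        have "\<bar>G (x - y) \<bullet> V y\<bar> \<le> norm (G (x - y)) * norm (V y)" by (rule Cauchy_Schwarz_ineq2)
        also have "\<dots> \<le> M * 1" using M[of "x - y"] V1[of y] by (intro mult_mono) (auto intro: order_trans[OF norm_ge_zero])
        finally show ?thesis by simp
      qed
      then show "AE p in lborel \<Otimes>\<^sub>M lborel. norm (case p of (x, y) \<Rightarrow> ?F x y) \<le> norm (M * indicator (E \<times> cball (0::'a) (R + \<eta>)) p)"
        using V0' by (intro AE_I2) (auto simp: indicator_def not_le)
    qed
  qed
  have eq: "(\<integral>x. indicator E x * (G (x - y) \<bullet> V y) \<partial>lborel) = norm (?g y)" for y
  proof -
    have "(\<integral>x. indicator E x * (G (x - y) \<bullet> V y) \<partial>lborel) = (\<integral>x. (indicator E x *\<^sub>R G (y - x)) \<bullet> (- V y) \<partial>lborel)"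
    proof (intro Bochner_Integration.integral_cong refl)
      fix x
      have "G (x - y) = - G (y - x)" using odd[of "y - x"] by simp
      then show "indicator E x * (G (x - y) \<bullet> V y) = (indicator E x *\<^sub>R G (y - x)) \<bullet> (- V y)" by simp
    qed
    also have "\<dots> = ?g y \<bullet> sgn (?g y)"
      unfolding smoothed_gradient_def[of E y] V_def using integrable_smoothed_gradient[OF E, of y]
      by (subst integral_inner_left) auto
    also have "\<dots> = norm (?g y)"
      by (cases "?g y = 0") (auto simp: sgn_div_norm dot_square_norm power2_eq_square)
    finally show ?thesis .
  qed
  have "(LINT x:E|lebesgue. divergence (conv V) x) = (\<integral>x. indicator E x * divergence (conv V) x \<partial>lborel)"
  proof -
    have "(\<lambda>x. indicator E x *\<^sub>R divergence (conv V) x) \<in> borel_measurable lborel"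
      unfolding div using E(1) by measurable
    then show ?thesis unfolding set_lebesgue_integral_def by (subst integral_completion) auto
  qed
  also have "\<dots> = (\<integral>x. (\<integral>y. ?F x y \<partial>lborel) \<partial>lborel)"
    unfolding div by (simp only: integral_mult_right_zero)
  also have "\<dots> = (\<integral>y. (\<integral>x. ?F x y \<partial>lborel) \<partial>lborel)"
    using lborel_pair.Fubini_integral[OF intF] by simp
  also have "\<dots> = (\<integral>y. norm (?g y) \<partial>lborel)" by (simp only: eq)
  finally have "(LINT x:E|lebesgue. divergence (conv V) x) = (\<integral>y. norm (?g y) \<partial>lborel)" .
  moreover have "conv V \<in> {\<phi>. compactly_supported_C1 \<phi> \<and> (\<forall>x. norm (\<phi> x) \<le> 1)}"
    using conv_compactly_supported_C1[OF intV V0] norm_conv_le_1[OF intV V1] by blast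
  ultimately show ?thesis unfolding perimeter_def by (metis (no_types, lifting) SUP_upper)
qed

text \<open>The mollified indicator equals 1 where the whole \<open>\<eta>\<close>-ball lies in
  \<open>E\<close>, so \<open>integral_gradient_ge\<close> sees the volume of such a set
  \<open>C\<close> rather than that of \<open>E\<close>. The loss disappears when
  \<open>\<eta>\<close> tends to 0.\<close>

lemma smoothed_gradient_isoperimetric:
  assumes E: "E \<in> sets borel" "bounded E"
    and C: "C \<in> lmeasurable" "\<And>x. x \<in> C \<Longrightarrow> ball x \<eta> \<subseteq> E" "r > 0"
      "unit_ball_vol (real DIM('a)) * r ^ DIM('a) \<le> measure lebesgue C"
  shows "integrable lborel (\<lambda>y. norm (smoothed_gradient E y))"
    and "DIM('a) * unit_ball_vol (real DIM('a)) * r ^ (DIM('a) - 1) \<le> (\<integral>y. norm (smoothed_gradient E y) \<partial>lborel)"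
proof -
  let ?u = "indicator E :: 'a \<Rightarrow> real"
  let ?g = "smoothed_gradient E"
  obtain R' where R': "\<And>x. x \<in> E \<Longrightarrow> norm x \<le> R'" using E(2) bounded_iff by blast
  define R where "R = \<bar>R'\<bar>"
  have R: "norm x \<le> R" if "x \<in> E" for x using R'[OF that] by (simp add: R_def)
  have u0: "?u y = 0" if "norm y > R" for y using R[of y] that by (force simp: indicator_def)
  note u = integrable_indicator_bounded[OF E]
  define K where "K = L * (\<integral>y. norm (?u y) \<partial>lborel)"
  have K: "K \<ge> 0" using L_nonneg by (simp add: K_def)
  have g0: "?g y = 0" if "norm y > R + \<eta>" for y
  proof (rule smoothed_gradient_support)
    fix x assume "x \<in> E"
    then show "\<eta> \<le> norm (y - x)" using R[of x] that norm_triangle_ineq2[of y x] by linarith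
  qed
  have "K-lipschitz_on UNIV ?g"
    using smoothed_gradient_lipschitz[OF E] K unfolding K_def[symmetric]
    by (intro lipschitz_onI) (auto simp: dist_norm)
  then have contg: "continuous_on UNIV ?g" by (rule lipschitz_on_continuous_on)
  have contf: "continuous_on UNIV (conv ?u)"
    using conv_has_derivative[OF u] by (intro continuous_at_imp_continuous_on ballI has_derivative_continuous) blast
  have tay: "\<bar>conv ?u y - conv ?u x - ?g x \<bullet> (y - x)\<bar> \<le> K * (norm (y - x))\<^sup>2" for x y
    using conv_taylor[OF u, of y x] unfolding smoothed_gradient_inner[OF E] K_def by simp
  have "conv ?u x = 1" if "x \<in> C" for x
  proof -
    have "k (x - y) * ?u y = k (x - y)" for y
    proof (cases "norm (x - y) < \<eta>")
      case True
      then have "y \<in> E" using C(2)[OF that] by (auto simp: dist_norm)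
      then show ?thesis by simp
    qed (use support(1)[of "x - y"] in simp)
    then have "(\<lambda>y. k (x - y) *\<^sub>R ?u y) = (\<lambda>y. k (x - y))" by (intro ext) (simp only: real_scaleR_def)
    then show ?thesis by (simp only: conv_def integral_kernel_shift)
  qed
  moreover have "conv ?u x \<ge> 0" for x
    unfolding conv_def using nonneg by (intro integral_nonneg_AE AE_I2) simp
  moreover have "conv ?u x = 0" if "norm x > R + \<eta>" for x
    using that by (intro conv_support(1)[of R] u0) auto
  ultimately show "DIM('a) * unit_ball_vol (real DIM('a)) * r ^ (DIM('a) - 1) \<le> (\<integral>y. norm (?g y) \<partial>lborel)"
    using contf contg g0 K C \<eta>_pos tay
    by (intro integral_gradient_ge[where R="R + \<eta>" and C=C and L=K and f="conv ?u"]) (auto simp: R_def)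
  have "integrable lborel (\<lambda>x. indicator (cball 0 (R + \<eta>)) x *\<^sub>R norm (?g x))"
    using contg by (intro borel_integrable_compact continuous_intros) (auto intro: continuous_on_subset)
  moreover have "(\<lambda>x. indicator (cball 0 (R + \<eta>)) x *\<^sub>R norm (?g x)) = (\<lambda>x. norm (?g x))"
    using g0 by (auto simp: fun_eq_iff indicator_def not_le)
  ultimately show "integrable lborel (\<lambda>x. norm (?g x))" by simp
qed

text \<open>A point where both smoothed gradients are nonzero would be closer than
  \<open>\<eta>\<close> to \<open>A\<close> and to \<open>B\<close>, against the distance
  \<open>2 * \<eta>\<close> of the two sets. So the norms add pointwise, and each integral has its
  own isoperimetric bound.\<close>

lemma perimeter_Un_ge:
  fixes A B C D :: "'a set"
  assumes A: "A \<in> sets borel" "bounded A" and B: "B \<in> sets borel" "bounded B"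
    and sep: "\<And>x y. x \<in> A \<Longrightarrow> y \<in> B \<Longrightarrow> dist x y \<ge> 2 * \<eta>"
    and C: "C \<in> lmeasurable" "\<And>x. x \<in> C \<Longrightarrow> ball x \<eta> \<subseteq> A" "r > 0"
      "unit_ball_vol (real DIM('a)) * r ^ DIM('a) \<le> measure lebesgue C"
    and D: "D \<in> lmeasurable" "\<And>x. x \<in> D \<Longrightarrow> ball x \<eta> \<subseteq> B" "s > 0"
      "unit_ball_vol (real DIM('a)) * s ^ DIM('a) \<le> measure lebesgue D"
  shows "ennreal (DIM('a) * unit_ball_vol (real DIM('a)) * (r ^ (DIM('a) - 1) + s ^ (DIM('a) - 1))) \<le> perimeter (A \<union> B)"
proof -
  have disj: "A \<inter> B = {}" using sep \<eta>_pos by force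
  have "norm (smoothed_gradient (A \<union> B) y) = norm (smoothed_gradient A y) + norm (smoothed_gradient B y)" for y :: 'a
  proof -
    have ind: "indicator (A \<union> B) x = (indicator A x + indicator B x :: real)" for x :: 'a
      using disj by (auto simp: indicator_def)
    have "smoothed_gradient (A \<union> B) y = smoothed_gradient A y + smoothed_gradient B y"
      unfolding smoothed_gradient_def ind scaleR_add_left
      using integrable_smoothed_gradient A B by (intro Bochner_Integration.integral_add) auto
    moreover have "smoothed_gradient A y = 0 \<or> smoothed_gradient B y = 0"
    proof (rule ccontr)
      assume "\<not> ?thesis"
      then obtain a b where "a \<in> A" "norm (y - a) < \<eta>" "b \<in> B" "norm (y - b) < \<eta>"
        using smoothed_gradient_support[of A y] smoothed_gradient_support[of B y] by (meson not_le)
      then show False using sep[of a b] dist_triangle2[of a b y] by (simp add: dist_norm norm_minus_commute)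
    qed
    ultimately show ?thesis by auto
  qed
  then have "(\<integral>y. norm (smoothed_gradient (A \<union> B) y) \<partial>lborel)
      = (\<integral>y. norm (smoothed_gradient A y) \<partial>lborel) + (\<integral>y. norm (smoothed_gradient B y) \<partial>lborel)"
    using smoothed_gradient_isoperimetric(1)[OF A C] smoothed_gradient_isoperimetric(1)[OF B D] by simp
  then have "DIM('a) * unit_ball_vol (real DIM('a)) * (r ^ (DIM('a) - 1) + s ^ (DIM('a) - 1))
      \<le> (\<integral>y. norm (smoothed_gradient (A \<union> B) y) \<partial>lborel)"
    using smoothed_gradient_isoperimetric(2)[OF A C] smoothed_gradient_isoperimetric(2)[OF B D]
    by (simp add: distrib_left)
  then have "ennreal (DIM('a) * unit_ball_vol (real DIM('a)) * (r ^ (DIM('a) - 1) + s ^ (DIM('a) - 1)))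
      \<le> ennreal (\<integral>y. norm (smoothed_gradient (A \<union> B) y) \<partial>lborel)"
    by (rule ennreal_leI)
  also have "\<dots> \<le> perimeter (A \<union> B)" using A B by (intro perimeter_ge_smoothed_gradient) auto
  finally show ?thesis .
qed

end

section \<open>The Riesz energy under expanding maps and on the unit ball\<close>

lemma borel_measurable_riesz_kernel [measurable]:
  "(\<lambda>p :: 'a::euclidean_space \<times> 'a. 1 / ennreal (norm (fst p - snd p) powr \<alpha>)) \<in> borel_measurable (borel \<Otimes>\<^sub>M borel)"
  by measurable

text \<open>Pushing a measure from \<open>F\<close> into \<open>E\<close> by \<open>T\<close>
  shrinks distances at most by the factor \<open>l\<close>, so the kernel grows at most by
  \<open>l powr (- \<alpha>)\<close>. The same estimate serves for lower semicontinuity, for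
  translations and for dilations of the unit ball.\<close>

lemma riesz_energy_expanding:
  fixes T :: "'a::euclidean_space \<Rightarrow> 'a"
  assumes [measurable]: "T \<in> borel \<rightarrow>\<^sub>M borel" "E \<in> sets borel" "F \<in> sets borel" and TF: "T ` F \<subseteq> E"
    and l: "l > 0" "\<And>x y. x \<in> F \<Longrightarrow> y \<in> F \<Longrightarrow> l * norm (x - y) \<le> norm (T x - T y)" and "\<alpha> > 0"
  shows "ennreal (l powr \<alpha>) * riesz_energy \<alpha> E \<le> riesz_energy \<alpha> F"
  unfolding riesz_energy_def[of \<alpha> F]
proof (rule INF_greatest)
  fix \<mu> :: "'a measure" assume "\<mu> \<in> {\<mu>. sets \<mu> = sets borel \<and> emeasure \<mu> F = 1}"
  then have [measurable_cong]: "sets \<mu> = sets borel" and \<mu>F: "emeasure \<mu> F = 1" by auto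
  let ?K = "\<lambda>x y :: 'a. 1 / ennreal (norm (x - y) powr \<alpha>)"
  \<comment> \<open>The measure \<open>\<mu>\<close> may fail to be sigma-finite. Its restriction to
    \<open>F\<close> has total mass 1, which makes the inner integrals measurable functions.\<close>
  define N where "N = density \<mu> (indicator F)"
  have [measurable_cong]: "sets N = sets borel" by (simp add: N_def \<open>sets \<mu> = sets borel\<close>)
  have spm: "space \<mu> = UNIV" using sets_eq_imp_space_eq[OF \<open>sets \<mu> = sets borel\<close>] by simp
  have spN: "space N = UNIV" by (simp add: N_def spm)
  have "emeasure N (space N) = 1"
    unfolding spN N_def using \<mu>F by (subst emeasure_density) (auto simp: spm nn_integral_indicator)
  then have "finite_measure N" by (intro finite_measureI) simp
  then interpret N: finite_measure N .
  have density: "(\<integral>\<^sup>+x. h x \<partial>N) = (\<integral>\<^sup>+x. indicator F x * h x \<partial>\<mu>)" if [measurable]: "h \<in> borel_measurable borel" for h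
    unfolding N_def by (rule nn_integral_density) measurable
  let ?\<nu> = "distr N borel T"
  interpret nu: finite_measure ?\<nu> by (rule N.finite_measure_distr) measurable
  have [measurable]: "T -` E \<in> sets borel" by (rule measurable_sets_borel[of T borel E]) measurable
  have "emeasure ?\<nu> E = emeasure N (T -` E)" by (subst emeasure_distr) (auto simp: spN)
  also have "\<dots> = (\<integral>\<^sup>+x. indicator F x * indicator (T -` E) x \<partial>\<mu>)"
    unfolding N_def by (rule emeasure_density) measurable
  also have "\<dots> = (\<integral>\<^sup>+x. indicator F x \<partial>\<mu>)"
    using TF by (intro nn_integral_cong) (auto simp: indicator_def)
  also have "\<dots> = 1" using \<mu>F by (subst nn_integral_indicator) auto
  finally have "riesz_energy \<alpha> E \<le> (\<integral>\<^sup>+x. (\<integral>\<^sup>+y. ?K x y \<partial>?\<nu>) \<partial>?\<nu>)"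
    unfolding riesz_energy_def by (intro INF_lower) simp
  moreover have "(\<integral>\<^sup>+x. (\<integral>\<^sup>+y. ?K x y \<partial>?\<nu>) \<partial>?\<nu>) = (\<integral>\<^sup>+x. (\<integral>\<^sup>+y. ?K (T x) y \<partial>?\<nu>) \<partial>N)"
    by (rule nn_integral_distr) measurable
  moreover have "\<dots> = (\<integral>\<^sup>+x. (\<integral>\<^sup>+y. ?K (T x) (T y) \<partial>N) \<partial>N)"
    by (intro nn_integral_cong nn_integral_distr) measurable
  ultimately have 1: "riesz_energy \<alpha> E \<le> (\<integral>\<^sup>+x. (\<integral>\<^sup>+y. ?K (T x) (T y) \<partial>N) \<partial>N)" by (simp only:)
  have pt: "ennreal (l powr \<alpha>) * ?K (T x) (T y) \<le> ?K x y" if "x \<in> F" "y \<in> F" for x y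
  proof (cases "x = y")
    case False
    have pos: "0 < l * norm (x - y)" using l False by simp
    have "(l * norm (x - y)) powr \<alpha> \<le> norm (T x - T y) powr \<alpha>"
      using l(2)[OF that] pos \<open>\<alpha> > 0\<close> by (intro powr_mono2) auto
    then have "l powr \<alpha> * norm (x - y) powr \<alpha> \<le> norm (T x - T y) powr \<alpha>"
      using l by (simp add: powr_mult)
    moreover have p: "0 < norm (x - y) powr \<alpha>" "0 < norm (T x - T y) powr \<alpha>"
      using False pos l(2)[OF that] by auto
    ultimately have "l powr \<alpha> * (1 / norm (T x - T y) powr \<alpha>) \<le> 1 / norm (x - y) powr \<alpha>"
      by (simp add: field_simps)
    then have "ennreal (l powr \<alpha> * (1 / norm (T x - T y) powr \<alpha>)) \<le> ennreal (1 / norm (x - y) powr \<alpha>)"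
      by (rule ennreal_leI)
    then show ?thesis using p by (simp add: ennreal_mult divide_ennreal[symmetric] ennreal_times_divide del: ennreal_le_iff)
  qed (use \<open>\<alpha> > 0\<close> in simp)
  let ?c = "ennreal (l powr \<alpha>)"
  have "?c * riesz_energy \<alpha> E \<le> ?c * (\<integral>\<^sup>+x. (\<integral>\<^sup>+y. ?K (T x) (T y) \<partial>N) \<partial>N)"
    using 1 by (rule mult_left_mono) simp
  also have "\<dots> = (\<integral>\<^sup>+x. ?c * (\<integral>\<^sup>+y. ?K (T x) (T y) \<partial>N) \<partial>N)"
    by (rule nn_integral_cmult[symmetric]) measurable
  also have "\<dots> = (\<integral>\<^sup>+x. (\<integral>\<^sup>+y. ?c * ?K (T x) (T y) \<partial>N) \<partial>N)"
    by (intro nn_integral_cong nn_integral_cmult[symmetric]) measurable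
  also have "\<dots> = (\<integral>\<^sup>+x. indicator F x * (\<integral>\<^sup>+y. ?c * ?K (T x) (T y) \<partial>N) \<partial>\<mu>)"
    by (rule density) measurable
  also have "\<dots> = (\<integral>\<^sup>+x. indicator F x * (\<integral>\<^sup>+y. indicator F y * (?c * ?K (T x) (T y)) \<partial>\<mu>) \<partial>\<mu>)"
    by (intro nn_integral_cong arg_cong2[where f="(*)"] refl density) measurable
  also have "\<dots> \<le> (\<integral>\<^sup>+x. (\<integral>\<^sup>+y. ?K x y \<partial>\<mu>) \<partial>\<mu>)"
  proof (rule nn_integral_mono)
    fix x
    show "indicator F x * (\<integral>\<^sup>+y. indicator F y * (?c * ?K (T x) (T y)) \<partial>\<mu>) \<le> (\<integral>\<^sup>+y. ?K x y \<partial>\<mu>)"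
      using pt[of x] by (cases "x \<in> F") (auto intro!: nn_integral_mono simp: indicator_def)
  qed
  finally show "ennreal (l powr \<alpha>) * riesz_energy \<alpha> E \<le> (\<integral>\<^sup>+x. (\<integral>\<^sup>+y. ?K x y \<partial>\<mu>) \<partial>\<mu>)" .
qed

text \<open>The kernel is dominated by \<open>(2 ^ n) powr \<alpha>\<close> on balls of radius
  \<open>2 * (1/2) ^ n\<close>. The integrals of these terms form a geometric series with ratio
  \<open>2 powr (\<alpha> - d)\<close>, \<open>d\<close> being the dimension. Radius 2 is the
  diameter of the unit ball.\<close>

lemma nn_integral_inverse_norm_powr_finite:
  assumes "0 < \<alpha>" "\<alpha> < real DIM('a::euclidean_space)"
  shows "(\<integral>\<^sup>+z. indicator (cball 0 2) z * (1 / ennreal (norm (z::'a) powr \<alpha>)) \<partial>lborel) < \<infinity>"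
proof -
  let ?d = "DIM('a)" and ?w = "unit_ball_vol (real DIM('a))"
  let ?r = "\<lambda>n::nat. 2 * (1/2) ^ n :: real"
  have [measurable]: "cball (0::'a) r \<in> sets borel" for r by simp
  have w: "?w \<ge> 0" by simp
  have "(\<integral>\<^sup>+z. indicator (cball 0 2) z * (1 / ennreal (norm (z::'a) powr \<alpha>)) \<partial>lborel)
     \<le> (\<integral>\<^sup>+z. (\<Sum>n. ennreal ((2 ^ n) powr \<alpha>) * indicator (cball (0::'a) (?r n)) z) \<partial>lborel)"
  proof (rule nn_integral_mono_AE)
    show "AE z in lborel. indicator (cball 0 2) z * (1 / ennreal (norm (z::'a) powr \<alpha>))
       \<le> (\<Sum>n. ennreal ((2 ^ n) powr \<alpha>) * indicator (cball (0::'a) (?r n)) z)"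
      using AE_lborel_singleton[of "0::'a"]
    proof eventually_elim
      case (elim z)
      show ?case
      proof (cases "norm z \<le> 2")
        case True
        \<comment> \<open>Minimality, or \<open>norm z \<le> 2\<close> when \<open>n = 0\<close>,
          puts \<open>z\<close> into the \<open>n\<close>-th ball. The defining inequality reads
          \<open>(1/2) ^ n < norm z\<close> and bounds the kernel by the \<open>n\<close>-th
          coefficient.\<close>
        define n where "n = (LEAST n. ?r (Suc n) < norm z)"
        have "(\<lambda>n. 2 * (1/2) ^ Suc n :: real) \<longlonglongrightarrow> 2 * 0"
          by (intro tendsto_intros LIMSEQ_Suc[OF LIMSEQ_power_zero]) simp
        then have "\<forall>\<^sub>F n in sequentially. ?r (Suc n) < norm z" using elim by (intro order_tendstoD(2)) auto
        then have ex: "\<exists>n. ?r (Suc n) < norm z" using eventually_happens trivial_limit_sequentially by blast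
        then have n1: "?r (Suc n) < norm z" unfolding n_def by (rule LeastI_ex)
        have n2: "norm z \<le> ?r n"
        proof (cases n)
          case (Suc m)
          then have "\<not> ?r (Suc m) < norm z" using not_less_Least[of m "\<lambda>n. ?r (Suc n) < norm z"] by (simp add: n_def)
          then show ?thesis using Suc by simp
        qed (use True in simp)
        have "1 / norm z \<le> 2 ^ n" using n1 elim by (simp add: power_one_over field_simps)
        then have "(1 / norm z) powr \<alpha> \<le> (2 ^ n) powr \<alpha>" using elim assms by (intro powr_mono2) auto
        then have "1 / norm z powr \<alpha> \<le> (2 ^ n) powr \<alpha>" by (simp add: powr_divide)
        then have "ennreal (1 / norm z powr \<alpha>) \<le> ennreal ((2 ^ n) powr \<alpha>)" by (rule ennreal_leI)
        then have "1 / ennreal (norm z powr \<alpha>) \<le> ennreal ((2 ^ n) powr \<alpha>)"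
          using elim by (subst (asm) divide_ennreal[symmetric]) auto
        also have "\<dots> = (\<Sum>m\<in>{n}. ennreal ((2 ^ m) powr \<alpha>) * indicator (cball (0::'a) (?r m)) z)" using n2 by simp
        also have "\<dots> \<le> (\<Sum>n. ennreal ((2 ^ n) powr \<alpha>) * indicator (cball (0::'a) (?r n)) z)"
          by (rule sum_le_suminf) auto
        finally show ?thesis using True by simp
      qed simp
    qed
  qed
  also have "\<dots> = (\<Sum>n. \<integral>\<^sup>+z. ennreal ((2 ^ n) powr \<alpha>) * indicator (cball (0::'a) (?r n)) z \<partial>lborel)"
    by (rule nn_integral_suminf, rule borel_measurable_times_ennreal) (auto intro!: borel_measurable_indicator)
  also have "\<dots> = (\<Sum>n. ennreal (?w * 2 ^ ?d * (2 powr (\<alpha> - ?d)) ^ n))"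
  proof (rule suminf_cong)
    fix n
    have "(\<integral>\<^sup>+z. ennreal ((2 ^ n) powr \<alpha>) * indicator (cball (0::'a) (?r n)) z \<partial>lborel)
       = ennreal ((2 ^ n) powr \<alpha>) * emeasure lborel (cball (0::'a) (?r n))"
      by (rule nn_integral_cmult_indicator) simp
    also have "\<dots> = ennreal ((2 ^ n) powr \<alpha>) * ennreal (?w * ?r n ^ ?d)"
      by (subst emeasure_cball) simp_all
    also have "\<dots> = ennreal ((2 ^ n) powr \<alpha> * (?w * ?r n ^ ?d))" by (rule ennreal_mult[symmetric]) auto
    also have "(2 ^ n) powr \<alpha> * (?w * ?r n ^ ?d) = ?w * 2 ^ ?d * ((2 powr \<alpha>) ^ n * ((1/2) ^ ?d) ^ n)"
    proof -
      have "(2::real) ^ n = 2 powr real n" "(2 powr \<alpha>) ^ n = (2 powr \<alpha>) powr real n"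
        by (simp_all add: powr_realpow)
      then have a: "(2 ^ n) powr \<alpha> = (2 powr \<alpha>) ^ n" by (simp only: powr_powr mult.commute)
      have b: "?r n ^ ?d = 2 ^ ?d * ((1/2) ^ ?d) ^ n"
        by (simp only: power_mult_distrib power_mult[symmetric] mult.commute)
      show ?thesis unfolding a b by (simp only: mult_ac)
    qed
    also have "(2 powr \<alpha>) ^ n * ((1/2) ^ ?d) ^ n = (2 powr (\<alpha> - ?d)) ^ n"
    proof -
      have "2 powr (\<alpha> - ?d) = 2 powr \<alpha> * (1/2) ^ ?d" by (simp add: powr_diff powr_realpow power_one_over)
      then show ?thesis by (simp only: power_mult_distrib)
    qed
    finally show "(\<integral>\<^sup>+z. ennreal ((2 ^ n) powr \<alpha>) * indicator (cball (0::'a) (?r n)) z \<partial>lborel)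
       = ennreal (?w * 2 ^ ?d * (2 powr (\<alpha> - ?d)) ^ n)" .
  qed
  also have "\<dots> = ennreal (\<Sum>n. ?w * 2 ^ ?d * (2 powr (\<alpha> - ?d)) ^ n)"
  proof (rule suminf_ennreal_eq[THEN trans])
    have "2 powr (\<alpha> - ?d) < 2 powr 0" using assms by (intro powr_less_mono) auto
    then have "summable (\<lambda>n. ?w * 2 ^ ?d * (2 powr (\<alpha> - ?d)) ^ n)"
      by (intro summable_mult summable_geometric) auto
    then show "(\<lambda>n. ?w * 2 ^ ?d * (2 powr (\<alpha> - ?d)) ^ n) sums (\<Sum>n. ?w * 2 ^ ?d * (2 powr (\<alpha> - ?d)) ^ n)"
      by (rule summable_sums)
  qed auto
  finally show ?thesis by (simp add: order_le_less_trans)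
qed

text \<open>The uniform probability measure has finite energy: for \<open>x\<close> in the unit ball
  all differences \<open>y - x\<close> lie in the ball of radius 2, so the potential at
  \<open>x\<close> is at most the integral of the previous lemma divided by the volume.\<close>

lemma riesz_energy_unit_ball_finite:
  assumes "0 < \<alpha>" "\<alpha> < real DIM('a::euclidean_space)"
  shows "riesz_energy \<alpha> (cball (0::'a) 1) < \<infinity>"
proof -
  let ?B = "cball (0::'a) 1"
  let ?K = "\<lambda>x y :: 'a. 1 / ennreal (norm (x - y) powr \<alpha>)"
  define J where "J = (\<integral>\<^sup>+z. indicator (cball 0 2) z * (1 / ennreal (norm (z::'a) powr \<alpha>)) \<partial>lborel)"
  have J: "J < \<infinity>" unfolding J_def by (rule nn_integral_inverse_norm_powr_finite[OF assms])
  define v where "v = emeasure lborel ?B"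
  have [measurable]: "cball (0::'a) r \<in> sets borel" for r by simp
  let ?\<mu> = "density lborel (\<lambda>x. indicator ?B x / v)"
  have v: "v \<noteq> 0" "v < \<infinity>"
  proof -
    show "v < \<infinity>" unfolding v_def using emeasure_lborel_cball_finite[of "0::'a" 1] by simp
    show "v \<noteq> 0" unfolding v_def using content_cball_pos[of 1 "0::'a"] by (auto simp: measure_def)
  qed
  have "(\<integral>\<^sup>+x. indicator ?B x / v \<partial>lborel) = (\<integral>\<^sup>+x. indicator ?B x \<partial>lborel) / v"
    by (rule nn_integral_divide) measurable
  also have "(\<integral>\<^sup>+x. indicator ?B x \<partial>lborel) = v" unfolding v_def by (rule nn_integral_indicator) simp
  also have "v / v = 1" using v by (intro ennreal_divide_self) auto
  finally have one: "(\<integral>\<^sup>+x. indicator ?B x / v \<partial>lborel) = 1" .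
  have "emeasure ?\<mu> ?B = (\<integral>\<^sup>+x. indicator ?B x / v * indicator ?B x \<partial>lborel)"
  proof (rule emeasure_density)
    show "?B \<in> sets lborel" by simp
  qed measurable
  also have "\<dots> = (\<integral>\<^sup>+x. indicator ?B x / v \<partial>lborel)" by (intro nn_integral_cong) (auto simp: indicator_def)
  also note one
  finally have "riesz_energy \<alpha> ?B \<le> (\<integral>\<^sup>+x. (\<integral>\<^sup>+y. ?K x y \<partial>?\<mu>) \<partial>?\<mu>)"
    unfolding riesz_energy_def by (intro INF_lower) simp
  also have "\<dots> \<le> (\<integral>\<^sup>+x. indicator ?B x / v * (J / v) \<partial>lborel)"
  proof -
    have inner: "(\<integral>\<^sup>+y. ?K x y \<partial>?\<mu>) \<le> J / v" if x: "x \<in> ?B" for x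
    proof -
      have "(\<integral>\<^sup>+y. ?K x y \<partial>?\<mu>) = (\<integral>\<^sup>+y. indicator ?B y / v * ?K x y \<partial>lborel)"
        by (rule nn_integral_density) measurable
      also have "\<dots> \<le> (\<integral>\<^sup>+y. (indicator (cball 0 2) (y - x) * ?K (y - x) 0) / v \<partial>lborel)"
      proof (rule nn_integral_mono)
        fix y
        have comm: "1 / v * c = c / v" for c using ennreal_times_divide[of c 1 v] by (simp add: mult.commute)
        show "indicator ?B y / v * ?K x y \<le> (indicator (cball 0 2) (y - x) * ?K (y - x) 0) / v"
        proof (cases "y \<in> ?B")
          case True
          then have "norm (y - x) \<le> 2" using x norm_triangle_ineq4[of y x] by simp
          then have 1: "indicator ?B y = (1::ennreal)" "indicator (cball 0 2) (y - x) = (1::ennreal)" using True by simp_all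
          have 2: "?K (y - x) 0 = ?K x y" by (simp add: norm_minus_commute)
          show ?thesis unfolding 1 2 comm by simp
        qed simp
      qed
      also have "\<dots> = (\<integral>\<^sup>+y. (indicator (cball 0 2) (y - x) * ?K (y - x) 0) \<partial>lborel) / v"
        by (rule nn_integral_divide) measurable
      also have "(\<integral>\<^sup>+y. (indicator (cball 0 2) (y - x) * ?K (y - x) 0) \<partial>lborel) = J"
      proof -
        define f where "f z = indicator (cball 0 2) z * (1 / ennreal (norm (z::'a) powr \<alpha>))" for z
        have [measurable]: "f \<in> borel_measurable borel" unfolding f_def by measurable
        have "(\<integral>\<^sup>+y. f (- x + y) \<partial>lborel) = (\<integral>\<^sup>+y. f y \<partial>distr lborel borel ((+) (- x)))"
          by (rule nn_integral_distr[symmetric]) measurable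
        then show ?thesis by (simp add: J_def f_def lborel_distr_plus)
      qed
      finally show ?thesis .
    qed
    have "(\<integral>\<^sup>+x. (\<integral>\<^sup>+y. ?K x y \<partial>?\<mu>) \<partial>?\<mu>) \<le> (\<integral>\<^sup>+x. J / v \<partial>?\<mu>)"
    proof (rule nn_integral_mono_AE)
      show "AE x in ?\<mu>. (\<integral>\<^sup>+y. ?K x y \<partial>?\<mu>) \<le> J / v"
        using inner by (subst AE_density) (measurable, auto simp: indicator_def)
    qed
    also have "\<dots> = (\<integral>\<^sup>+x. indicator ?B x / v * (J / v) \<partial>lborel)"
      by (rule nn_integral_density) measurable
    finally show ?thesis .
  qed
  also have "\<dots> = (\<integral>\<^sup>+x. indicator ?B x / v \<partial>lborel) * (J / v)"
    by (rule nn_integral_multc) measurable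
  also have "\<dots> < \<infinity>"
    using v J unfolding one by (simp add: ennreal_divide_eq_top_iff less_top[symmetric])
  finally show ?thesis .
qed

section \<open>The perimeter of a ball from above\<close>

lemma compactly_supported_C1_bounds:
  fixes \<phi> :: "'a::euclidean_space \<Rightarrow> 'a"
  assumes "compactly_supported_C1 \<phi>"
  obtains \<phi>' :: "'a \<Rightarrow> 'a \<Rightarrow>\<^sub>L 'a" and S M where "\<And>x. (\<phi> has_derivative blinfun_apply (\<phi>' x)) (at x)"
    "continuous_on UNIV \<phi>'" "S > 0" "M > 0" "\<And>x. norm x > S \<Longrightarrow> \<phi> x = 0" "\<And>x. norm x > S \<Longrightarrow> \<phi>' x = 0"
    "\<And>x. norm (\<phi>' x) \<le> M" "\<And>x y. norm (\<phi> x - \<phi> y) \<le> M * norm (x - y)"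
proof -
  obtain \<phi>' :: "'a \<Rightarrow> 'a \<Rightarrow>\<^sub>L 'a" where d: "\<And>x. (\<phi> has_derivative blinfun_apply (\<phi>' x)) (at x)"
    and c: "continuous_on UNIV \<phi>'" and K: "compact (closure {x. \<phi> x \<noteq> 0})"
    using assms unfolding compactly_supported_C1_def by blast
  obtain S where S: "S > 0" "\<And>x. x \<in> closure {x. \<phi> x \<noteq> 0} \<Longrightarrow> norm x \<le> S"
    using compact_imp_bounded[OF K] unfolding bounded_pos by blast
  have z: "\<phi> x = 0" if "norm x > S" for x
    using S(2)[of x] that closure_subset[of "{x. \<phi> x \<noteq> 0}"] by force
  have z': "\<phi>' x = 0" if "norm x > S" for x
  proof -
    have "((\<lambda>_. 0 :: 'a) has_derivative blinfun_apply (\<phi>' x)) (at x)"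
    proof (rule has_derivative_transform_within_open[OF d])
      show "open {y :: 'a. S < norm y}" by (intro open_Collect_less continuous_intros)
    qed (use that z in auto)
    then have "blinfun_apply (\<phi>' x) = (\<lambda>_. 0)" using has_derivative_const has_derivative_unique by blast
    then show ?thesis by (intro blinfun_eqI) simp
  qed
  have "compact (\<phi>' ` cball 0 S)" by (intro compact_continuous_image continuous_on_subset[OF c]) auto
  then have "bounded (\<phi>' ` cball 0 S)" by (rule compact_imp_bounded)
  then obtain M where M: "M > 0" "\<And>x. x \<in> cball 0 S \<Longrightarrow> norm (\<phi>' x) \<le> M"
    unfolding bounded_pos by auto
  have b: "norm (\<phi>' x) \<le> M" for x using M z'[of x] by (cases "norm x > S") auto
  have "norm (\<phi> x - \<phi> y) \<le> M * norm (x - y)" for x y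
    by (rule differentiable_bound[of UNIV \<phi> "\<lambda>x. blinfun_apply (\<phi>' x)"]) (use d b in \<open>auto simp: norm_blinfun.rep_eq[symmetric]\<close>)
  then show thesis using that d c S(1) M(1) z z' b by blast
qed

lemma divergence_eq:
  assumes "(\<phi> has_derivative D) (at x)"
  shows "divergence \<phi> x = (\<Sum>b\<in>Basis. D b \<bullet> b)"
  unfolding divergence_def using frechet_derivative_at[OF assms] by simp

lemma integral_translate:
  fixes u :: "'a::euclidean_space \<Rightarrow> real"
  assumes [measurable]: "u \<in> borel_measurable borel"
  shows "(\<integral>x. u (x + c) \<partial>lborel) = (\<integral>x. u x \<partial>lborel)"
  by (subst (2) lborel_distr_plus[symmetric, of c], subst integral_distr) (auto simp: add.commute)

text \<open>Integration by parts against a Lipschitz cutoff, carried out with difference quotients.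
  Translation invariance moves the quotient from \<open>\<phi>\<close> to \<open>\<psi>\<close>, and
  both sides converge by dominated convergence. Off two spheres, which are null,
  \<open>\<psi>\<close> is differentiable; its gradient has norm \<open>1 / \<epsilon>\<close> in
  the shell and is 0 elsewhere.\<close>

lemma integral_radial_cutoff_le:
  fixes \<phi> :: "'a::euclidean_space \<Rightarrow> 'a" and \<psi> :: "'a \<Rightarrow> real"
  assumes \<phi>: "compactly_supported_C1 \<phi>" "\<And>x. norm (\<phi> x) \<le> 1" and "0 < R" "0 < \<epsilon>"
  defines "\<psi> \<equiv> \<lambda>x. max 0 (min 1 ((R + \<epsilon> - norm x) / \<epsilon>))"
  shows "(\<integral>x. \<psi> x * divergence \<phi> x \<partial>lborel) \<le> measure lborel (cball (0::'a) (R + \<epsilon>) - cball 0 R) / \<epsilon>"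
proof -
  obtain \<phi>' :: "'a \<Rightarrow> 'a \<Rightarrow>\<^sub>L 'a" and S M where d: "\<And>x. (\<phi> has_derivative blinfun_apply (\<phi>' x)) (at x)"
    and c: "continuous_on UNIV \<phi>'" and S: "S > 0" and M: "M > 0" and z: "\<And>x. norm x > S \<Longrightarrow> \<phi> x = 0" "\<And>x. norm x > S \<Longrightarrow> \<phi>' x = 0"
    and b: "\<And>x. norm (\<phi>' x) \<le> M" and lip: "\<And>x y. norm (\<phi> x - \<phi> y) \<le> M * norm (x - y)"
    by (rule compactly_supported_C1_bounds[OF \<phi>(1)], rule that)
  have cont\<phi>: "continuous_on UNIV \<phi>" using d by (intro continuous_at_imp_continuous_on ballI has_derivative_continuous) blast
  have [measurable]: "\<phi> \<in> borel_measurable borel" using cont\<phi> by (rule borel_measurable_continuous_onI)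
  have [measurable]: "(\<lambda>x. blinfun_apply (\<phi>' x) b) \<in> borel_measurable borel" for b
    by (intro borel_measurable_continuous_onI continuous_intros c)
  have [measurable]: "\<psi> \<in> borel_measurable borel"
    unfolding \<psi>_def using \<open>\<epsilon> > 0\<close> by (intro borel_measurable_continuous_onI continuous_intros) auto
  have \<psi>01: "0 \<le> \<psi> x" "\<psi> x \<le> 1" for x by (auto simp: \<psi>_def)
  have \<psi>0: "\<psi> x = 0" if "norm x \<ge> R + \<epsilon>" for x using that \<open>\<epsilon> > 0\<close> by (simp add: \<psi>_def divide_le_0_iff)
  have \<psi>lip: "\<bar>\<psi> x - \<psi> y\<bar> \<le> norm (x - y) / \<epsilon>" for x y
  proof -
    have "\<bar>\<psi> x - \<psi> y\<bar> \<le> \<bar>(R + \<epsilon> - norm x) / \<epsilon> - (R + \<epsilon> - norm y) / \<epsilon>\<bar>" unfolding \<psi>_def by linarith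
    also have "\<dots> = \<bar>norm x - norm y\<bar> / \<epsilon>" using \<open>\<epsilon> > 0\<close> by (simp add: diff_divide_distrib[symmetric] abs_divide abs_minus_commute)
    also have "\<dots> \<le> norm (x - y) / \<epsilon>" using \<open>\<epsilon> > 0\<close> norm_triangle_ineq3 by (intro divide_right_mono) auto
    finally show ?thesis .
  qed
  define h where "h n = 1 / real (Suc n)" for n
  have h: "0 < h n" "h n \<le> 1" for n by (auto simp: h_def)
  have h0: "h \<longlonglongrightarrow> 0" unfolding h_def by (rule LIMSEQ_inverse_real_of_nat[unfolded inverse_eq_divide])
  let ?Q = "\<lambda>n x. \<Sum>b\<in>Basis. \<psi> x * ((\<phi> (x + h n *\<^sub>R b) - \<phi> x) \<bullet> b) / h n"
  let ?T = "\<lambda>n x. \<Sum>b\<in>Basis. (\<phi> x \<bullet> b) * (\<psi> (x - h n *\<^sub>R b) - \<psi> x) / h n"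
  have cball: "integrable lborel (\<lambda>x. K * indicator (cball (0::'a) r) x :: real)" for r K
    using emeasure_lborel_cball_finite[of "0::'a" r] by (intro integrable_mult_right integrable_real_indicator) auto
  have limQ: "(\<lambda>n. \<integral>x. ?Q n x \<partial>lborel) \<longlonglongrightarrow> (\<integral>x. \<psi> x * divergence \<phi> x \<partial>lborel)"
  proof (rule integral_dominated_convergence[where w="\<lambda>x. real DIM('a) * M * indicator (cball (0::'a) (R + \<epsilon>)) x"])
    show "(\<lambda>x. \<psi> x * divergence \<phi> x) \<in> borel_measurable lborel" unfolding divergence_eq[OF d] by measurable
    show "?Q n \<in> borel_measurable lborel" for n by measurable
    show "integrable lborel (\<lambda>x. real DIM('a) * M * indicator (cball (0::'a) (R + \<epsilon>)) x)" by (rule cball)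
    show "AE x in lborel. (\<lambda>n. ?Q n x) \<longlonglongrightarrow> \<psi> x * divergence \<phi> x"
    proof (rule AE_I2)
      fix x
      have "(\<lambda>n. ((\<phi> (x + h n *\<^sub>R b) - \<phi> x) \<bullet> b) / h n) \<longlonglongrightarrow> \<phi>' x b \<bullet> b" if "b \<in> Basis" for b
      proof -
        have "((\<lambda>t. \<phi> (x + t *\<^sub>R b)) has_derivative (\<lambda>t. \<phi>' x (t *\<^sub>R b))) (at 0)"
          using d[of x] by (intro has_derivative_compose[of "\<lambda>t. x + t *\<^sub>R b" "\<lambda>t. t *\<^sub>R b" 0 UNIV \<phi>])
            (auto intro!: derivative_eq_intros)
        then have "((\<lambda>t. \<phi> (x + t *\<^sub>R b)) has_vector_derivative \<phi>' x b) (at 0)"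
          by (simp add: has_vector_derivative_def blinfun.scaleR_right)
        then have "((\<lambda>t. \<phi> (x + t *\<^sub>R b) \<bullet> b) has_real_derivative \<phi>' x b \<bullet> b) (at 0)"
          unfolding has_real_derivative_iff_has_vector_derivative
          by (rule bounded_linear.has_vector_derivative[OF bounded_linear_inner_left])
        then have "((\<lambda>t. (\<phi> (x + t *\<^sub>R b) \<bullet> b - \<phi> x \<bullet> b) / t) \<longlongrightarrow> \<phi>' x b \<bullet> b) (at 0)"
          by (simp add: has_field_derivative_iff)
        moreover have "filterlim h (at 0) sequentially"
          using h0 h(1) by (intro filterlim_atI) (auto simp: less_imp_neq[THEN not_sym])
        ultimately have "(\<lambda>n. (\<phi> (x + h n *\<^sub>R b) \<bullet> b - \<phi> x \<bullet> b) / h n) \<longlonglongrightarrow> \<phi>' x b \<bullet> b"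
          by (rule filterlim_compose)
        then show ?thesis by (simp add: inner_diff_left)
      qed
      then have "(\<lambda>n. \<Sum>b\<in>Basis. \<psi> x * (((\<phi> (x + h n *\<^sub>R b) - \<phi> x) \<bullet> b) / h n)) \<longlonglongrightarrow> (\<Sum>b\<in>Basis. \<psi> x * (\<phi>' x b \<bullet> b))"
        by (intro tendsto_sum tendsto_mult_left)
      then show "(\<lambda>n. ?Q n x) \<longlonglongrightarrow> \<psi> x * divergence \<phi> x"
        unfolding divergence_eq[OF d] by (simp add: sum_distrib_left)
    qed
    show "AE x in lborel. norm (?Q n x) \<le> real DIM('a) * M * indicator (cball (0::'a) (R + \<epsilon>)) x" for n
    proof (rule AE_I2)
      fix x
      have "\<bar>\<psi> x * ((\<phi> (x + h n *\<^sub>R b) - \<phi> x) \<bullet> b) / h n\<bar> \<le> M" if b: "b \<in> Basis" for b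
      proof -
        have "\<bar>(\<phi> (x + h n *\<^sub>R b) - \<phi> x) \<bullet> b\<bar> \<le> M * h n"
          using Basis_le_norm[OF b, of "\<phi> (x + h n *\<^sub>R b) - \<phi> x"] lip[of "x + h n *\<^sub>R b" x] b h(1)[of n] by simp
        then have "\<psi> x * \<bar>(\<phi> (x + h n *\<^sub>R b) - \<phi> x) \<bullet> b\<bar> \<le> 1 * (M * h n)"
          using \<psi>01[of x] M h(1)[of n] by (intro mult_mono) auto
        then show ?thesis using \<psi>01[of x] h(1)[of n] by (simp add: abs_mult abs_divide divide_le_eq)
      qed
      then have "\<bar>?Q n x\<bar> \<le> real DIM('a) * M" using sum_norm_bound[of Basis "\<lambda>b. \<psi> x * ((\<phi> (x + h n *\<^sub>R b) - \<phi> x) \<bullet> b) / h n" M] by simp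
      then show "norm (?Q n x) \<le> real DIM('a) * M * indicator (cball (0::'a) (R + \<epsilon>)) x"
        using \<psi>0[of x] by (cases "norm x \<le> R + \<epsilon>") auto
    qed
  qed
  have parts: "(\<integral>x. ?Q n x \<partial>lborel) = (\<integral>x. ?T n x \<partial>lborel)" for n
  proof -
    have bd: "integrable lborel u" if "u \<in> borel_measurable borel" "\<And>x. \<bar>u x\<bar> \<le> 1" "\<And>x. norm x > r \<Longrightarrow> u x = 0" for u :: "'a \<Rightarrow> real" and r
      by (rule Bochner_Integration.integrable_bound[OF cball[of 1 r]]) (use that in \<open>auto simp: indicator_def not_le intro!: AE_I2\<close>)
    have \<phi>b: "\<bar>\<phi> x \<bullet> b\<bar> \<le> 1" if "b \<in> Basis" for x b using Basis_le_norm[OF that, of "\<phi> x"] \<phi>(2)[of x] by linarith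
    have le1: "\<bar>\<psi> x * u\<bar> \<le> 1" "\<bar>u * \<psi> x\<bar> \<le> 1" if "\<bar>u\<bar> \<le> 1" for x u
      using \<psi>01[of x] that mult_mono[of "\<psi> x" 1 "\<bar>u\<bar>" 1] by (auto simp: abs_mult mult.commute)
    have i1: "integrable lborel (\<lambda>x. \<psi> x * (\<phi> (x + h n *\<^sub>R b) \<bullet> b))" if "b \<in> Basis" for b
      by (rule bd[of _ "R + \<epsilon>"]) (use \<psi>0 le1 \<phi>b that in \<open>auto\<close>)
    have i2: "integrable lborel (\<lambda>x. \<psi> x * (\<phi> x \<bullet> b))" if "b \<in> Basis" for b
      by (rule bd[of _ "R + \<epsilon>"]) (use \<psi>0 le1 \<phi>b that in \<open>auto\<close>)
    have i3: "integrable lborel (\<lambda>x. \<psi> (x - h n *\<^sub>R b) * (\<phi> x \<bullet> b))" if "b \<in> Basis" for b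
      by (rule bd[of _ S]) (use z le1 \<phi>b that in \<open>auto\<close>)
    have "(\<integral>x. ?Q n x \<partial>lborel) = (\<Sum>b\<in>Basis. (\<integral>x. (\<psi> x * (\<phi> (x + h n *\<^sub>R b) \<bullet> b) - \<psi> x * (\<phi> x \<bullet> b)) / h n \<partial>lborel))"
      using i1 i2 by (subst Bochner_Integration.integral_sum[symmetric]) (auto simp: inner_diff_left right_diff_distrib)
    also have "\<dots> = (\<Sum>b\<in>Basis. (\<integral>x. (\<psi> (x - h n *\<^sub>R b) * (\<phi> x \<bullet> b) - \<psi> x * (\<phi> x \<bullet> b)) / h n \<partial>lborel))"
    proof (intro sum.cong refl)
      fix b :: 'a assume b: "b \<in> Basis"
      have "(\<integral>x. \<psi> x * (\<phi> (x + h n *\<^sub>R b) \<bullet> b) \<partial>lborel) = (\<integral>x. \<psi> (x - h n *\<^sub>R b) * (\<phi> x \<bullet> b) \<partial>lborel)"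
        using integral_translate[of "\<lambda>x. \<psi> (x - h n *\<^sub>R b) * (\<phi> x \<bullet> b)" "h n *\<^sub>R b"] by simp
      then show "(\<integral>x. (\<psi> x * (\<phi> (x + h n *\<^sub>R b) \<bullet> b) - \<psi> x * (\<phi> x \<bullet> b)) / h n \<partial>lborel)
         = (\<integral>x. (\<psi> (x - h n *\<^sub>R b) * (\<phi> x \<bullet> b) - \<psi> x * (\<phi> x \<bullet> b)) / h n \<partial>lborel)"
        using i1[OF b] i2[OF b] i3[OF b] by simp
    qed
    also have "\<dots> = (\<integral>x. ?T n x \<partial>lborel)"
      using i3 i2 by (subst Bochner_Integration.integral_sum[symmetric]) (auto simp: right_diff_distrib mult.commute)
    finally show ?thesis .
  qed
  let ?shell = "cball (0::'a) (R + \<epsilon>) - cball 0 R"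
  \<comment> \<open>The limit of \<open>?T\<close> is minus the gradient of \<open>\<psi>\<close>
    times \<open>\<phi>\<close>; in the shell \<open>\<psi>\<close> has radial slope
    \<open>- 1 / \<epsilon>\<close>. Values on the bounding spheres are immaterial.\<close>
  define D where "D x = (if norm x \<le> R \<or> norm x > R + \<epsilon> then 0 else (sgn x \<bullet> \<phi> x) / \<epsilon>)" for x
  have limT: "(\<lambda>n. \<integral>x. ?T n x \<partial>lborel) \<longlonglongrightarrow> (\<integral>x. D x \<partial>lborel)"
  proof (rule integral_dominated_convergence[where w="\<lambda>x. real DIM('a) / \<epsilon> * indicator (cball (0::'a) S) x"])
    show "D \<in> borel_measurable lborel" unfolding D_def by measurable
    show "?T n \<in> borel_measurable lborel" for n by measurable
    show "integrable lborel (\<lambda>x. real DIM('a) / \<epsilon> * indicator (cball (0::'a) S) x)" by (rule cball)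
    have "AE x in lborel. norm (x::'a) \<noteq> r" for r
    proof (rule AE_I')
      show "sphere (0::'a) r \<in> null_sets lborel"
        using negligible_sphere[of "0::'a" r] by (auto simp: negligible_iff_null_sets null_sets_def)
    qed auto
    then have "AE x in lborel. norm (x::'a) \<noteq> R" "AE x in lborel. norm (x::'a) \<noteq> R + \<epsilon>" by auto
    then show "AE x in lborel. (\<lambda>n. ?T n x) \<longlonglongrightarrow> D x"
    proof eventually_elim
      case (elim x)
      have "(\<psi> has_derivative (\<lambda>v. if norm x < R \<or> norm x > R + \<epsilon> then 0 else - (sgn x \<bullet> v) / \<epsilon>)) (at x)"
      proof -
        consider "norm x < R" | "norm x > R + \<epsilon>" | "R < norm x" "norm x < R + \<epsilon>" using elim by linarith
        then show ?thesis
        proof cases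
          case 1
          have "(\<psi> has_derivative (\<lambda>v. 0)) (at x)"
          proof (rule has_derivative_transform_within_open[OF has_derivative_const[of 1]])
            show "open (ball (0::'a) R)" by simp
          qed (use 1 \<open>\<epsilon> > 0\<close> in \<open>auto simp: \<psi>_def\<close>)
          then show ?thesis using 1 by simp
        next
          case 2
          have "(\<psi> has_derivative (\<lambda>v. 0)) (at x)"
          proof (rule has_derivative_transform_within_open[OF has_derivative_const[of 0]])
            show "open {y :: 'a. R + \<epsilon> < norm y}" by (intro open_Collect_less continuous_intros)
          qed (use 2 \<psi>0 in auto)
          then show ?thesis using 2 by simp
        next
          case 3
          then have "x \<noteq> 0" using \<open>R > 0\<close> by auto
          then have norm_der: "(norm has_derivative (\<lambda>v. v \<bullet> sgn x)) (at x)"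
            using has_derivative_norm[of x] by (simp add: inner_commute)
          have "((\<lambda>y. (R + \<epsilon> - norm y) / \<epsilon>) has_derivative (\<lambda>v. - (sgn x \<bullet> v) / \<epsilon>)) (at x)"
            using \<open>\<epsilon> > 0\<close> norm_der by (auto intro!: derivative_eq_intros simp: inner_commute)
          then have "(\<psi> has_derivative (\<lambda>v. - (sgn x \<bullet> v) / \<epsilon>)) (at x)"
          proof (rule has_derivative_transform_within_open)
            show "open {y :: 'a. R < norm y \<and> norm y < R + \<epsilon>}"
              by (intro open_Collect_conj open_Collect_less continuous_intros)
          qed (use 3 \<open>\<epsilon> > 0\<close> in \<open>auto simp: \<psi>_def\<close>)
          then show ?thesis using 3 by simp
        qed
      qed
      then obtain \<psi>' where \<psi>': "(\<psi> has_derivative \<psi>') (at x)"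
        and eq: "\<psi>' = (\<lambda>v. if norm x < R \<or> norm x > R + \<epsilon> then 0 else - (sgn x \<bullet> v) / \<epsilon>)" by blast
      have "(\<lambda>n. (\<psi> (x - h n *\<^sub>R b) - \<psi> x) / h n) \<longlonglongrightarrow> - \<psi>' b" for b
      proof -
        have lin: "bounded_linear \<psi>'" using \<psi>' by (rule has_derivative_bounded_linear)
        have "((\<lambda>t. \<psi> (x - t *\<^sub>R b)) has_derivative (\<lambda>t. \<psi>' (- (t *\<^sub>R b)))) (at 0)"
          using \<psi>' by (intro has_derivative_compose[of "\<lambda>t. x - t *\<^sub>R b" "\<lambda>t. - (t *\<^sub>R b)" 0 UNIV \<psi>])
            (auto intro!: derivative_eq_intros)
        moreover have "(\<lambda>t. \<psi>' (- (t *\<^sub>R b))) = (*) (- \<psi>' b)"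
          using bounded_linear.linear[OF lin] by (auto simp: linear_neg linear_cmul)
        ultimately have "((\<lambda>t. \<psi> (x - t *\<^sub>R b)) has_real_derivative - \<psi>' b) (at 0)"
          by (simp add: has_field_derivative_def)
        then have "((\<lambda>t. (\<psi> (x - t *\<^sub>R b) - \<psi> x) / t) \<longlongrightarrow> - \<psi>' b) (at 0)"
          by (simp add: has_field_derivative_iff)
        moreover have "filterlim h (at 0) sequentially"
          using h0 h(1) by (intro filterlim_atI) (auto simp: less_imp_neq[THEN not_sym])
        ultimately show ?thesis by (rule filterlim_compose)
      qed
      then have "(\<lambda>n. \<Sum>b\<in>Basis. (\<phi> x \<bullet> b) * ((\<psi> (x - h n *\<^sub>R b) - \<psi> x) / h n)) \<longlonglongrightarrow> (\<Sum>b\<in>Basis. (\<phi> x \<bullet> b) * - \<psi>' b)"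
        by (intro tendsto_sum tendsto_mult_left)
      moreover have "(\<Sum>b\<in>Basis. (\<phi> x \<bullet> b) * - \<psi>' b) = D x"
        unfolding eq D_def using elim
        by (auto simp: euclidean_inner[of "sgn x" "\<phi> x"] sum_divide_distrib mult.commute intro!: sum.cong)
      ultimately show ?case by simp
    qed
    show "AE x in lborel. norm (?T n x) \<le> real DIM('a) / \<epsilon> * indicator (cball (0::'a) S) x" for n
    proof (rule AE_I2)
      fix x
      have "\<bar>(\<phi> x \<bullet> b) * (\<psi> (x - h n *\<^sub>R b) - \<psi> x) / h n\<bar> \<le> 1 / \<epsilon>" if b: "b \<in> Basis" for b
      proof -
        have "\<bar>\<psi> (x - h n *\<^sub>R b) - \<psi> x\<bar> \<le> h n / \<epsilon>" using \<psi>lip[of "x - h n *\<^sub>R b" x] b h(1)[of n] by simp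
        moreover have "\<bar>\<phi> x \<bullet> b\<bar> \<le> 1" using Basis_le_norm[OF b, of "\<phi> x"] \<phi>(2)[of x] by linarith
        ultimately have "\<bar>\<phi> x \<bullet> b\<bar> * \<bar>\<psi> (x - h n *\<^sub>R b) - \<psi> x\<bar> \<le> 1 * (h n / \<epsilon>)" by (intro mult_mono) auto
        then show ?thesis using h(1)[of n] by (simp add: abs_mult abs_divide divide_le_eq)
      qed
      then have "\<bar>?T n x\<bar> \<le> real DIM('a) * (1 / \<epsilon>)"
        using sum_norm_bound[of Basis "\<lambda>b. (\<phi> x \<bullet> b) * (\<psi> (x - h n *\<^sub>R b) - \<psi> x) / h n" "1 / \<epsilon>"] by simp
      then show "norm (?T n x) \<le> real DIM('a) / \<epsilon> * indicator (cball (0::'a) S) x"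
        using z(1)[of x] by (cases "norm x \<le> S") auto
    qed
  qed
  have "(\<integral>x. \<psi> x * divergence \<phi> x \<partial>lborel) = (\<integral>x. D x \<partial>lborel)"
    using limQ limT unfolding parts by (rule LIMSEQ_unique)
  also have "\<dots> \<le> (\<integral>x. (1 / \<epsilon>) * indicator ?shell x \<partial>lborel)"
  proof (rule integral_mono_AE')
    have "emeasure lborel ?shell < \<infinity>"
      using emeasure_bounded_finite[of ?shell] by (simp add: bounded_diff)
    then show "integrable lborel (\<lambda>x. (1 / \<epsilon>) * indicator ?shell x)"
      by (intro integrable_mult_right integrable_real_indicator) auto
    show "AE x in lborel. D x \<le> (1 / \<epsilon>) * indicator ?shell x"
    proof (rule AE_I2)
      fix x
      have "sgn x \<bullet> \<phi> x \<le> norm (sgn x) * norm (\<phi> x)" by (rule norm_cauchy_schwarz)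
      also have "\<dots> \<le> 1 * 1" using \<phi>(2)[of x] by (intro mult_mono) (auto simp: norm_sgn)
      finally show "D x \<le> (1 / \<epsilon>) * indicator ?shell x"
        using \<open>\<epsilon> > 0\<close> by (auto simp: D_def indicator_def divide_right_mono)
    qed
    show "AE x in lborel. 0 \<le> (1 / \<epsilon>) * indicat_real ?shell x" using \<open>\<epsilon> > 0\<close> by simp
  qed
  also have "\<dots> = measure lborel ?shell / \<epsilon>" by simp
  finally show ?thesis .
qed

text \<open>Replacing the indicator by the cutoff costs a multiple of the shell volume, which
  vanishes with the width of the shell. The cutoff integral is at most the shell volume divided by
  the width, which tends to the derivative of the ball volume in the radius. No surface measure
  enters.\<close>

lemma perimeter_cball_le:
  assumes "R > 0"
  shows "perimeter (cball (0::'a::euclidean_space) R) \<le> ennreal (DIM('a) * unit_ball_vol (real DIM('a)) * R ^ (DIM('a) - 1))"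
  unfolding perimeter_def
proof (rule SUP_least, rule ennreal_leI)
  let ?d = "DIM('a)" and ?w = "unit_ball_vol (real DIM('a))"
  fix \<phi> :: "'a \<Rightarrow> 'a" assume "\<phi> \<in> {\<phi>. compactly_supported_C1 \<phi> \<and> (\<forall>x. norm (\<phi> x) \<le> 1)}"
  then have \<phi>: "compactly_supported_C1 \<phi>" "\<And>x. norm (\<phi> x) \<le> 1" by auto
  obtain \<phi>' :: "'a \<Rightarrow> 'a \<Rightarrow>\<^sub>L 'a" and S M where d: "\<And>x. (\<phi> has_derivative blinfun_apply (\<phi>' x)) (at x)"
    and c: "continuous_on UNIV \<phi>'" and M: "M > 0" and b: "\<And>x. norm (\<phi>' x) \<le> M"
    using compactly_supported_C1_bounds[OF \<phi>(1)] by metis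
  have [measurable]: "(\<lambda>x. blinfun_apply (\<phi>' x) b) \<in> borel_measurable borel" for b
    by (intro borel_measurable_continuous_onI continuous_intros c)
  have [measurable]: "divergence \<phi> \<in> borel_measurable borel" unfolding divergence_eq[OF d] by measurable
  have divb: "\<bar>divergence \<phi> x\<bar> \<le> ?d * M" for x
  proof -
    have "\<bar>\<phi>' x i \<bullet> i\<bar> \<le> M" if "i \<in> Basis" for i
      using Basis_le_norm[OF that, of "\<phi>' x i"] norm_blinfun[of "\<phi>' x" i] b[of x] that by simp
    then show ?thesis unfolding divergence_eq[OF d] using sum_norm_bound[of Basis "\<lambda>i. \<phi>' x i \<bullet> i" M] by simp
  qed
  have cball: "integrable lborel (\<lambda>x. K * indicator (cball (0::'a) r) x :: real)" for r K
    using emeasure_lborel_cball_finite[of "0::'a" r] by (intro integrable_mult_right integrable_real_indicator) auto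
  have [measurable]: "cball (0::'a) r \<in> sets borel" for r by simp
  let ?I = "LINT x:cball 0 R|lebesgue. divergence \<phi> x"
  have I: "?I = (\<integral>x. indicator (cball 0 R) x * divergence \<phi> x \<partial>lborel)"
    unfolding set_lebesgue_integral_def by (subst integral_completion) auto
  have main: "?I \<le> (?d * M) * (?w * (R + \<epsilon>) ^ ?d - ?w * R ^ ?d) + (?w * (R + \<epsilon>) ^ ?d - ?w * R ^ ?d) / \<epsilon>" if \<epsilon>: "\<epsilon> > 0" for \<epsilon>
  proof -
    define \<psi> where "\<psi> x = max 0 (min 1 ((R + \<epsilon> - norm x) / \<epsilon>))" for x :: 'a
    let ?shell = "cball (0::'a) (R + \<epsilon>) - cball 0 R"
    have shell: "measure lborel ?shell = ?w * (R + \<epsilon>) ^ ?d - ?w * R ^ ?d"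
      using emeasure_lborel_cball_finite[of "0::'a"] assms \<epsilon>
      by (subst measure_Diff) (auto simp: content_cball less_top)
    have [measurable]: "\<psi> \<in> borel_measurable borel"
      unfolding \<psi>_def using \<open>\<epsilon> > 0\<close> by (intro borel_measurable_continuous_onI continuous_intros) auto
    have \<psi>01: "0 \<le> \<psi> x" "\<psi> x \<le> 1" for x by (auto simp: \<psi>_def)
    have \<psi>0: "\<psi> x = 0" if "norm x > R + \<epsilon>" for x using that \<open>\<epsilon> > 0\<close> by (simp add: \<psi>_def divide_le_0_iff)
    have \<psi>1: "\<psi> x = 1" if "norm x \<le> R" for x using that \<open>\<epsilon> > 0\<close> by (simp add: \<psi>_def)
    have i1: "integrable lborel (\<lambda>x. indicator (cball 0 R) x * divergence \<phi> x)"
      by (rule Bochner_Integration.integrable_bound[OF cball[of "?d * M" R]]) (use divb in \<open>auto simp: indicator_def intro!: AE_I2 intro: order_trans[OF _ abs_ge_self]\<close>)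
    have i2: "integrable lborel (\<lambda>x. \<psi> x * divergence \<phi> x)"
    proof (rule Bochner_Integration.integrable_bound[OF cball[of "?d * M" "R + \<epsilon>"]])
      have "\<bar>\<psi> x * divergence \<phi> x\<bar> \<le> 1 * (?d * M)" for x
        unfolding abs_mult using \<psi>01[of x] divb[of x] by (intro mult_mono) auto
      then show "AE x in lborel. norm (\<psi> x * divergence \<phi> x) \<le> norm (real ?d * M * indicator (cball (0::'a) (R + \<epsilon>)) x)"
        using \<psi>0 M by (intro AE_I2) (auto simp: indicator_def not_le)
    qed measurable
    have "?I - (\<integral>x. \<psi> x * divergence \<phi> x \<partial>lborel) = (\<integral>x. (indicator (cball 0 R) x - \<psi> x) * divergence \<phi> x \<partial>lborel)"
      unfolding I left_diff_distrib using i1 i2 by simp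
    also have "\<dots> \<le> (\<integral>x. (?d * M) * indicator ?shell x \<partial>lborel)"
    proof (rule integral_mono_AE')
      have "emeasure lborel ?shell < \<infinity>"
        using emeasure_bounded_finite[of ?shell] by (simp add: bounded_diff)
      then show "integrable lborel (\<lambda>x. (?d * M) * indicator ?shell x)"
        by (intro integrable_mult_right integrable_real_indicator) auto
      show "AE x in lborel. (indicator (cball 0 R) x - \<psi> x) * divergence \<phi> x \<le> (?d * M) * indicator ?shell x"
      proof (rule AE_I2)
        fix x :: 'a
        consider "norm x \<le> R" | "norm x > R + \<epsilon>" | "R < norm x" "norm x \<le> R + \<epsilon>" by linarith
        then show "(indicator (cball 0 R) x - \<psi> x) * divergence \<phi> x \<le> (?d * M) * indicator ?shell x"
        proof cases
          case 3
          have "- (\<psi> x * divergence \<phi> x) \<le> 1 * (?d * M)"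
            using \<psi>01[of x] divb[of x] mult_mono[of "\<psi> x" 1 "\<bar>divergence \<phi> x\<bar>" "?d * M"] abs_mult[of "\<psi> x" "divergence \<phi> x"] by (simp add: abs_le_iff)
          then show ?thesis using 3 by simp
        qed (use \<psi>0 \<psi>1 \<epsilon> in auto)
      qed
      show "AE x in lborel. 0 \<le> (?d * M) * indicat_real ?shell x" using M by simp
    qed
    also have "\<dots> = ?d * M * measure lborel ?shell" by simp
    finally have "?I \<le> (\<integral>x. \<psi> x * divergence \<phi> x \<partial>lborel) + ?d * M * measure lborel ?shell" by simp
    also have "(\<integral>x. \<psi> x * divergence \<phi> x \<partial>lborel) \<le> measure lborel ?shell / \<epsilon>"
      unfolding \<psi>_def by (rule integral_radial_cutoff_le[OF \<phi> assms \<epsilon>])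
    finally show ?thesis unfolding shell by (simp only: add.commute)
  qed
  show "?I \<le> ?d * ?w * R ^ (?d - 1)"
  proof (rule tendsto_lowerbound)
    have der: "((\<lambda>r. ?w * r ^ ?d) has_real_derivative ?w * (?d * R ^ (?d - 1))) (at R)"
      by (auto intro!: derivative_eq_intros)
    then have 1: "((\<lambda>\<epsilon>. (?w * (R + \<epsilon>) ^ ?d - ?w * R ^ ?d) / \<epsilon>) \<longlongrightarrow> ?w * (?d * R ^ (?d - 1))) (at_right 0)"
      unfolding DERIV_def by (rule tendsto_within_subset) auto
    have 2: "((\<lambda>\<epsilon>. (?d * M) * (?w * (R + \<epsilon>) ^ ?d - ?w * R ^ ?d)) \<longlongrightarrow> (?d * M) * (?w * (R + 0) ^ ?d - ?w * R ^ ?d)) (at_right 0)"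
      by (intro tendsto_intros)
    show "((\<lambda>\<epsilon>. (?d * M) * (?w * (R + \<epsilon>) ^ ?d - ?w * R ^ ?d) + (?w * (R + \<epsilon>) ^ ?d - ?w * R ^ ?d) / \<epsilon>) \<longlongrightarrow> ?d * ?w * R ^ (?d - 1)) (at_right 0)"
      using tendsto_add[OF 2 1] by (simp add: mult_ac)
    show "\<forall>\<^sub>F \<epsilon> in at_right 0. ?I \<le> (?d * M) * (?w * (R + \<epsilon>) ^ ?d - ?w * R ^ ?d) + (?w * (R + \<epsilon>) ^ ?d - ?w * R ^ ?d) / \<epsilon>"
      using main by (intro eventually_at_rightI[of 0 1]) auto
  qed simp
qed

section \<open>Geometry of the ball condition\<close>

text \<open>The equality case of the triangle inequality for vectors of equal length, by the
  parallelogram law. It forces the centres of the two tangent balls at a boundary point to be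
  antipodal.\<close>

lemma norm_add_maximal_eq:
  fixes a b :: "'a::real_inner"
  assumes "norm a = norm b" "norm (a + b) \<ge> 2 * norm b"
  shows "a = b"
proof -
  have "(norm (a + b))\<^sup>2 + (norm (a - b))\<^sup>2 = 2 * (norm a)\<^sup>2 + 2 * (norm b)\<^sup>2"
    unfolding power2_norm_eq_inner by (simp add: inner_add_left inner_add_right inner_diff_left inner_diff_right inner_commute)
  moreover have "(2 * norm b)\<^sup>2 \<le> (norm (a + b))\<^sup>2" using assms(2) by (intro power_mono) auto
  moreover have "2 * (norm a)\<^sup>2 + 2 * (norm b)\<^sup>2 = (2 * norm b)\<^sup>2" by (simp add: assms(1) power_mult_distrib)
  ultimately have "(norm (a - b))\<^sup>2 \<le> 0" by linarith
  then show ?thesis by simp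
qed

lemma dist_ge_if_disjoint_balls:
  fixes x y :: "'a::euclidean_space"
  assumes "ball x r \<subseteq> E" "ball y s \<subseteq> - E" "r > 0" "s > 0"
  shows "r + s \<le> dist x y"
proof (rule ccontr)
  assume "\<not> ?thesis"
  then have less: "dist x y < r + s" by simp
  \<comment> \<open>The point dividing the segment from \<open>x\<close> to \<open>y\<close> in the
    ratio of the radii would lie in both balls.\<close>
  define t where "t = r / (r + s)"
  have t: "0 < t" "t < 1" using assms by (auto simp: t_def)
  let ?z = "x + t *\<^sub>R (y - x)"
  have "dist x ?z = t * dist x y" using t by (simp add: dist_norm norm_minus_commute)
  also have "\<dots> < t * (r + s)" using less t by simp
  also have "\<dots> = r" using assms by (simp add: t_def)
  finally have 1: "?z \<in> ball x r" by simp
  have "y - ?z = (1 - t) *\<^sub>R (y - x)" by (simp add: algebra_simps)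
  then have "dist y ?z = (1 - t) * dist x y" using t by (simp add: dist_norm norm_minus_commute)
  also have "\<dots> < (1 - t) * (r + s)" using less t by simp
  also have "\<dots> = s" using assms by (simp add: t_def field_simps)
  finally have 2: "?z \<in> ball y s" by simp
  show False using subsetD[OF assms(1) 1] subsetD[OF assms(2) 2] by simp
qed

locale ball_domain =
  fixes E :: "'a::euclidean_space set" and \<delta> :: real
  assumes \<delta>: "\<delta> > 0" and closed: "closed E" and ball: "ball_condition \<delta> E"
begin

text \<open>The centres of the inner and the outer ball have distance \<delta> from \<open>x\<close>
  and, the balls being disjoint, at least \<open>\<delta> + \<delta>\<close> from each other. So
  they are antipodal about \<open>x\<close> and define one common direction.\<close>

lemma normal_exists:
  assumes "x \<in> frontier E"
  shows "\<exists>n. norm n = 1 \<and> ball (x - \<delta> *\<^sub>R n) \<delta> \<subseteq> E \<and> ball (x + \<delta> *\<^sub>R n) \<delta> \<subseteq> - E"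
proof -
  obtain y z where y: "ball y \<delta> \<subseteq> E" "norm (x - y) = \<delta>" and z: "ball z \<delta> \<subseteq> - E" "norm (x - z) = \<delta>"
    by (rule exE[OF conjunct1[OF bspec[OF ball[unfolded ball_condition_def] assms]]],
        rule exE[OF conjunct2[OF bspec[OF ball[unfolded ball_condition_def] assms]]])
      (rule that; erule conjunct1 conjunct2)
  have yz: "\<delta> + \<delta> \<le> dist y z" by (rule dist_ge_if_disjoint_balls[OF y(1) z(1) \<delta> \<delta>])
  have s: "(z - x) + (x - y) = z - y" by simp
  have "z - x = x - y"
  proof (rule norm_add_maximal_eq)
    show "norm (z - x) = norm (x - y)" using y(2) z(2) by (simp only: norm_minus_commute)
    show "2 * norm (x - y) \<le> norm ((z - x) + (x - y))"
      unfolding s y(2) using yz by (simp only: dist_norm norm_minus_commute mult_2)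
  qed
  then have eq: "x - (z - x) = y" by simp
  show ?thesis
  proof (intro exI[of _ "(1 / \<delta>) *\<^sub>R (z - x)"] conjI)
    show "norm ((1 / \<delta>) *\<^sub>R (z - x)) = 1" using z(2) \<delta> by (simp add: norm_minus_commute)
    have "x - \<delta> *\<^sub>R ((1 / \<delta>) *\<^sub>R (z - x)) = y" "x + \<delta> *\<^sub>R ((1 / \<delta>) *\<^sub>R (z - x)) = z"
      using \<delta> eq by simp_all
    then show "ball (x - \<delta> *\<^sub>R ((1 / \<delta>) *\<^sub>R (z - x))) \<delta> \<subseteq> E" "ball (x + \<delta> *\<^sub>R ((1 / \<delta>) *\<^sub>R (z - x))) \<delta> \<subseteq> - E"
      using y(1) z(1) by (simp_all only:)
  qed
qed

definition \<nu> :: "'a \<Rightarrow> 'a" where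
  "\<nu> x = (SOME n. norm n = 1 \<and> ball (x - \<delta> *\<^sub>R n) \<delta> \<subseteq> E \<and> ball (x + \<delta> *\<^sub>R n) \<delta> \<subseteq> - E)"

lemma normal:
  assumes "x \<in> frontier E"
  shows "norm (\<nu> x) = 1" "ball (x - \<delta> *\<^sub>R \<nu> x) \<delta> \<subseteq> E" "ball (x + \<delta> *\<^sub>R \<nu> x) \<delta> \<subseteq> - E"
  using someI_ex[OF normal_exists[OF assms]] unfolding \<nu>_def by auto

text \<open>The inner ball at \<open>x\<close> is disjoint from the outer ball at \<open>y\<close>,
  and conversely. This bounds \<open>?a - \<delta> *\<^sub>R ?s\<close> and
  \<open>?a + \<delta> *\<^sub>R ?s\<close> from below by \<open>\<delta> + \<delta>\<close>, and
  the parallelogram law combines the two bounds.\<close>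

lemma normal_lipschitz:
  assumes x: "x \<in> frontier E" and y: "y \<in> frontier E"
  shows "norm (\<nu> x - \<nu> y) \<le> norm (x - y) / \<delta>"
proof -
  let ?a = "x - y" and ?s = "\<nu> x + \<nu> y"
  have sq: "4 * \<delta>\<^sup>2 \<le> (norm v)\<^sup>2" if "\<delta> + \<delta> \<le> norm v" for v :: 'a
    using power_mono[OF that, of 2] \<delta> by (simp add: power2_eq_square algebra_simps)
  have "\<delta> + \<delta> \<le> dist (x - \<delta> *\<^sub>R \<nu> x) (y + \<delta> *\<^sub>R \<nu> y)"
    by (rule dist_ge_if_disjoint_balls[OF normal(2)[OF x] normal(3)[OF y] \<delta> \<delta>])
  also have "\<dots> = norm (?a - \<delta> *\<^sub>R ?s)" by (simp add: dist_norm algebra_simps)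
  finally have 1: "4 * \<delta>\<^sup>2 \<le> (norm (?a - \<delta> *\<^sub>R ?s))\<^sup>2" by (rule sq)
  have "\<delta> + \<delta> \<le> dist (y - \<delta> *\<^sub>R \<nu> y) (x + \<delta> *\<^sub>R \<nu> x)"
    by (rule dist_ge_if_disjoint_balls[OF normal(2)[OF y] normal(3)[OF x] \<delta> \<delta>])
  also have "\<dots> = norm (- (?a + \<delta> *\<^sub>R ?s))" unfolding dist_norm by (rule arg_cong[where f=norm]) (simp add: algebra_simps)
  also have "\<dots> = norm (?a + \<delta> *\<^sub>R ?s)" by (rule norm_minus_cancel)
  finally have 2: "4 * \<delta>\<^sup>2 \<le> (norm (?a + \<delta> *\<^sub>R ?s))\<^sup>2" by (rule sq)
  have "(norm (?a - \<delta> *\<^sub>R ?s))\<^sup>2 + (norm (?a + \<delta> *\<^sub>R ?s))\<^sup>2 = 2 * (norm ?a)\<^sup>2 + 2 * \<delta>\<^sup>2 * (norm ?s)\<^sup>2"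
    unfolding power2_norm_eq_inner
    by (simp add: inner_add_left inner_add_right inner_diff_left inner_diff_right inner_commute power2_eq_square algebra_simps)
  moreover have "(norm ?s)\<^sup>2 = 4 - (norm (\<nu> x - \<nu> y))\<^sup>2"
    using normal(1)[OF x] normal(1)[OF y] unfolding norm_eq_1 power2_norm_eq_inner
    by (simp add: inner_add_left inner_add_right inner_diff_left inner_diff_right inner_commute)
  ultimately have "\<delta>\<^sup>2 * (norm (\<nu> x - \<nu> y))\<^sup>2 \<le> (norm ?a)\<^sup>2"
    using 1 2 by (simp add: algebra_simps)
  then have "(\<delta> * norm (\<nu> x - \<nu> y))\<^sup>2 \<le> (norm ?a)\<^sup>2" by (simp add: power_mult_distrib)
  then have "\<delta> * norm (\<nu> x - \<nu> y) \<le> norm ?a" by (rule power2_le_imp_le) simp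
  then show ?thesis using \<delta> by (simp add: field_simps)
qed

lemma ball_disjoint_frontier: "ball y r \<subseteq> E \<Longrightarrow> ball y r \<inter> frontier E = {}"
proof (rule equals0I)
  fix w assume "ball y r \<subseteq> E" and w: "w \<in> ball y r \<inter> frontier E"
  then have "ball y r \<subseteq> interior E" by (intro interior_maximal open_ball)
  then have "w \<in> interior E" using w by (simp only: Int_iff subsetD)
  then show False using w by (simp add: frontier_def)
qed

text \<open>The ball about \<open>x\<close> and the tangent ball at \<open>p\<close> on the other
  side are disjoint, so their centres are at least \<open>r + \<delta>\<close> apart. The path
  through \<open>p\<close> has exactly this length; equality in the triangle inequality makes the
  three points collinear. The radius \<open>r\<close> may exceed \<delta>.\<close>

lemma nearest_point_normal:
  assumes p: "p \<in> frontier E" and r: "norm (x - p) = r" and "r > 0"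
  shows "ball x r \<subseteq> E \<Longrightarrow> x = p - r *\<^sub>R \<nu> p" "ball x r \<subseteq> - E \<Longrightarrow> x = p + r *\<^sub>R \<nu> p"
proof -
  note n = normal[OF p]
  have eq: "a = r *\<^sub>R b" if a: "norm a = r" and b: "norm b = 1" and "r + \<delta> \<le> norm (a + \<delta> *\<^sub>R b)" for a b :: 'a
  proof -
    have "norm (a + \<delta> *\<^sub>R b) = norm a + norm (\<delta> *\<^sub>R b)"
      using norm_triangle_ineq[of a "\<delta> *\<^sub>R b"] that \<delta> by simp
    then have "norm a *\<^sub>R (\<delta> *\<^sub>R b) = norm (\<delta> *\<^sub>R b) *\<^sub>R a" by (simp only: norm_triangle_eq)
    then have "\<delta> *\<^sub>R (r *\<^sub>R b) = \<delta> *\<^sub>R a" using a b \<delta> by (simp add: mult.commute)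
    then have "r *\<^sub>R b = a" using \<delta> by (metis scaleR_cancel_left less_irrefl)
    then show ?thesis ..
  qed
  show "x = p - r *\<^sub>R \<nu> p" if "ball x r \<subseteq> E"
  proof -
    have "r + \<delta> \<le> dist x (p + \<delta> *\<^sub>R \<nu> p)" by (rule dist_ge_if_disjoint_balls[OF that n(3) \<open>r > 0\<close> \<delta>])
    also have "\<dots> = norm ((p - x) + \<delta> *\<^sub>R \<nu> p)" by (simp add: dist_norm norm_minus_commute algebra_simps)
    finally have "p - x = r *\<^sub>R \<nu> p" using r n(1) by (intro eq) (auto simp: norm_minus_commute)
    then show ?thesis by (simp add: algebra_simps)
  qed
  show "x = p + r *\<^sub>R \<nu> p" if "ball x r \<subseteq> - E"
  proof -
    have "\<delta> + r \<le> dist (p - \<delta> *\<^sub>R \<nu> p) x" by (rule dist_ge_if_disjoint_balls[OF n(2) that \<delta> \<open>r > 0\<close>])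
    also have "\<dots> = norm ((x - p) + \<delta> *\<^sub>R \<nu> p)" by (simp add: dist_norm norm_minus_commute algebra_simps)
    finally have "x - p = r *\<^sub>R \<nu> p" using r n(1) by (intro eq) auto
    then show ?thesis by (simp add: algebra_simps)
  qed
qed

text \<open>Near \<open>p\<close> the frontier meets each ray from the centre \<open>a\<close> of
  the inner ball at most once: going back from a frontier point towards \<open>a\<close>, while
  staying near \<open>p\<close>, one is inside the inner tangent ball at that point. Sets with this
  property are null.\<close>

lemma negligible_frontier: "negligible (frontier E)"
proof (subst locally_negligible_alt, rule ballI)
  fix p assume p: "p \<in> frontier E"
  \<comment> \<open>Within this distance of \<open>p\<close> the normal turns by at most 1/4, hence
    the inner product of the two normals is at least 31/32. Subtracting \<kappa> leaves 23/32 of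
    \<delta> in the normal component of \<open>u\<close>, and the final comparison is 5/8 <
    23/16.\<close>
  define \<kappa> where "\<kappa> = \<delta> / 4"
  have \<kappa>: "\<kappa> > 0" using \<delta> by (simp add: \<kappa>_def)
  define a where "a = p - \<delta> *\<^sub>R \<nu> p"
  have "negligible (frontier E \<inter> cball p \<kappa>)"
  proof (rule starlike_negligible_strong[where a=a])
    show "closed (frontier E \<inter> cball p \<kappa>)" by (intro closed_Int frontier_closed closed_cball)
    fix c :: real and u :: 'a assume c: "0 \<le> c" "c < 1" and u: "a + u \<in> frontier E \<inter> cball p \<kappa>"
    show "a + c *\<^sub>R u \<notin> frontier E \<inter> cball p \<kappa>"
    proof
      assume u': "a + c *\<^sub>R u \<in> frontier E \<inter> cball p \<kappa>"
      let ?x = "a + u"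
      have x: "?x \<in> frontier E" "norm (?x - p) \<le> \<kappa>" using u by (auto simp: dist_norm norm_minus_commute)
      note nx = normal[OF x(1)] and np = normal[OF p]
      have udef: "u = (?x - p) + \<delta> *\<^sub>R \<nu> p" by (simp add: a_def algebra_simps)
      have nu: "norm u \<le> \<kappa> + \<delta>"
      proof -
        have "norm u \<le> norm (?x - p) + norm (\<delta> *\<^sub>R \<nu> p)" by (subst udef, rule norm_triangle_ineq)
        then show ?thesis using x np \<delta> by simp
      qed
      have "norm ((1 - c) *\<^sub>R u) = dist ?x (a + c *\<^sub>R u)" by (simp add: dist_norm algebra_simps)
      also have "\<dots> \<le> dist ?x p + dist p (a + c *\<^sub>R u)" by (rule dist_triangle)
      also have "\<dots> \<le> 2 * \<kappa>" using u u' by (simp add: dist_commute)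
      finally have cu: "(1 - c) * norm u \<le> 2 * \<kappa>" using c by simp
      have "norm (\<nu> p - \<nu> ?x) \<le> norm (p - ?x) / \<delta>" by (rule normal_lipschitz[OF p x(1)])
      also have "\<dots> \<le> 1 / 4" using x(2) \<delta> by (simp add: \<kappa>_def norm_minus_commute field_simps)
      finally have "(norm (\<nu> p - \<nu> ?x))\<^sup>2 \<le> (1 / 4)\<^sup>2" by (intro power_mono) auto
      moreover have "(norm (\<nu> p - \<nu> ?x))\<^sup>2 = 2 - 2 * (\<nu> p \<bullet> \<nu> ?x)"
        using nx(1) np(1) unfolding norm_eq_1 power2_norm_eq_inner
        by (simp add: inner_diff_left inner_diff_right inner_commute)
      ultimately have in1: "\<nu> p \<bullet> \<nu> ?x \<ge> 31 / 32" by (simp add: power2_eq_square)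
      have in2: "(?x - p) \<bullet> \<nu> ?x \<ge> - \<kappa>"
        using Cauchy_Schwarz_ineq2[of "?x - p" "\<nu> ?x"] x(2) nx(1) by (simp add: abs_le_iff)
      have "u \<bullet> \<nu> ?x = (?x - p) \<bullet> \<nu> ?x + \<delta> * (\<nu> p \<bullet> \<nu> ?x)"
        by (subst udef) (simp only: inner_add_left inner_scaleR_left)
      also have "\<dots> \<ge> - \<kappa> + \<delta> * (31 / 32)" using in1 in2 \<delta> by (intro add_mono mult_left_mono) auto
      finally have in3: "u \<bullet> \<nu> ?x \<ge> \<delta> * (23 / 32)" by (simp add: \<kappa>_def)
      have "(1 - c) * norm u * norm u \<le> 2 * \<kappa> * (\<kappa> + \<delta>)"
        using mult_mono[OF cu nu] \<kappa> by simp
      also have "\<dots> = \<delta>\<^sup>2 * (5 / 8)" by (simp add: \<kappa>_def power2_eq_square)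
      also have "\<dots> < 2 * \<delta> * (\<delta> * (23 / 32))" using \<delta> by (simp add: power2_eq_square)
      also have "\<dots> \<le> 2 * \<delta> * (u \<bullet> \<nu> ?x)" using in3 \<delta> by (intro mult_left_mono) auto
      finally have less: "(1 - c) * ((1 - c) * norm u * norm u) < (1 - c) * (2 * \<delta> * (u \<bullet> \<nu> ?x))"
        using c by simp
      \<comment> \<open>As the point is \<open>?x\<close> minus \<open>1 - c\<close> times
        \<open>u\<close>, it lies in the inner ball at \<open>?x\<close> exactly if \<open>(1 - c) *
        norm u * norm u < 2 * \<delta> * (u \<bullet> \<nu> ?x)\<close>.\<close>
      have "(norm (a + c *\<^sub>R u - (?x - \<delta> *\<^sub>R \<nu> ?x)))\<^sup>2 = (norm (\<delta> *\<^sub>R \<nu> ?x - (1 - c) *\<^sub>R u))\<^sup>2"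
        by (simp add: algebra_simps)
      also have "\<dots> = \<delta>\<^sup>2 * (\<nu> ?x \<bullet> \<nu> ?x) - 2 * ((1 - c) * (\<delta> * (u \<bullet> \<nu> ?x))) + (1 - c)\<^sup>2 * (u \<bullet> u)"
        unfolding power2_norm_eq_inner inner_diff_left inner_diff_right inner_scaleR_left inner_scaleR_right
        by (simp add: inner_commute power2_eq_square algebra_simps)
      also have "\<nu> ?x \<bullet> \<nu> ?x = 1" using nx(1) by (simp only: norm_eq_1)
      also have "u \<bullet> u = norm u * norm u" by (simp add: dot_square_norm power2_eq_square)
      finally have "(norm (a + c *\<^sub>R u - (?x - \<delta> *\<^sub>R \<nu> ?x)))\<^sup>2 < \<delta>\<^sup>2"
        using less by (simp add: power2_eq_square mult.assoc)
      then have "norm (a + c *\<^sub>R u - (?x - \<delta> *\<^sub>R \<nu> ?x)) < \<delta>" using \<delta> by (simp add: power2_less_imp_less)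
      then have "a + c *\<^sub>R u \<in> ball (?x - \<delta> *\<^sub>R \<nu> ?x) \<delta>" by (simp only: mem_ball dist_norm norm_minus_commute)
      then have "a + c *\<^sub>R u \<in> ball (?x - \<delta> *\<^sub>R \<nu> ?x) \<delta> \<inter> frontier E" using u' by simp
      then show False using ball_disjoint_frontier[OF nx(2)] by simp
    qed
  qed
  then have "negligible (frontier E \<inter> ball p \<kappa>)" by (rule negligible_subset) auto
  moreover have "openin (top_of_set (frontier E)) (frontier E \<inter> ball p \<kappa>)" by (intro openin_open_Int open_ball)
  ultimately show "\<exists>U. openin (top_of_set (frontier E)) U \<and> p \<in> U \<and> negligible U"
    using p \<kappa> by (intro exI[of _ "frontier E \<inter> ball p \<kappa>"]) auto
qed

lemma ball_near_point:
  assumes "x \<in> E"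
  shows "\<exists>y. ball y \<delta> \<subseteq> E \<and> dist x y \<le> 2 * \<delta>"
proof (cases "ball x \<delta> \<subseteq> E")
  case False
  have "x \<in> ball x \<delta> \<inter> E" using assms \<delta> by simp
  then have "ball x \<delta> \<inter> E \<noteq> {}" by (metis empty_iff)
  moreover have "ball x \<delta> - E \<noteq> {}" using False by simp
  ultimately have "ball x \<delta> \<inter> frontier E \<noteq> {}" by (rule connected_Int_frontier[OF connected_ball])
  then obtain p where p: "p \<in> frontier E" "dist x p < \<delta>" by auto
  have "dist p (p - \<delta> *\<^sub>R \<nu> p) = \<delta>" using normal(1)[OF p(1)] \<delta> by (simp add: dist_norm)
  then show ?thesis
    using normal(2)[OF p(1)] p(2) dist_triangle[of x "p - \<delta> *\<^sub>R \<nu> p" p]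
    by (intro exI[of _ "p - \<delta> *\<^sub>R \<nu> p"]) auto
qed (use \<delta> in \<open>auto intro: exI[of _ x]\<close>)

text \<open>Each point has a \<delta>-ball of \<open>E\<close> whose centre is at most
  \<open>2 * \<delta>\<close> away. Separation \<open>6 * \<delta>\<close> therefore keeps the
  centres \<open>2 * \<delta>\<close> apart and the balls disjoint.\<close>

lemma card_separated_le:
  assumes X: "finite X" "X \<subseteq> E" "\<And>x y. x \<in> X \<Longrightarrow> y \<in> X \<Longrightarrow> x \<noteq> y \<Longrightarrow> dist x y \<ge> 6 * \<delta>"
    and E: "E \<in> lmeasurable"
  shows "card X * (unit_ball_vol (real DIM('a)) * \<delta> ^ DIM('a)) \<le> measure lebesgue E"
proof -
  obtain c where c: "\<And>x. x \<in> X \<Longrightarrow> ball (c x) \<delta> \<subseteq> E \<and> dist x (c x) \<le> 2 * \<delta>"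
    using ball_near_point X(2) by (metis subsetD)
  have disj: "ball (c x) \<delta> \<inter> ball (c y) \<delta> = {}" if "x \<in> X" "y \<in> X" "x \<noteq> y" for x y
  proof -
    have "dist x y \<le> dist x (c x) + dist (c x) (c y) + dist y (c y)"
      using dist_triangle[of x y "c x"] dist_triangle[of "c x" y "c y"] by (simp add: dist_commute)
    then have "dist (c x) (c y) \<ge> 2 * \<delta>" using X(3)[OF that] c[OF that(1)] c[OF that(2)] by simp
    then show ?thesis by (intro disjoint_ballI) simp
  qed
  have "measure lebesgue (\<Union>x\<in>X. ball (c x) \<delta>) = (\<Sum>x\<in>X. measure lebesgue (ball (c x) \<delta>))"
  proof (rule measure_finite_Union)
    show "emeasure lebesgue (ball (c x) \<delta>) \<noteq> \<infinity>" for x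
      using emeasure_lborel_ball_finite[of "c x" \<delta>] by simp
  qed (use X(1) disj in \<open>auto simp: disjoint_family_on_def\<close>)
  also have "\<dots> = (\<Sum>x\<in>X. unit_ball_vol (real DIM('a)) * \<delta> ^ DIM('a))"
    using \<delta> by (intro sum.cong refl) (simp add: content_ball)
  also have "\<dots> = card X * (unit_ball_vol (real DIM('a)) * \<delta> ^ DIM('a))" by simp
  finally have "card X * (unit_ball_vol (real DIM('a)) * \<delta> ^ DIM('a)) = measure lebesgue (\<Union>x\<in>X. ball (c x) \<delta>)" ..
  also have "\<dots> \<le> measure lebesgue E"
    using c E X(1) by (intro measure_mono_fmeasurable) auto
  finally show ?thesis .
qed

text \<open>In an unbounded set a further point at distance \<open>6 * \<delta>\<close> from any
  finite selection can always be found, which contradicts the counting bound for finite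
  measure.\<close>

lemma bounded:
  assumes E: "E \<in> lmeasurable"
  shows "bounded E"
proof (rule ccontr)
  assume nb: "\<not> bounded E"
  have ex: "\<exists>X. finite X \<and> card X = n \<and> X \<subseteq> E \<and> (\<forall>x\<in>X. \<forall>y\<in>X. x \<noteq> y \<longrightarrow> dist x y \<ge> 6 * \<delta>)" for n
  proof (induction n)
    case (Suc n)
    then obtain X where X: "finite X" "card X = n" "X \<subseteq> E" "\<And>x y. x \<in> X \<Longrightarrow> y \<in> X \<Longrightarrow> x \<noteq> y \<Longrightarrow> dist x y \<ge> 6 * \<delta>" by blast
    obtain K where K: "\<And>x. x \<in> X \<Longrightarrow> norm x \<le> K" using finite_imp_bounded[OF X(1)] unfolding bounded_iff by blast
    have "\<not> (\<forall>x\<in>E. norm x \<le> \<bar>K\<bar> + 6 * \<delta>)" using nb unfolding bounded_iff by (rule contrapos_nn) (rule exI)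
    then obtain e where e: "e \<in> E" "norm e > \<bar>K\<bar> + 6 * \<delta>" by (auto simp: not_le)
    have far: "dist e x \<ge> 6 * \<delta>" if "x \<in> X" for x
      using K[OF that] e(2) norm_triangle_ineq2[of e x] by (simp add: dist_norm)
    then have "e \<notin> X" using \<delta> by force
    then show ?case
      using X e far by (intro exI[of _ "insert e X"]) (auto simp: dist_commute)
  qed (intro exI[of _ "{}"], simp)
  obtain n :: nat where n: "measure lebesgue E < n * (unit_ball_vol (real DIM('a)) * \<delta> ^ DIM('a))"
  proof -
    have "0 < unit_ball_vol (real DIM('a)) * \<delta> ^ DIM('a)" using \<delta> by simp
    from spec[OF reals_Archimedean3[OF this], of "measure lebesgue E"] show thesis by (rule exE) (rule that)
  qed
  obtain X where X: "finite X \<and> card X = n \<and> X \<subseteq> E \<and> (\<forall>x\<in>X. \<forall>y\<in>X. x \<noteq> y \<longrightarrow> dist x y \<ge> 6 * \<delta>)"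
    using ex[of n] by (rule exE)
  then have X: "finite X" "card X = n" "X \<subseteq> E" "\<And>x y. x \<in> X \<Longrightarrow> y \<in> X \<Longrightarrow> x \<noteq> y \<Longrightarrow> dist x y \<ge> 6 * \<delta>" by simp_all
  show False using card_separated_le[OF X(1,3,4) E] X(2) n by simp
qed

text \<open>On a connected set the distance from \<open>a\<close> takes every value up to
  \<open>dist a b\<close>. If that were \<open>6 * \<delta> * n\<close>, points at the distances
  \<open>6 * \<delta> * k\<close> for \<open>k < n\<close> would violate the counting bound.\<close>

lemma connected_dist_less:
  fixes n :: nat
  assumes E: "E \<in> lmeasurable" "connected E" and a: "a \<in> E" and b: "b \<in> E"
    and n: "measure lebesgue E < n * (unit_ball_vol (real DIM('a)) * \<delta> ^ DIM('a))"
  shows "dist a b < 6 * \<delta> * n"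
proof (rule ccontr)
  assume far: "\<not> ?thesis"
  have "connected (dist a ` E)" using E(2) by (intro connected_continuous_image continuous_intros)
  then have iv: "{0..dist a b} \<subseteq> dist a ` E"
    using a b by (intro connected_contains_Icc) (auto intro: image_eqI[of _ _ a])
  have "\<exists>x\<in>E. dist a x = 6 * \<delta> * k" if "k < n" for k :: nat
  proof -
    have "6 * \<delta> * k \<le> 6 * \<delta> * n" using that \<delta> by simp
    then have "6 * \<delta> * k \<le> dist a b" using far by linarith
    then have "6 * \<delta> * k \<in> {0..dist a b}" using \<delta> by simp
    then have "6 * \<delta> * k \<in> dist a ` E" by (rule subsetD[OF iv])
    then obtain x where "6 * \<delta> * k = dist a x" "x \<in> E" by (rule imageE)
    then show ?thesis by (intro bexI[of _ x]) simp_all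
  qed
  then obtain f where f: "\<And>k. k < n \<Longrightarrow> f k \<in> E \<and> dist a (f k) = 6 * \<delta> * k" by metis
  have sep: "dist (f k) (f l) \<ge> 6 * \<delta>" if "k < n" "l < n" "k \<noteq> l" for k l
  proof -
    have "\<bar>real k - real l\<bar> \<ge> 1" using that(3) by (cases "k < l") auto
    then have "6 * \<delta> \<le> 6 * \<delta> * \<bar>real k - real l\<bar>" using \<delta> by simp
    also have "\<dots> = \<bar>dist a (f k) - dist a (f l)\<bar>" using f that \<delta> by (simp add: abs_mult flip: right_diff_distrib)
    also have "\<dots> \<le> dist (f k) (f l)" by (metis abs_dist_diff_le dist_commute)
    finally show ?thesis .
  qed
  have inj: "inj_on f {..<n}"
  proof (rule inj_onI)
    fix k l assume "k \<in> {..<n}" "l \<in> {..<n}" "f k = f l"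
    then show "k = l" using sep[of k l] \<delta> by force
  qed
  have "card (f ` {..<n}) * (unit_ball_vol (real DIM('a)) * \<delta> ^ DIM('a)) \<le> measure lebesgue E"
  proof (rule card_separated_le[OF _ _ _ E(1)])
    show "dist x y \<ge> 6 * \<delta>" if "x \<in> f ` {..<n}" "y \<in> f ` {..<n}" "x \<noteq> y" for x y
      using that sep by fastforce
  qed (use f in auto)
  then show False using n by (simp add: card_image[OF inj])
qed

text \<open>A bounded nonempty piece has a frontier point \<open>p\<close>. The closed inner ball at
  \<open>p\<close> is connected, lies in the closed set \<open>E\<close> and contains
  \<open>p\<close>, so it cannot leave \<open>A\<close>.\<close>

lemma clopen_piece:
  assumes AB: "E = A \<union> B" "closed A" "closed B" "A \<inter> B = {}" and A: "A \<noteq> {}" "bounded A"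
  shows "frontier A \<subseteq> frontier E" "\<exists>y. ball y \<delta> \<subseteq> A"
proof -
  show fr: "frontier A \<subseteq> frontier E"
  proof
    fix p assume p: "p \<in> frontier A"
    then have "p \<in> A" by (rule subsetD[OF frontier_subset_closed[OF AB(2)]])
    have "p \<notin> interior E"
    proof
      assume "p \<in> interior E"
      moreover have "p \<notin> B" using \<open>p \<in> A\<close> AB(4) by (meson disjoint_iff)
      ultimately have pB: "p \<in> interior E \<inter> - B" by simp
      have 1: "open (interior E \<inter> - B)" by (rule open_Int[OF open_interior open_Compl[OF AB(3)]])
      have 2: "interior E \<inter> - B \<subseteq> A"
      proof
        fix w assume w: "w \<in> interior E \<inter> - B"
        then have "w \<in> E" by (simp only: Int_iff subsetD[OF interior_subset])
        then show "w \<in> A" using w AB(1) by simp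
      qed
      have "p \<in> interior A" by (rule subsetD[OF interior_maximal[OF 2 1] pB])
      then show False using p by (simp add: frontier_def)
    qed
    moreover have "p \<in> closure E" using \<open>p \<in> A\<close> AB(1) by (intro subsetD[OF closure_subset]) simp
    ultimately show "p \<in> frontier E" by (simp add: frontier_def)
  qed
  have "frontier A \<noteq> {}" using A frontier_not_empty not_bounded_UNIV by metis
  then obtain p where pA: "p \<in> frontier A" by blast
  have p: "p \<in> frontier E" "p \<in> A" using subsetD[OF fr pA] subsetD[OF frontier_subset_closed[OF AB(2)] pA] .
  let ?y = "p - \<delta> *\<^sub>R \<nu> p"
  have "closure (ball ?y \<delta>) \<subseteq> E" using normal(2)[OF p(1)] closed by (rule closure_minimal)
  then have sub: "cball ?y \<delta> \<subseteq> A \<union> B" using \<delta> AB(1) by (simp add: closure_ball)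
  have "p \<in> cball ?y \<delta>" using normal(1)[OF p(1)] \<delta> by (simp add: dist_norm)
  then have "A \<inter> cball ?y \<delta> \<noteq> {}" using p(2) by (meson disjoint_iff)
  moreover have "A \<inter> B \<inter> cball ?y \<delta> = {}" using AB(4) by simp
  ultimately have "B \<inter> cball ?y \<delta> = {}"
    using connected_closedD[OF connected_cball _ sub AB(2,3)] by simp
  have "cball ?y \<delta> \<subseteq> A"
  proof
    fix w assume w: "w \<in> cball ?y \<delta>"
    then have "w \<in> A \<union> B" by (rule subsetD[OF sub])
    moreover have "w \<notin> B" using w \<open>B \<inter> cball ?y \<delta> = {}\<close> by (meson disjoint_iff)
    ultimately show "w \<in> A" by simp
  qed
  then show "\<exists>y. ball y \<delta> \<subseteq> A" by (intro exI[of _ ?y]) (rule order_trans[OF ball_subset_cball])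
qed

end

section \<open>The isoperimetric gap of disconnected sets\<close>

lemma inner_parallel_set:
  fixes A :: "'a::euclidean_space set"
  assumes A: "closed A" "bounded A" "negligible (frontier A)" and c: "c < measure lebesgue A"
  shows "\<exists>\<eta>\<^sub>0>0. \<forall>\<eta>. 0 < \<eta> \<and> \<eta> \<le> \<eta>\<^sub>0 \<longrightarrow> (\<exists>C. C \<in> lmeasurable \<and> (\<forall>x\<in>C. ball x \<eta> \<subseteq> A) \<and> c < measure lebesgue C)"
proof -
  have ne: "- A \<noteq> {}" using A(2) not_bounded_UNIV by (metis Compl_UNIV_eq double_complement)
  have lA: "A \<in> lmeasurable" using A by (intro lmeasurable_compact) (simp add: compact_eq_bounded_closed)
  define C where "C n = {x. inverse (real (Suc n)) < infdist x (- A)}" for n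
  have opn: "open (C n)" for n
    unfolding C_def by (intro open_Collect_less continuous_intros)
  have subA: "C n \<subseteq> A" for n
  proof
    fix x assume x: "x \<in> C n"
    show "x \<in> A"
    proof (rule ccontr)
      assume "x \<notin> A"
      then have "infdist x (- A) = 0" by simp
      then show False using x by (simp add: C_def)
    qed
  qed
  have lC: "C n \<in> lmeasurable" for n
    using opn bounded_subset[OF A(2) subA] by (intro lmeasurable_open)
  have UC: "(\<Union>n. C n) = interior A"
  proof
    show "(\<Union>n. C n) \<subseteq> interior A"
      using subA opn by (intro UN_least interior_maximal)
    show "interior A \<subseteq> (\<Union>n. C n)"
    proof
      fix x assume "x \<in> interior A"
      then have "x \<notin> closure (- A)" by (simp add: closure_complement)
      then have "infdist x (- A) \<noteq> 0" using in_closure_iff_infdist_zero[OF ne] by simp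
      then have "0 < infdist x (- A)" using infdist_nonneg[of x "- A"] by linarith
      then obtain n where "inverse (real (Suc n)) < infdist x (- A)" using reals_Archimedean by meson
      then show "x \<in> (\<Union>n. C n)" by (intro UN_I[of n]) (simp_all add: C_def)
    qed
  qed
  have inc: "incseq C"
  proof (rule incseq_SucI, rule subsetI)
    fix n x assume "x \<in> C n"
    moreover have "inverse (real (Suc (Suc n))) \<le> inverse (real (Suc n))" by (intro le_imp_inverse_le) auto
    ultimately show "x \<in> C (Suc n)" unfolding C_def mem_Collect_eq by linarith
  qed
  have mint: "measure lebesgue (interior A) = measure lebesgue A"
  proof (rule measure_negligible_symdiff[OF lA])
    have "sym_diff A (interior A) \<subseteq> frontier A" using closure_subset[of A] interior_subset[of A] by (auto simp: frontier_def)
    then show "negligible (sym_diff A (interior A))" by (rule negligible_subset[OF A(3)])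
  qed
  have "(\<lambda>n. measure lebesgue (C n)) \<longlonglongrightarrow> measure lebesgue (\<Union>n. C n)"
  proof (rule Lim_measure_incseq[OF _ inc])
    show "range C \<subseteq> sets lebesgue" using lC by (auto intro: fmeasurableD)
    have "interior A \<in> lmeasurable" using A(2) by (intro lmeasurable_open bounded_interior open_interior)
    then show "emeasure lebesgue (\<Union>n. C n) \<noteq> \<infinity>" unfolding UC by (auto simp: fmeasurable_def simp del: emeasure_completion)
  qed
  then have "\<forall>\<^sub>F n in sequentially. c < measure lebesgue (C n)"
    using c unfolding UC mint by (rule order_tendstoD)
  then obtain n where n: "c < measure lebesgue (C n)" using eventually_happens'[OF sequentially_bot] by auto
  have "ball x \<eta> \<subseteq> A" if "x \<in> C n" "\<eta> \<le> inverse (real (Suc n))" for x \<eta>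
  proof (rule subsetI, rule ccontr)
    fix y assume y: "y \<in> ball x \<eta>" "y \<notin> A"
    then have "infdist x (- A) \<le> dist x y" by (intro infdist_le) simp
    then show False using y that by (simp add: C_def)
  qed
  then show ?thesis using lC[of n] n by (intro exI[of _ "inverse (real (Suc n))"]) auto
qed

text \<open>The radius of the mollifier stays below the thresholds of both pieces and below half
  their distance. Shrinking the volume radii by \<open>t < 1\<close> makes room for the volume lost
  near the boundary; at the end \<open>t\<close> tends to 1.\<close>

lemma perimeter_disjoint_Un_ge:
  fixes A B :: "'a::euclidean_space set"
  assumes A: "closed A" "bounded A" "negligible (frontier A)" "A \<noteq> {}"
    and B: "closed B" "bounded B" "negligible (frontier B)" "B \<noteq> {}" and disj: "A \<inter> B = {}"
    and a: "a > 0" "measure lebesgue A = unit_ball_vol (real DIM('a)) * a ^ DIM('a)"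
    and b: "b > 0" "measure lebesgue B = unit_ball_vol (real DIM('a)) * b ^ DIM('a)"
  shows "ennreal (DIM('a) * unit_ball_vol (real DIM('a)) * (a ^ (DIM('a) - 1) + b ^ (DIM('a) - 1))) \<le> perimeter (A \<union> B)"
proof -
  let ?d = "DIM('a)" and ?w = "unit_ball_vol (real DIM('a))"
  let ?X = "?d * ?w * (a ^ (?d - 1) + b ^ (?d - 1))"
  have w: "?w > 0" by (rule unit_ball_vol_pos) simp
  have main: "ennreal (t ^ (?d - 1) * ?X) \<le> perimeter (A \<union> B)" if t: "0 < t" "t < 1" for t
  proof -
    have less: "?w * (t * r) ^ ?d < ?w * r ^ ?d" if "r > 0" for r
      using w t that by (intro mult_strict_left_mono power_strict_mono) auto
    have "?w * (t * a) ^ ?d < measure lebesgue A" "?w * (t * b) ^ ?d < measure lebesgue B"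
      using less[OF a(1)] less[OF b(1)] a(2) b(2) by simp_all
    from inner_parallel_set[OF A(1-3) this(1)] inner_parallel_set[OF B(1-3) this(2)]
    obtain \<eta>A \<eta>B where \<eta>A: "\<eta>A > 0" "\<forall>\<eta>. 0 < \<eta> \<and> \<eta> \<le> \<eta>A \<longrightarrow> (\<exists>C. C \<in> lmeasurable \<and> (\<forall>x\<in>C. ball x \<eta> \<subseteq> A) \<and> ?w * (t * a) ^ ?d < measure lebesgue C)"
      and \<eta>B: "\<eta>B > 0" "\<forall>\<eta>. 0 < \<eta> \<and> \<eta> \<le> \<eta>B \<longrightarrow> (\<exists>C. C \<in> lmeasurable \<and> (\<forall>x\<in>C. ball x \<eta> \<subseteq> B) \<and> ?w * (t * b) ^ ?d < measure lebesgue C)"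
      by (elim exE conjE)
    have sd: "setdist A B > 0"
      using A B disj setdist_gt_0_compact_closed[of A B] by (simp add: compact_eq_bounded_closed)
    define \<eta> where "\<eta> = min (min \<eta>A \<eta>B) (setdist A B / 2)"
    have \<eta>: "0 < \<eta>" "\<eta> \<le> \<eta>A" "\<eta> \<le> \<eta>B" "2 * \<eta> \<le> setdist A B" using \<eta>A(1) \<eta>B(1) sd by (auto simp: \<eta>_def)
    obtain C where C: "C \<in> lmeasurable" "\<forall>x\<in>C. ball x \<eta> \<subseteq> A" "?w * (t * a) ^ ?d < measure lebesgue C"
      using \<eta>A(2)[rule_format, OF conjI[OF \<eta>(1,2)]] by (elim exE conjE)
    obtain D where D: "D \<in> lmeasurable" "\<forall>x\<in>D. ball x \<eta> \<subseteq> B" "?w * (t * b) ^ ?d < measure lebesgue D"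
      using \<eta>B(2)[rule_format, OF conjI[OF \<eta>(1,3)]] by (elim exE conjE)
    obtain k :: "'a \<Rightarrow> real" and G L where "mollifier \<eta> k G L"
      using mollifier_exists[OF \<eta>(1)] by (elim exE)
    then interpret mollifier \<eta> k G L .
    have "ennreal (?d * ?w * ((t * a) ^ (?d - 1) + (t * b) ^ (?d - 1))) \<le> perimeter (A \<union> B)"
    proof (rule perimeter_Un_ge[where C=C and D=D])
      show "2 * \<eta> \<le> dist x y" if "x \<in> A" "y \<in> B" for x y
        using setdist_le_dist[OF that] \<eta>(4) by linarith
      show "ball x \<eta> \<subseteq> A" if "x \<in> C" for x using C(2) that by (rule bspec)
      show "ball x \<eta> \<subseteq> B" if "x \<in> D" for x using D(2) that by (rule bspec)
    qed (use A B C D t a b in \<open>auto intro: borel_closed\<close>)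
    also have "?d * ?w * ((t * a) ^ (?d - 1) + (t * b) ^ (?d - 1)) = t ^ (?d - 1) * ?X"
      by (simp add: power_mult_distrib algebra_simps)
    finally show ?thesis .
  qed
  have "((\<lambda>t. ennreal (t ^ (?d - 1) * ?X)) \<longlongrightarrow> ennreal (1 ^ (?d - 1) * ?X)) (at_left 1)"
    by (intro tendsto_ennrealI tendsto_intros)
  moreover have "\<forall>\<^sub>F t in at_left 1. ennreal (t ^ (?d - 1) * ?X) \<le> perimeter (A \<union> B)"
    using main by (intro eventually_at_leftI[of 0]) auto
  ultimately have "ennreal (1 ^ (?d - 1) * ?X) \<le> perimeter (A \<union> B)"
    by (rule tendsto_upperbound) simp
  then show ?thesis by simp
qed

text \<open>For \<open>s \<le> r\<close>, write \<open>R ^ (d - 1)\<close> as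
  \<open>(r ^ d + s ^ d) / R\<close>. Since \<open>r \<le> R\<close>, at least
  \<open>(1 - s / R) * s ^ (d - 1)\<close> remains. The smaller ball holds at most half of the
  volume, which bounds \<open>s / R\<close> away from 1.\<close>

lemma two_radii_gap:
  fixes r s R \<delta> :: real
  assumes d: "d \<ge> 1" and \<delta>: "0 < \<delta>" "\<delta> \<le> r" "\<delta> \<le> s" and R: "R > 0" "r ^ d + s ^ d = R ^ d"
  shows "R ^ (d - 1) + (1 - 2 powr (- 1 / d)) * \<delta> ^ (d - 1) \<le> r ^ (d - 1) + s ^ (d - 1)"
proof -
  have wlog: "R ^ (d - 1) + (1 - 2 powr (- 1 / d)) * \<delta> ^ (d - 1) \<le> r ^ (d - 1) + s ^ (d - 1)"
    if "s \<le> r" "\<delta> \<le> s" "r ^ d + s ^ d = R ^ d" for r s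
  proof -
    have s0: "s > 0" "r > 0" using that \<delta> by auto
    have "r ^ d \<le> R ^ d" using that s0 by (simp add: power_mono_iff) (metis less_eq_real_def zero_le_power le_add_same_cancel1)
    then have rR: "r \<le> R" using R(1) s0 d by (simp add: power_mono_iff)
    have pd: "x ^ d = x * x ^ (d - 1)" for x :: real using d by (cases d) auto
    have "s ^ d \<le> r ^ d" using that s0 by (intro power_mono) auto
    then have "2 * s ^ d \<le> R ^ d" using that by linarith
    then have "s ^ d \<le> R ^ d / 2" by simp
    also have "\<dots> = (2 powr (- 1 / d) * R) ^ d"
    proof -
      have "2 powr (- 1 / d) = (1 / 2) powr (1 / real d)" by (simp add: powr_minus_divide powr_divide)
      then have "(2 powr (- 1 / d)) ^ d = 1 / 2" using d by (simp only:) (intro powr_inverse_power(1), auto)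
      then show ?thesis by (simp add: power_mult_distrib)
    qed
    finally have "s \<le> 2 powr (- 1 / d) * R" using R(1) s0 d by (subst (asm) power_mono_iff) auto
    then have "s / R \<le> 2 powr (- 1 / d)" using R(1) by (simp add: divide_le_eq)
    moreover have "2 powr (- 1 / d) \<le> 2 powr 0" using d by (intro powr_mono) auto
    ultimately have "(1 - 2 powr (- 1 / d)) * \<delta> ^ (d - 1) \<le> (1 - s / R) * s ^ (d - 1)"
      using \<delta> that(2) by (intro mult_mono power_mono) auto
    also have "\<dots> = s ^ (d - 1) - s ^ d / R" by (simp add: pd algebra_simps)
    finally have 1: "(1 - 2 powr (- 1 / d)) * \<delta> ^ (d - 1) \<le> s ^ (d - 1) - s ^ d / R" .
    have "r * r ^ (d - 1) \<le> R * r ^ (d - 1)" using rR s0 by (intro mult_right_mono) auto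
    then have 2: "r ^ d / R \<le> r ^ (d - 1)" using R(1) by (simp add: pd divide_le_eq mult.commute)
    have "R ^ (d - 1) = (r ^ d + s ^ d) / R" using that R(1) by (simp add: pd)
    then show ?thesis using 1 2 by (simp add: add_divide_distrib)
  qed
  show ?thesis using wlog[of s r] wlog[of r s] assms by (cases "s \<le> r") (auto simp: add.commute)
qed

context ball_domain begin

text \<open>The two pieces of a disconnection need not be components. By \<open>clopen_piece\<close>
  each inherits a null frontier and contains a \<delta>-ball, so both volume radii are at least
  \<delta>.\<close>

lemma perimeter_disconnected_ge:
  assumes E: "E \<in> lmeasurable" "\<not> connected E" and R: "R > 0" "measure lebesgue E = unit_ball_vol (real DIM('a)) * R ^ DIM('a)"
  shows "ennreal (DIM('a) * unit_ball_vol (real DIM('a)) * (R ^ (DIM('a) - 1) + (1 - 2 powr (- 1 / DIM('a))) * \<delta> ^ (DIM('a) - 1))) \<le> perimeter E"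
proof -
  let ?d = "DIM('a)" and ?w = "unit_ball_vol (real DIM('a))"
  have w: "?w > 0" by (rule unit_ball_vol_pos) simp
  have "\<exists>A. closed A \<and> (\<exists>B. A \<union> B = E \<and> closed B \<and> A \<noteq> {} \<and> B \<noteq> {} \<and> A \<inter> B = {})"
    using E(2) connected_closed_set[OF closed] by simp
  then obtain A B where AB: "closed A" "closed B" "A \<noteq> {}" "B \<noteq> {}" "A \<union> B = E" "A \<inter> B = {}" by (elim exE conjE)
  have bE: "bounded E" by (rule bounded[OF E(1)])
  have bA: "bounded A" "bounded B" using AB(5) by (auto intro: bounded_subset[OF bE])
  note pA = clopen_piece[OF AB(5)[symmetric] AB(1,2,6,3) bA(1)]
  have BA: "E = B \<union> A" "B \<inter> A = {}" using AB(5,6) by auto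
  note pB = clopen_piece[OF BA(1) AB(2,1) BA(2) AB(4) bA(2)]
  have neg: "negligible (frontier A)" "negligible (frontier B)"
    using negligible_subset[OF negligible_frontier pA(1)] negligible_subset[OF negligible_frontier pB(1)] .
  have lm: "A \<in> lmeasurable" "B \<in> lmeasurable"
    using AB bA by (auto intro!: lmeasurable_compact simp: compact_eq_bounded_closed)
  have radius: "\<exists>r\<ge>\<delta>. measure lebesgue X = ?w * r ^ ?d"
    if X: "X \<in> lmeasurable" "ball y \<delta> \<subseteq> X" for X :: "'a set" and y
  proof -
    have "?w * \<delta> ^ ?d = measure lebesgue (ball y \<delta>)" using \<delta> by (subst measure_ball) auto
    also have "\<dots> \<le> measure lebesgue X" using X by (intro measure_mono_fmeasurable) auto
    finally have le: "?w * \<delta> ^ ?d \<le> measure lebesgue X" .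
    define q where "q = measure lebesgue X / ?w"
    have q: "\<delta> ^ ?d \<le> q" using le w by (simp add: q_def le_divide_eq mult.commute del: measure_completion)
    have "\<delta> = (\<delta> ^ ?d) powr (1 / ?d)" using \<delta> by (simp add: powr_inverse_power)
    also have "\<dots> \<le> q powr (1 / ?d)" using q \<delta> by (intro powr_mono2) auto
    finally have "\<delta> \<le> q powr (1 / ?d)" .
    moreover have "0 \<le> \<delta> ^ ?d" using \<delta> by simp
    then have "(q powr (1 / ?d)) ^ ?d = q" using q by (intro powr_inverse_power(1)) auto
    then have "measure lebesgue X = ?w * (q powr (1 / ?d)) ^ ?d" using less_imp_neq[OF w] unfolding q_def by (metis nonzero_mult_div_cancel_left times_divide_eq_right)
    ultimately show ?thesis by (intro exI[of _ "q powr (1 / ?d)"] conjI)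
  qed
  obtain ya yb where "ball ya \<delta> \<subseteq> A" "ball yb \<delta> \<subseteq> B" using pA(2) pB(2) by (elim exE)
  from radius[OF lm(1) this(1)] radius[OF lm(2) this(2)]
  obtain a b where a: "\<delta> \<le> a" "measure lebesgue A = ?w * a ^ ?d" and b: "\<delta> \<le> b" "measure lebesgue B = ?w * b ^ ?d"
    by (elim exE conjE)
  have "measure lebesgue E = measure lebesgue A + measure lebesgue B"
    unfolding AB(5)[symmetric] by (simp only: measure_Un3[OF lm] AB(6) measure_empty diff_zero)
  then have "?w * (a ^ ?d + b ^ ?d) = ?w * R ^ ?d" using a(2) b(2) R(2) by (simp only: distrib_left)
  then have "a ^ ?d + b ^ ?d = R ^ ?d" using less_imp_neq[OF w] by (metis mult_cancel_left)
  then have "R ^ (?d - 1) + (1 - 2 powr (- 1 / ?d)) * \<delta> ^ (?d - 1) \<le> a ^ (?d - 1) + b ^ (?d - 1)"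
    using a b \<delta> R by (intro two_radii_gap) auto
  then have "?d * ?w * (R ^ (?d - 1) + (1 - 2 powr (- 1 / ?d)) * \<delta> ^ (?d - 1)) \<le> ?d * ?w * (a ^ (?d - 1) + b ^ (?d - 1))"
    using w by (intro mult_left_mono) auto
  then have "ennreal (?d * ?w * (R ^ (?d - 1) + (1 - 2 powr (- 1 / ?d)) * \<delta> ^ (?d - 1))) \<le> ennreal (?d * ?w * (a ^ (?d - 1) + b ^ (?d - 1)))"
    by (rule ennreal_leI)
  also have "\<dots> \<le> perimeter (A \<union> B)"
    using a b \<delta> AB bA neg by (intro perimeter_disjoint_Un_ge) auto
  finally show ?thesis unfolding AB(5) .
qed

end

section \<open>Nearest boundary points and lower semicontinuity of the Riesz energy\<close>

lemma nearest_frontier_point_inside: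
  fixes E :: "'a::euclidean_space set"
  assumes E: "closed E" "- E \<noteq> {}" and x: "x \<in> E"
  shows "\<exists>p\<in>frontier E. ball x (dist x p) \<subseteq> E \<and> dist x p = infdist x (- E)"
proof -
  \<comment> \<open>The complement is open and need not contain a nearest point, so the distance is
    realised in its closure.\<close>
  have "closure (- E) \<noteq> {}" using E(2) by simp
  then obtain p where p: "p \<in> closure (- E)" "infdist x (closure (- E)) = dist x p"
    using infdist_attains_inf[OF closed_closure] by metis
  have d: "dist x p = infdist x (- E)" using p(2) by (simp add: infdist_eq_setdist)
  have sub: "ball x (dist x p) \<subseteq> E"
  proof (rule subsetI, rule ccontr)
    fix y assume y: "y \<in> ball x (dist x p)" "y \<notin> E"
    then have "infdist x (- E) \<le> dist x y" by (intro infdist_le) simp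
    then show False using y d by simp
  qed
  have "p \<in> E"
  proof (cases "x = p")
    case False
    have "closure (ball x (dist x p)) \<subseteq> E" by (rule closure_minimal[OF sub E(1)])
    moreover have "p \<in> closure (ball x (dist x p))" using False by (simp add: closure_ball)
    ultimately show ?thesis by (rule subsetD)
  qed (use x in simp)
  then have "p \<in> frontier E" using p(1) E(1) by (simp add: frontier_def closure_complement)
  then show ?thesis using sub d by (intro bexI[of _ p] conjI)
qed

lemma nearest_frontier_point_outside:
  fixes E :: "'a::euclidean_space set"
  assumes E: "closed E" "E \<noteq> {}" and x: "x \<notin> E"
  shows "\<exists>p\<in>frontier E. ball x (dist x p) \<subseteq> - E \<and> dist x p = infdist x E"
proof -
  obtain p where p: "p \<in> E" "infdist x E = dist x p"
    using infdist_attains_inf[OF E] by metis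
  have sub: "ball x (dist x p) \<subseteq> - E"
  proof (rule subsetI, rule ccontr)
    fix y assume y: "y \<in> ball x (dist x p)" "y \<notin> - E"
    then have "infdist x E \<le> dist x y" by (intro infdist_le) simp
    then show False using y p by simp
  qed
  have "x \<noteq> p" using p x by auto
  then have "p \<in> closure (ball x (dist x p))" by (simp add: closure_ball)
  then have "p \<in> closure (- E)" by (rule subsetD[OF closure_mono[OF sub]])
  then have "p \<in> frontier E" using p(1) E(1) by (simp add: frontier_def closure_complement)
  then show ?thesis using sub p by (intro bexI[of _ p] conjI) simp_all
qed

text \<open>McShane's extension: the infimum of the cones of slope \<open>K\<close> over the points
  of \<open>S\<close>.\<close>

lemma lipschitz_extension_real:
  fixes u :: "'a::metric_space \<Rightarrow> real"
  assumes S: "S \<noteq> {}" and "K \<ge> 0" and u: "\<And>x y. x \<in> S \<Longrightarrow> y \<in> S \<Longrightarrow> \<bar>u x - u y\<bar> \<le> K * dist x y"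
  shows "\<exists>v. (\<forall>x\<in>S. v x = u x) \<and> (\<forall>x y. \<bar>v x - v y\<bar> \<le> K * dist x y)"
proof -
  define v where "v x = (INF p\<in>S. u p + K * dist x p)" for x
  obtain p0 where p0: "p0 \<in> S" using S by auto
  have bdd: "bdd_below ((\<lambda>p. u p + K * dist x p) ` S)" for x
  proof (rule bdd_belowI2)
    fix p assume p: "p \<in> S"
    have "K * dist p0 p \<le> K * (dist p0 x + dist x p)"
      using \<open>K \<ge> 0\<close> by (intro mult_left_mono dist_triangle)
    then show "u p0 - K * dist p0 x \<le> u p + K * dist x p" using u[OF p0 p] by (simp add: distrib_left)
  qed
  have le: "v x \<le> v y + K * dist x y" for x y
  proof -
    have "v x - K * dist x y \<le> (INF p\<in>S. u p + K * dist y p)"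
    proof (rule cINF_greatest[OF S])
      fix p assume p: "p \<in> S"
      have "v x \<le> u p + K * dist x p" unfolding v_def by (rule cINF_lower[OF bdd p])
      also have "\<dots> \<le> u p + K * (dist x y + dist y p)"
        using \<open>K \<ge> 0\<close> by (intro add_left_mono mult_left_mono dist_triangle)
      finally show "v x - K * dist x y \<le> u p + K * dist y p" by (simp add: distrib_left)
    qed
    then show ?thesis unfolding v_def[of y] by linarith
  qed
  show ?thesis
  proof (intro exI[of _ v] conjI ballI allI)
    show "v x = u x" if x: "x \<in> S" for x
    proof (rule antisym)
      show "v x \<le> u x" unfolding v_def using cINF_lower[OF bdd x, of x] by simp
      show "u x \<le> v x" unfolding v_def
      proof (rule cINF_greatest[OF S])
        show "u x \<le> u p + K * dist x p" if "p \<in> S" for p using u[OF x that] by linarith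
      qed
    qed
    show "\<bar>v x - v y\<bar> \<le> K * dist x y" for x y
      using le[of x y] le[of y x] by (simp add: dist_commute abs_le_iff)
  qed
qed

context ball_domain begin

text \<open>McShane's extension is applied to each coordinate, hence the factor
  \<open>DIM('a)\<close>. The extended field has unit length only on the frontier.\<close>

lemma normal_extension:
  assumes "frontier E \<noteq> {}"
  shows "\<exists>W. (\<forall>p\<in>frontier E. W p = \<nu> p) \<and> (\<forall>x y. norm (W x - W y) \<le> (real DIM('a) / \<delta>) * norm (x - y))"
proof -
  have "\<exists>v. (\<forall>x\<in>frontier E. v x = \<nu> x \<bullet> b) \<and> (\<forall>x y. \<bar>v x - v y\<bar> \<le> (1 / \<delta>) * dist x y)" if b: "b \<in> Basis" for b
  proof (rule lipschitz_extension_real[OF assms])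
    fix x y assume "x \<in> frontier E" "y \<in> frontier E"
    then have "norm (\<nu> x - \<nu> y) \<le> norm (x - y) / \<delta>" by (rule normal_lipschitz)
    then show "\<bar>\<nu> x \<bullet> b - \<nu> y \<bullet> b\<bar> \<le> (1 / \<delta>) * dist x y"
      using Basis_le_norm[OF b, of "\<nu> x - \<nu> y"] by (simp add: inner_diff_left dist_norm)
  qed (use \<delta> in simp)
  then obtain v where v: "\<And>b x. b \<in> Basis \<Longrightarrow> x \<in> frontier E \<Longrightarrow> v b x = \<nu> x \<bullet> b"
    "\<And>b x y. b \<in> Basis \<Longrightarrow> \<bar>v b x - v b y\<bar> \<le> (1 / \<delta>) * dist x y" by metis
  let ?W = "\<lambda>x. \<Sum>b\<in>Basis. v b x *\<^sub>R b"
  show ?thesis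
  proof (intro exI[of _ ?W] conjI ballI allI)
    fix p assume "p \<in> frontier E"
    then have "?W p = (\<Sum>b\<in>Basis. (\<nu> p \<bullet> b) *\<^sub>R b)" using v(1) by (intro sum.cong) auto
    then show "?W p = \<nu> p" by (simp add: euclidean_representation)
  next
    fix x y
    have "norm (?W x - ?W y) \<le> (\<Sum>b\<in>Basis. norm ((v b x - v b y) *\<^sub>R b))"
      unfolding sum_subtractf[symmetric] scaleR_diff_left[symmetric] by (rule norm_sum)
    also have "\<dots> \<le> (\<Sum>b\<in>(Basis :: 'a set). (1 / \<delta>) * dist x y)"
      using v(2) by (intro sum_mono) simp
    finally show "norm (?W x - ?W y) \<le> (real DIM('a) / \<delta>) * norm (x - y)" by (simp add: dist_norm)
  qed
qed

text \<open>Shrinking a neighbourhood of \<open>E\<close> along a Lipschitz extension of the normal field maps it into \<open>E\<close>.\<close>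

lemma riesz_energy_lower_semicontinuous:
  assumes E: "E \<noteq> {}" "E \<subseteq> cball 0 D" and "\<alpha> > 0" and \<epsilon>: "0 < \<epsilon>" "\<epsilon> < 1"
  shows "\<exists>s>0. \<forall>F. F \<in> sets borel \<and> F \<subseteq> cball 0 D \<and> (\<forall>x\<in>F. infdist x E \<le> s)
    \<longrightarrow> ennreal ((1 - \<epsilon>) powr \<alpha>) * riesz_energy \<alpha> E \<le> riesz_energy \<alpha> F"
proof -
  let ?d = "real DIM('a)"
  have bE: "bounded E" by (rule bounded_subset[OF bounded_cball E(2)])
  have nU: "E \<noteq> UNIV" using bE not_bounded_UNIV by auto
  then have cne: "- E \<noteq> {}" by auto
  have fne: "frontier E \<noteq> {}" using E(1) nU by (rule frontier_not_empty)
  obtain W where W: "\<And>p. p \<in> frontier E \<Longrightarrow> W p = \<nu> p"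
    and Wlip: "\<And>x y. norm (W x - W y) \<le> (?d / \<delta>) * norm (x - y)"
    using normal_extension[OF fne] by metis
  have d1: "?d \<ge> 1" using DIM_positive[where 'a='a] by linarith
  have lipW: "(?d / \<delta>)-lipschitz_on UNIV W" using Wlip \<delta> by (intro lipschitz_onI) (auto simp: dist_norm)
  then have contW: "continuous_on UNIV W" by (rule lipschitz_on_continuous_on)
  have "compact (W ` cball 0 D)" by (intro compact_continuous_image continuous_on_subset[OF contW]) auto
  then have "bounded (W ` cball 0 D)" by (rule compact_imp_bounded)
  then obtain M where M: "M > 0" "\<And>x. x \<in> cball 0 D \<Longrightarrow> norm (W x) \<le> M"
    unfolding bounded_pos by auto
  \<comment> \<open>Within distance \<kappa> of a frontier point the extended field differs from the
    normal there by at most 1/4.\<close>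
  define \<kappa> where "\<kappa> = \<delta> / (4 * ?d)"
  have \<kappa>: "\<kappa> > 0" "(?d / \<delta>) * \<kappa> = 1 / 4" "\<kappa> \<le> \<delta> / 4"
    using \<delta> d1 by (auto simp: \<kappa>_def field_simps)
  \<comment> \<open>The three bounds on the step length keep \<open>\<sigma> + \<delta> - t\<close>
    nonnegative, keep points deeper than \<kappa> inside \<open>E\<close>, and limit the contraction
    of distances to the factor \<open>1 - \<epsilon>\<close>.\<close>
  define t where "t = min (min (\<delta> / 2) (\<kappa> / (2 * M))) (\<epsilon> * \<delta> / ?d)"
  have t: "t > 0" "t \<le> \<delta> / 2" "t \<le> \<kappa> / (2 * M)" "t \<le> \<epsilon> * \<delta> / ?d"
    using \<delta> \<kappa> M(1) \<epsilon> d1 by (auto simp: t_def)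
  have tM: "t * M \<le> \<kappa> / 2" using t(3) M(1) by (simp add: le_divide_eq mult.commute mult.left_commute)
  have te: "t * (?d / \<delta>) \<le> \<epsilon>" using t(4) \<delta> d1 by (simp add: field_simps)
  \<comment> \<open>The step moves a point at least \<open>3 / 4 * t\<close> inwards in normal
    direction, which outweighs an excess of at most \<open>t / 2\<close>. The bound by \<kappa>
    keeps outside points where the field is close to the normal.\<close>
  define s where "s = min (t / 2) \<kappa>"
  have s: "s > 0" "s \<le> t / 2" "s \<le> \<kappa>" using t \<kappa> by (auto simp: s_def)
  define T where "T x = x - t *\<^sub>R W x" for x
  have near: "T x \<in> E" if p: "p \<in> frontier E" and x: "x = p + \<sigma> *\<^sub>R \<nu> p" and \<sigma>: "\<bar>\<sigma>\<bar> \<le> \<kappa>" "\<sigma> \<le> s" for x p \<sigma>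
  proof -
    have np: "norm (\<nu> p) = 1" by (rule normal(1)[OF p])
    have "norm (\<nu> p - W x) \<le> (?d / \<delta>) * norm (p - x)" using Wlip[of p x] by (simp add: W[OF p])
    also have "norm (p - x) = \<bar>\<sigma>\<bar>" using np by (simp add: x)
    also have "(?d / \<delta>) * \<bar>\<sigma>\<bar> \<le> (?d / \<delta>) * \<kappa>" using \<sigma>(1) \<delta> by (intro mult_left_mono) auto
    finally have 1: "norm (\<nu> p - W x) \<le> 1 / 4" unfolding \<kappa>(2) .
    have "T x - (p - \<delta> *\<^sub>R \<nu> p) = (\<sigma> + \<delta> - t) *\<^sub>R \<nu> p + t *\<^sub>R (\<nu> p - W x)"
      by (simp add: T_def x algebra_simps)
    then have "norm (T x - (p - \<delta> *\<^sub>R \<nu> p)) \<le> norm ((\<sigma> + \<delta> - t) *\<^sub>R \<nu> p) + norm (t *\<^sub>R (\<nu> p - W x))"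
      using norm_triangle_ineq by metis
    also have "\<dots> = \<bar>\<sigma> + \<delta> - t\<bar> + t * norm (\<nu> p - W x)" using np t(1) by simp
    also have "\<dots> \<le> (\<sigma> + \<delta> - t) + t * (1 / 4)"
    proof (intro add_mono mult_left_mono 1)
      show "\<bar>\<sigma> + \<delta> - t\<bar> \<le> \<sigma> + \<delta> - t" using t(2) \<sigma>(1) \<kappa>(3) \<delta> by linarith
    qed (use t(1) in simp)
    also have "\<dots> < \<delta>" using \<sigma>(2) s(2) t(1) by simp
    finally have "T x \<in> ball (p - \<delta> *\<^sub>R \<nu> p) \<delta>" by (simp only: mem_ball dist_norm norm_minus_commute)
    then show ?thesis by (rule subsetD[OF normal(2)[OF p]])
  qed
  have into: "T x \<in> E" if x: "x \<in> cball 0 D" "infdist x E \<le> s" for x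
  proof (cases "x \<in> E")
    case True
    obtain p where p: "p \<in> frontier E" "ball x (dist x p) \<subseteq> E"
      using nearest_frontier_point_inside[OF closed cne True] by (elim bexE conjE)
    show ?thesis
    proof (cases "dist x p \<le> \<kappa>")
      case True
      have "x = p + (- dist x p) *\<^sub>R \<nu> p"
      proof (cases "x = p")
        case False
        then have "0 < dist x p" by simp
        from nearest_point_normal(1)[OF p(1) _ this p(2)] show ?thesis by (simp add: dist_norm)
      qed simp
      then show ?thesis by (rule near[OF p(1)]) (use True s(1) in \<open>auto intro: order_trans[of _ 0]\<close>)
    next
      case False
      have "norm (t *\<^sub>R W x) \<le> t * M" using M(2)[OF x(1)] t(1) by simp
      also have "\<dots> < dist x p" using tM False \<kappa>(1) by linarith
      finally have "T x \<in> ball x (dist x p)" by (simp add: T_def dist_norm)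
      then show ?thesis by (rule subsetD[OF p(2)])
    qed
  next
    case False
    obtain p where p: "p \<in> frontier E" "ball x (dist x p) \<subseteq> - E" "dist x p = infdist x E"
      using nearest_frontier_point_outside[OF closed E(1) False] by (elim bexE conjE)
    have "p \<in> E" by (rule subsetD[OF frontier_subset_closed[OF closed] p(1)])
    then have "0 < dist x p" using False by auto
    from nearest_point_normal(2)[OF p(1) _ this p(2)] have "x = p + dist x p *\<^sub>R \<nu> p" by (simp add: dist_norm)
    then show ?thesis by (rule near[OF p(1)]) (use x(2) p(3) s(3) infdist_nonneg[of x E] in auto)
  qed
  have contT: "continuous_on UNIV T" unfolding T_def by (intro continuous_intros contW)
  have exp: "(1 - \<epsilon>) * norm (x - y) \<le> norm (T x - T y)" for x y
  proof -
    have "norm (t *\<^sub>R (W x - W y)) \<le> t * ((?d / \<delta>) * norm (x - y))"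
      using mult_left_mono[OF Wlip[of x y] less_imp_le[OF t(1)]] by (simp only: norm_scaleR abs_of_pos[OF t(1)])
    also have "\<dots> = (t * (?d / \<delta>)) * norm (x - y)" by (simp only: mult.assoc)
    also have "\<dots> \<le> \<epsilon> * norm (x - y)" using te by (rule mult_right_mono) simp
    finally have "norm (t *\<^sub>R (W x - W y)) \<le> \<epsilon> * norm (x - y)" .
    moreover have "T x - T y = (x - y) - t *\<^sub>R (W x - W y)" by (simp add: T_def algebra_simps)
    moreover have "norm (x - y) - norm (t *\<^sub>R (W x - W y)) \<le> norm ((x - y) - t *\<^sub>R (W x - W y))" by (rule norm_triangle_ineq2)
    ultimately show ?thesis by (simp add: left_diff_distrib)
  qed
  show ?thesis
  proof (intro exI[of _ s] conjI allI impI)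
    fix F assume F: "F \<in> sets borel \<and> F \<subseteq> cball 0 D \<and> (\<forall>x\<in>F. infdist x E \<le> s)"
    show "ennreal ((1 - \<epsilon>) powr \<alpha>) * riesz_energy \<alpha> E \<le> riesz_energy \<alpha> F"
    proof (rule riesz_energy_expanding[where T=T])
      show "T \<in> borel \<rightarrow>\<^sub>M borel" using contT by (rule borel_measurable_continuous_onI)
      show "T ` F \<subseteq> E"
      proof (rule image_subsetI, rule into)
        show "x \<in> cball 0 D" if "x \<in> F" for x using F that by (elim conjE subsetD)
      qed (use F in auto)
    qed (use F closed \<epsilon> exp \<open>\<alpha> > 0\<close> in auto)
  qed (fact s(1))
qed

end

section \<open>Compactness by signed distance functions\<close>

lemma le_infdistI: "A \<noteq> {} \<Longrightarrow> (\<And>a. a \<in> A \<Longrightarrow> r \<le> dist x a) \<Longrightarrow> r \<le> infdist x A"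
  by (simp add: infdist_notempty cINF_greatest)

text \<open>At every point one of the two terms vanishes, so a limit of these functions records
  inside and outside at once. As \<open>infdist\<close> to the empty set is 0, the bounds from
  tangent balls assume that the set measured against is nonempty.\<close>

definition signed_dist :: "'a::metric_space set \<Rightarrow> 'a \<Rightarrow> real" where
  "signed_dist E x = infdist x E - infdist x (- E)"

lemma signed_dist_lipschitz: "\<bar>signed_dist E x - signed_dist E y\<bar> \<le> 2 * dist x y"
proof -
  have "\<bar>infdist x A - infdist y A\<bar> \<le> dist x y" for A
    using infdist_triangle[of x A y] infdist_triangle[of y A x] by (simp add: dist_commute abs_le_iff)
  from this[of E] this[of "- E"] show ?thesis unfolding signed_dist_def by linarith
qed

lemma signed_dist_nonpos: "x \<in> E \<Longrightarrow> signed_dist E x = - infdist x (- E)"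
  and signed_dist_nonneg: "x \<notin> E \<Longrightarrow> signed_dist E x = infdist x E"
  by (simp_all add: signed_dist_def)

lemma signed_dist_ball_inside:
  assumes "ball y r \<subseteq> E" "- E \<noteq> {}" "r > 0"
  shows "signed_dist E y \<le> - r"
proof -
  have "y \<in> E" using assms(1,3) by auto
  have "r \<le> infdist y (- E)"
  proof (rule le_infdistI)
    show "- E \<noteq> {}" by fact
    fix z assume "z \<in> - E"
    then have "z \<notin> ball y r" using assms(1) by auto
    then show "r \<le> dist y z" by simp
  qed
  then show ?thesis using \<open>y \<in> E\<close> by (simp add: signed_dist_nonpos)
qed

lemma signed_dist_ball_outside:
  assumes "ball y r \<subseteq> - E" "E \<noteq> {}" "r > 0"
  shows "r \<le> signed_dist E y"
proof -
  have "y \<notin> E" using subsetD[OF assms(1), of y] assms(3) by simp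
  have "r \<le> infdist y E"
  proof (rule le_infdistI)
    show "E \<noteq> {}" by fact
    fix z assume "z \<in> E"
    then have "z \<notin> ball y r" using assms(1) by auto
    then show "r \<le> dist y z" by simp
  qed
  then show ?thesis using \<open>y \<notin> E\<close> by (simp add: signed_dist_nonneg)
qed

lemma frontier_point_signed_dist:
  fixes E :: "'a::euclidean_space set"
  assumes "closed E" "E \<noteq> {}" "- E \<noteq> {}"
  shows "\<exists>p\<in>frontier E. dist x p = \<bar>signed_dist E x\<bar>"
proof (cases "x \<in> E")
  case True
  obtain p where "p \<in> frontier E" "dist x p = infdist x (- E)"
    using nearest_frontier_point_inside[OF assms(1,3) True] by (elim bexE conjE)
  then show ?thesis using infdist_nonneg[of x "- E"] by (intro bexI[of _ p]) (simp_all add: signed_dist_nonpos[OF True])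
next
  case False
  obtain p where "p \<in> frontier E" "dist x p = infdist x E"
    using nearest_frontier_point_outside[OF assms(1,2) False] by (elim bexE conjE)
  then show ?thesis using infdist_nonneg[of x E] by (intro bexI[of _ p]) (simp_all add: signed_dist_nonneg[OF False])
qed

text \<open>The danger is a limit \<open>g\<close> that vanishes on a fat set. Tangent balls are
  therefore constructed at every zero of \<open>g\<close>, not merely at frontier points of
  \<open>F\<close>. This yields the ball condition and also shows that each zero is a frontier
  point; so the indicators converge off a null set, and volumes are preserved.\<close>

lemma ball_domain_compactness:
  fixes E :: "nat \<Rightarrow> 'a::euclidean_space set"
  assumes dom: "\<And>n. ball_domain (E n) \<delta>" and ne: "\<And>n. E n \<noteq> {}" and bd: "\<And>n. E n \<subseteq> cball 0 D"
  shows "\<exists>F r. strict_mono (r :: nat \<Rightarrow> nat) \<and> ball_domain F \<delta> \<and> F \<subseteq> cball 0 D \<and>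
    (\<forall>h :: 'a \<Rightarrow> real. integrable lborel h \<longrightarrow>
       (\<lambda>n. \<integral>x. indicator (E (r n)) x * h x \<partial>lborel) \<longlonglongrightarrow> (\<integral>x. indicator F x * h x \<partial>lborel)) \<and>
    (\<forall>s>0. \<forall>\<^sub>F n in sequentially. \<forall>x\<in>E (r n). infdist x F \<le> s)"
proof -
  have \<delta>: "\<delta> > 0" using dom ball_domain.\<delta> by blast
  have clE: "closed (E n)" for n using dom ball_domain.closed by blast
  have cne: "- E n \<noteq> {}" for n
  proof
    assume "- E n = {}"
    then have "bounded (UNIV :: 'a set)" using bounded_subset[OF bounded_cball bd[of n]] by (metis Compl_empty_eq double_complement)
    then show False using not_bounded_UNIV by simp
  qed
  have D0: "D \<ge> 0"
  proof -
    obtain x where "x \<in> E 0" using ne by auto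
    then have "norm x \<le> D" using bd[of 0] by auto
    then show ?thesis using norm_ge_zero[of x] by linarith
  qed
  \<comment> \<open>The zeros of \<open>g\<close> lie in \<open>cball 0 D\<close>; a margin of
    \<open>2 * \<delta>\<close> makes room for both tangent balls at such a point inside the compact
    set where \<open>g\<close> is obtained.\<close>
  define R where "R = D + 2 * \<delta> + 1"
  let ?S = "cball (0::'a) R"
  have out: "norm x - D \<le> signed_dist (E n) x" if "norm x > D" for n x
  proof -
    have "x \<notin> E n" using bd[of n] that by auto
    have "norm x - D \<le> infdist x (E n)"
    proof (rule le_infdistI[OF ne])
      fix z assume "z \<in> E n"
      then have "norm z \<le> D" using bd[of n] by auto
      then show "norm x - D \<le> dist x z" using norm_triangle_ineq2[of x z] by (simp add: dist_norm)
    qed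
    then show ?thesis using \<open>x \<notin> E n\<close> by (simp add: signed_dist_nonneg)
  qed
  have eqc: "\<exists>d>0. \<forall>n y. y \<in> ?S \<and> norm (x - y) < d \<longrightarrow> norm (signed_dist (E n) x - signed_dist (E n) y) < e"
    if "e > 0" for x e
  proof (intro exI[of _ "e / 2"] conjI allI impI)
    fix n y assume "y \<in> ?S \<and> norm (x - y) < e / 2"
    then show "norm (signed_dist (E n) x - signed_dist (E n) y) < e"
      using signed_dist_lipschitz[of "E n" x y] by (simp add: dist_norm)
  qed (use that in simp)
  have bnd: "norm (signed_dist (E n) x) \<le> 4 * R + 2" if x: "x \<in> ?S" for n x
  proof -
    obtain p where p: "p \<in> frontier (E n)" "dist x p = \<bar>signed_dist (E n) x\<bar>"
      using frontier_point_signed_dist[OF clE[of n] ne[of n] cne[of n], of x] by (elim bexE)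
    have "p \<in> cball 0 D" by (rule subsetD[OF bd subsetD[OF frontier_subset_closed[OF clE] p(1)]])
    then have "dist x p \<le> R + D" using x dist_triangle[of x p 0] by simp
    then show ?thesis using p(2) D0 \<delta> by (simp add: R_def)
  qed
  obtain g r where g: "continuous_on ?S g" and r: "strict_mono (r :: nat \<Rightarrow> nat)"
    and unif: "\<And>e. 0 < e \<Longrightarrow> \<exists>N. \<forall>n x. n \<ge> N \<and> x \<in> ?S \<longrightarrow> norm (signed_dist (E (r n)) x - g x) < e"
    by (rule Arzela_Ascoli[OF compact_cball[of 0 R] bnd eqc]; blast)
  have lim: "(\<lambda>n. signed_dist (E (r n)) x) \<longlonglongrightarrow> g x" if "x \<in> ?S" for x
  proof (rule LIMSEQ_I)
    fix e :: real assume "0 < e"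
    from unif[OF this] obtain N where "\<forall>n x. n \<ge> N \<and> x \<in> ?S \<longrightarrow> norm (signed_dist (E (r n)) x - g x) < e" by (rule exE)
    then show "\<exists>no. \<forall>n\<ge>no. norm (signed_dist (E (r n)) x - g x) < e" using that by (intro exI[of _ N]) simp
  qed
  define F where "F = {x \<in> ?S. g x \<le> 0}"
  have gout: "g x > 0" if "x \<in> ?S" "norm x > D" for x
  proof -
    have "norm x - D \<le> g x" by (rule LIMSEQ_le_const[OF lim[OF that(1)]]) (use out[OF that(2)] in auto)
    then show ?thesis using that(2) by linarith
  qed
  have FD: "F \<subseteq> cball 0 D"
  proof
    fix x assume "x \<in> F"
    then have "x \<in> ?S" "\<not> g x > 0" by (auto simp: F_def)
    then show "x \<in> cball 0 D" using gout[of x] by force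
  qed
  have clF: "closed F"
  proof -
    have "F = ?S \<inter> g -` {..0}" by (auto simp: F_def)
    then show ?thesis using continuous_closed_preimage[OF g closed_cball closed_atMost[of 0]] by (simp only:)
  qed
  \<comment> \<open>Nearest frontier points of the approximating sets converge to \<open>x\<close>,
    since their distance is the modulus of a signed distance tending to 0. A limit of their unit
    normals provides the axis of both tangent balls.\<close>
  have touching: "\<exists>y. norm (x - y) = \<delta> \<and> ball y \<delta> \<subseteq> F \<and> ball (2 *\<^sub>R x - y) \<delta> \<subseteq> - F"
    if x: "x \<in> ?S" "g x = 0" for x
  proof -
    have xD: "norm x \<le> D" using gout[OF x(1)] x(2) by force
    have "\<exists>p\<in>frontier (E (r n)). dist x p = \<bar>signed_dist (E (r n)) x\<bar>" for n
      by (rule frontier_point_signed_dist[OF clE ne cne])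
    then obtain p where p: "\<And>n. p n \<in> frontier (E (r n))" "\<And>n. dist x (p n) = \<bar>signed_dist (E (r n)) x\<bar>" by metis
    have "(\<lambda>n. \<bar>signed_dist (E (r n)) x\<bar>) \<longlonglongrightarrow> \<bar>g x\<bar>" by (intro tendsto_rabs lim x)
    then have px: "p \<longlonglongrightarrow> x" unfolding tendsto_dist_iff[of p] using p(2) x(2) by (simp add: dist_commute)
    define m where "m n = ball_domain.\<nu> (E (r n)) \<delta> (p n)" for n
    have m: "norm (m n) = 1" "ball (p n - \<delta> *\<^sub>R m n) \<delta> \<subseteq> E (r n)" "ball (p n + \<delta> *\<^sub>R m n) \<delta> \<subseteq> - E (r n)" for n
      unfolding m_def by (rule ball_domain.normal[OF dom p(1)])+
    have "bounded (range m)" using m(1) by (auto simp: bounded_iff intro!: exI[of _ 1])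
    then obtain l q where q: "strict_mono (q :: nat \<Rightarrow> nat)" and l: "(m \<circ> q) \<longlonglongrightarrow> l"
      using bounded_imp_convergent_subsequence[of m] by blast
    have pq: "(\<lambda>n. p (q n)) \<longlonglongrightarrow> x" using LIMSEQ_subseq_LIMSEQ[OF px q] by (simp add: o_def)
    have l': "(\<lambda>n. m (q n)) \<longlonglongrightarrow> l" using l by (simp add: o_def)
    have nl: "norm l = 1" using tendsto_norm[OF l'] m(1) LIMSEQ_unique[OF _ tendsto_const] by simp
    have inS: "w \<in> ?S" if "dist w x < 2 * \<delta>" for w
      using that xD dist_triangle[of w 0 x] by (simp add: R_def)
    \<comment> \<open>Used with \<open>c = - \<delta>\<close> for the inner and
      \<open>c = \<delta>\<close> for the outer balls. The margin \<rho> turns into a strict sign of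
      \<open>g\<close>, which a bare inclusion in the limit would not give.\<close>
    have key: "\<exists>\<rho>>0. \<forall>\<^sub>F n in sequentially. ball w \<rho> \<subseteq> ball (p (q n) + c *\<^sub>R m (q n)) \<delta>" if w: "w \<in> ball (x + c *\<^sub>R l) \<delta>" for w c
    proof -
      define \<rho> where "\<rho> = (\<delta> - dist (x + c *\<^sub>R l) w) / 2"
      have \<rho>: "\<rho> > 0" using w by (simp add: \<rho>_def)
      have "(\<lambda>n. p (q n) + c *\<^sub>R m (q n)) \<longlonglongrightarrow> x + c *\<^sub>R l" by (intro tendsto_intros pq l')
      then have "\<forall>\<^sub>F n in sequentially. dist (p (q n) + c *\<^sub>R m (q n)) (x + c *\<^sub>R l) < \<rho>" using \<rho> by (rule tendstoD)
      then have "\<forall>\<^sub>F n in sequentially. ball w \<rho> \<subseteq> ball (p (q n) + c *\<^sub>R m (q n)) \<delta>"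
      proof eventually_elim
        case (elim n)
        let ?a = "p (q n) + c *\<^sub>R m (q n)" and ?b = "x + c *\<^sub>R l"
        show ?case
        proof
          fix v assume "v \<in> ball w \<rho>"
          moreover have "dist ?a v \<le> dist ?a ?b + dist ?b w + dist w v"
            using dist_triangle[of ?a v ?b] dist_triangle[of ?b v w] by linarith
          ultimately show "v \<in> ball ?a \<delta>" using elim by (simp add: \<rho>_def)
        qed
      qed
      then show ?thesis using \<rho> by blast
    qed
    have limq: "(\<lambda>n. signed_dist (E (r (q n))) w) \<longlonglongrightarrow> g w" if "w \<in> ?S" for w
      using LIMSEQ_subseq_LIMSEQ[OF lim[OF that] q] by (simp add: o_def)
    have 1: "ball (x - \<delta> *\<^sub>R l) \<delta> \<subseteq> F"
    proof
      fix w assume w: "w \<in> ball (x - \<delta> *\<^sub>R l) \<delta>"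
      have "dist w x \<le> dist w (x - \<delta> *\<^sub>R l) + dist (x - \<delta> *\<^sub>R l) x" by (rule dist_triangle)
      also have "\<dots> < 2 * \<delta>" using w nl \<delta> by (simp add: dist_commute; simp add: dist_norm)
      finally have wS: "w \<in> ?S" by (rule inS)
      obtain \<rho> where \<rho>: "\<rho> > 0" "\<forall>\<^sub>F n in sequentially. ball w \<rho> \<subseteq> ball (p (q n) + (- \<delta>) *\<^sub>R m (q n)) \<delta>"
        using key[of w "- \<delta>"] w by auto
      from \<rho>(2) have "\<forall>\<^sub>F n in sequentially. signed_dist (E (r (q n))) w \<le> - \<rho>"
      proof eventually_elim
        case (elim n)
        have "ball w \<rho> \<subseteq> E (r (q n))" using order_trans[OF elim, of "E (r (q n))"] m(2)[of "q n"] by simp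
        then show ?case by (rule signed_dist_ball_inside[OF _ cne \<rho>(1)])
      qed
      then have "g w \<le> - \<rho>" by (rule tendsto_upperbound[OF limq[OF wS]]) simp
      then show "w \<in> F" using wS \<rho>(1) by (simp add: F_def)
    qed
    have 2: "ball (x + \<delta> *\<^sub>R l) \<delta> \<subseteq> - F"
    proof
      fix w assume w: "w \<in> ball (x + \<delta> *\<^sub>R l) \<delta>"
      have "dist w x \<le> dist w (x + \<delta> *\<^sub>R l) + dist (x + \<delta> *\<^sub>R l) x" by (rule dist_triangle)
      also have "\<dots> < 2 * \<delta>" using w nl \<delta> by (simp add: dist_commute; simp add: dist_norm)
      finally have wS: "w \<in> ?S" by (rule inS)
      obtain \<rho> where \<rho>: "\<rho> > 0" "\<forall>\<^sub>F n in sequentially. ball w \<rho> \<subseteq> ball (p (q n) + \<delta> *\<^sub>R m (q n)) \<delta>"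
        using key[of w \<delta>] w by auto
      from \<rho>(2) have "\<forall>\<^sub>F n in sequentially. \<rho> \<le> signed_dist (E (r (q n))) w"
      proof eventually_elim
        case (elim n)
        have "ball w \<rho> \<subseteq> - E (r (q n))" by (rule order_trans[OF elim m(3)])
        then show ?case by (rule signed_dist_ball_outside[OF _ ne \<rho>(1)])
      qed
      then have "\<rho> \<le> g w" by (rule tendsto_lowerbound[OF limq[OF wS]]) simp
      then show "w \<in> - F" using \<rho>(1) by (simp add: F_def)
    qed
    have e: "2 *\<^sub>R x - (x - \<delta> *\<^sub>R l) = x + \<delta> *\<^sub>R l" by (simp add: scaleR_2)
    have "norm (x - (x - \<delta> *\<^sub>R l)) = \<delta>" using nl \<delta> by simp
    moreover have "ball (2 *\<^sub>R x - (x - \<delta> *\<^sub>R l)) \<delta> \<subseteq> - F" unfolding e by (rule 2)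
    ultimately show ?thesis using 1 by (intro exI[of _ "x - \<delta> *\<^sub>R l"] conjI)
  qed
  have frF: "x \<in> ?S \<and> g x = 0" if x: "x \<in> frontier F" for x
  proof -
    have "x \<in> F" by (rule subsetD[OF frontier_subset_closed[OF clF] x])
    then have xS: "x \<in> ?S" "g x \<le> 0" by (auto simp: F_def)
    have xD: "norm x \<le> D" using subsetD[OF FD \<open>x \<in> F\<close>] by simp
    have "\<not> g x < 0"
    proof
      assume gx: "g x < 0"
      have cont: "continuous_on (ball 0 R) g" by (rule continuous_on_subset[OF g]) auto
      have "open (ball 0 R \<inter> g -` {..<0})" using continuous_on_open_vimage[OF open_ball] cont open_lessThan by (metis Int_commute)
      moreover have "x \<in> ball 0 R \<inter> g -` {..<0}" using gx xD \<delta> by (simp add: R_def)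
      moreover have "ball 0 R \<inter> g -` {..<0} \<subseteq> F" by (auto simp: F_def)
      ultimately have "x \<in> interior F" by (rule interiorI)
      then show False using x by (simp add: frontier_def)
    qed
    then show ?thesis using xS by simp
  qed
  have domF: "ball_domain F \<delta>"
  proof
    show "ball_condition \<delta> F"
      unfolding ball_condition_def
    proof
      fix x assume "x \<in> frontier F"
      from touching[OF conjunct1[OF frF[OF this]] conjunct2[OF frF[OF this]]]
      obtain y where y: "norm (x - y) = \<delta>" "ball y \<delta> \<subseteq> F" "ball (2 *\<^sub>R x - y) \<delta> \<subseteq> - F" by (elim exE conjE)
      have "norm (x - (2 *\<^sub>R x - y)) = norm (- (x - y))" by (rule arg_cong[where f=norm]) (simp add: scaleR_2)
      then have "norm (x - (2 *\<^sub>R x - y)) = \<delta>" using y(1) by (simp only: norm_minus_cancel)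
      then show "(\<exists>y. ball y \<delta> \<subseteq> F \<and> norm (x - y) = \<delta>) \<and> (\<exists>z. ball z \<delta> \<subseteq> - F \<and> norm (x - z) = \<delta>)"
        using y by (intro conjI exI)
    qed
  qed (use \<delta> clF in auto)
  \<comment> \<open>The outer tangent ball touches \<open>x\<close>, so \<open>x\<close> is a limit
    of points outside \<open>F\<close>.\<close>
  have zero: "x \<in> frontier F" if x: "x \<in> ?S" "g x = 0" for x
  proof -
    obtain y where y: "norm (x - y) = \<delta>" "ball (2 *\<^sub>R x - y) \<delta> \<subseteq> - F" using touching[OF x] by (elim exE conjE)
    have "dist (2 *\<^sub>R x - y) x = norm (x - y)" by (simp add: dist_norm scaleR_2)
    then have "x \<in> closure (ball (2 *\<^sub>R x - y) \<delta>)" using y(1) \<delta> by (simp add: closure_ball)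
    then have "x \<in> closure (- F)" by (rule subsetD[OF closure_mono[OF y(2)]])
    moreover have "x \<in> F" using x by (simp add: F_def)
    ultimately show ?thesis using clF by (simp add: frontier_def closure_complement)
  qed
  have negF: "negligible (frontier F)" by (rule ball_domain.negligible_frontier[OF domF])
  have ind: "AE x in lborel. (\<lambda>n. indicator (E (r n)) x * h x :: real) \<longlonglongrightarrow> indicator F x * h x" for h :: "'a \<Rightarrow> real"
  proof (rule AE_I')
    show "frontier F \<in> null_sets lborel"
      using negF frontier_closed[of F] by (auto simp: negligible_iff_null_sets null_sets_def)
    show "{x \<in> space lborel. \<not> (\<lambda>n. indicator (E (r n)) x * h x :: real) \<longlonglongrightarrow> indicator F x * h x} \<subseteq> frontier F"
    proof (rule subsetI, rule ccontr)
      fix x assume x: "x \<in> {x \<in> space lborel. \<not> (\<lambda>n. indicator (E (r n)) x * h x :: real) \<longlonglongrightarrow> indicator F x * h x}"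
        and nf: "x \<notin> frontier F"
      have "\<forall>\<^sub>F n in sequentially. (x \<in> E (r n)) = (x \<in> F)"
      proof (cases "x \<in> ?S")
        case False
        then have "x \<notin> cball 0 D" using \<delta> by (auto simp: R_def)
        then have "x \<notin> F" "x \<notin> E (r n)" for n
          using subsetD[OF FD, of x] subsetD[OF bd[of "r n"], of x] by argo+
        then show ?thesis by simp
      next
        case True
        have "g x \<noteq> 0" using zero[OF True] nf by auto
        then consider "g x < 0" | "g x > 0" by linarith
        then show ?thesis
        proof cases
          case 1
          have "\<forall>\<^sub>F n in sequentially. signed_dist (E (r n)) x < 0" by (rule order_tendstoD(2)[OF lim[OF True] 1])
          then show ?thesis
          proof eventually_elim
            case (elim n)
            have "x \<in> E (r n)" using elim signed_dist_nonneg[of x "E (r n)"] infdist_nonneg[of x "E (r n)"] by force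
            then show ?case using 1 True by (simp add: F_def)
          qed
        next
          case 2
          have "\<forall>\<^sub>F n in sequentially. 0 < signed_dist (E (r n)) x" by (rule order_tendstoD(1)[OF lim[OF True] 2])
          then show ?thesis
          proof eventually_elim
            case (elim n)
            have "x \<notin> E (r n)" using elim signed_dist_nonpos[of x "E (r n)"] infdist_nonneg[of x "- E (r n)"] by force
            then show ?case using 2 by (simp add: F_def)
          qed
        qed
      qed
      then have "\<forall>\<^sub>F n in sequentially. indicator (E (r n)) x * h x = indicator F x * h x"
        by eventually_elim (simp add: indicator_def)
      then have "(\<lambda>n. indicator (E (r n)) x * h x :: real) \<longlonglongrightarrow> indicator F x * h x" by (rule tendsto_eventually)
      then show False using x by simp
    qed
  qed
  have conv: "(\<lambda>n. \<integral>x. indicator (E (r n)) x * h x \<partial>lborel) \<longlonglongrightarrow> (\<integral>x. indicator F x * h x \<partial>lborel)"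
    if h: "integrable lborel h" for h :: "'a \<Rightarrow> real"
  proof (rule integral_dominated_convergence[where w="\<lambda>x. \<bar>h x\<bar>"])
    have [measurable]: "h \<in> borel_measurable borel" "F \<in> sets borel" "E n \<in> sets borel" for n
      using h clF clE by (auto intro: borel_closed)
    show "(\<lambda>x. indicator F x * h x) \<in> borel_measurable lborel" "(\<lambda>x. indicator (E (r n)) x * h x) \<in> borel_measurable lborel" for n
      by measurable
    show "integrable lborel (\<lambda>x. \<bar>h x\<bar>)" using h by simp
    show "AE x in lborel. (\<lambda>n. indicator (E (r n)) x * h x :: real) \<longlonglongrightarrow> indicator F x * h x" by (rule ind)
    show "AE x in lborel. norm (indicator (E (r n)) x * h x) \<le> \<bar>h x\<bar>" for n by (simp add: indicator_def)
  qed
  have hull: "\<forall>\<^sub>F n in sequentially. \<forall>x\<in>E (r n). infdist x F \<le> s" if s: "s > 0" for s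
  proof -
    let ?K = "cball 0 D \<inter> {x. s \<le> infdist x F}"
    have cK: "compact ?K" by (intro compact_Int_closed compact_cball closed_Collect_le continuous_intros)
    have KS: "?K \<subseteq> ?S" using \<delta> by (auto simp: R_def)
    have gpos: "g x > 0" if "x \<in> ?K" for x
    proof (rule ccontr)
      assume "\<not> g x > 0"
      then have "x \<in> F" using subsetD[OF KS that] by (simp add: F_def)
      then show False using that s by simp
    qed
    \<comment> \<open>A positive minimum of \<open>g\<close> on the compact set away from
      \<open>F\<close>, combined with uniform convergence, keeps the approximating sets out of it.
      If that set is empty, any positive constant will do.\<close>
    have "\<exists>c>0. \<forall>x\<in>?K. c \<le> g x"
    proof (cases "?K = {}")
      case False
      obtain x where x: "x \<in> ?K" "\<forall>y\<in>?K. g x \<le> g y"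
        using continuous_attains_inf[OF cK False continuous_on_subset[OF g KS]] by (elim bexE)
      then show ?thesis using gpos[OF x(1)] by (intro exI[of _ "g x"] conjI)
    qed (intro exI[of _ 1], simp)
    then obtain c where c: "c > 0" "\<forall>x\<in>?K. c \<le> g x" by (elim exE conjE)
    obtain N where N: "\<forall>n x. n \<ge> N \<and> x \<in> ?S \<longrightarrow> norm (signed_dist (E (r n)) x - g x) < c"
      using unif[OF c(1)] by (elim exE)
    show ?thesis
    proof (rule eventually_sequentiallyI, rule ballI, rule ccontr)
      fix n x assume n: "N \<le> n" and x: "x \<in> E (r n)" and far: "\<not> infdist x F \<le> s"
      have xK: "x \<in> ?K" using subsetD[OF bd x] far by simp
      have "norm (signed_dist (E (r n)) x - g x) < c" using N n subsetD[OF KS xK] by simp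
      moreover have "c \<le> g x" using c(2) xK by (rule bspec)
      ultimately have "signed_dist (E (r n)) x > 0" unfolding real_norm_def by linarith
      then show False using x infdist_nonneg[of x "- E (r n)"] by (simp add: signed_dist_nonpos)
    qed
  qed
  show ?thesis using r domF FD conv hull by (intro exI[of _ F] exI[of _ r] conjI allI impI)
qed

section \<open>Translations, balls and the size of the charge\<close>

lemma divergence_integrable:
  fixes \<phi> :: "'a::euclidean_space \<Rightarrow> 'a"
  assumes "compactly_supported_C1 \<phi>"
  shows "divergence \<phi> \<in> borel_measurable borel" "integrable lborel (divergence \<phi>)"
proof -
  obtain \<phi>' :: "'a \<Rightarrow> 'a \<Rightarrow>\<^sub>L 'a" and S M where d: "\<And>x. (\<phi> has_derivative blinfun_apply (\<phi>' x)) (at x)"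
    and c: "continuous_on UNIV \<phi>'" and z: "S > 0" "M > 0" "\<And>x. norm x > S \<Longrightarrow> \<phi> x = 0" "\<And>x. norm x > S \<Longrightarrow> \<phi>' x = 0"
    "\<And>x. norm (\<phi>' x) \<le> M" "\<And>x y. norm (\<phi> x - \<phi> y) \<le> M * norm (x - y)"
    by (rule compactly_supported_C1_bounds[OF assms], rule that)
  have div: "divergence \<phi> = (\<lambda>x. \<Sum>b\<in>Basis. \<phi>' x b \<bullet> b)" by (rule ext) (rule divergence_eq[OF d])
  have cont: "continuous_on UNIV (divergence \<phi>)" unfolding div by (intro continuous_intros c)
  then show "divergence \<phi> \<in> borel_measurable borel" by (rule borel_measurable_continuous_onI)
  have "integrable lborel (\<lambda>x. indicator (cball 0 S) x *\<^sub>R divergence \<phi> x)"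
    by (rule borel_integrable_compact) (auto intro: continuous_on_subset[OF cont])
  moreover have "(\<lambda>x. indicator (cball 0 S) x *\<^sub>R divergence \<phi> x) = divergence \<phi>"
    unfolding div using z(4) by (auto simp: fun_eq_iff indicator_def not_le)
  ultimately show "integrable lborel (divergence \<phi>)" by simp
qed

lemma set_integral_divergence:
  fixes \<phi> :: "'a::euclidean_space \<Rightarrow> 'a"
  assumes "compactly_supported_C1 \<phi>" and [measurable]: "E \<in> sets borel"
  shows "(LINT x:E|lebesgue. divergence \<phi> x) = (\<integral>x. indicator E x * divergence \<phi> x \<partial>lborel)"
proof -
  note [measurable] = divergence_integrable(1)[OF assms(1)]
  show ?thesis unfolding set_lebesgue_integral_def by (subst integral_completion) auto
qed

lemma perimeter_translation_le:
  fixes E :: "'a::euclidean_space set"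
  assumes [measurable]: "E \<in> sets borel" "(+) a ` E \<in> sets borel"
  shows "perimeter ((+) a ` E) \<le> perimeter E"
  unfolding perimeter_def[of "(+) a ` E"]
proof (rule SUP_least)
  fix \<phi> :: "'a \<Rightarrow> 'a" assume "\<phi> \<in> {\<phi>. compactly_supported_C1 \<phi> \<and> (\<forall>x. norm (\<phi> x) \<le> 1)}"
  then have \<phi>: "compactly_supported_C1 \<phi>" "\<And>x. norm (\<phi> x) \<le> 1" by auto
  obtain \<phi>' :: "'a \<Rightarrow> 'a \<Rightarrow>\<^sub>L 'a" where d: "\<And>x. (\<phi> has_derivative blinfun_apply (\<phi>' x)) (at x)"
    and c: "continuous_on UNIV \<phi>'" and K: "compact (closure {x. \<phi> x \<noteq> 0})"
    using \<phi>(1) unfolding compactly_supported_C1_def by blast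
  let ?\<psi> = "\<lambda>x. \<phi> (x + a)"
  have d\<psi>: "(?\<psi> has_derivative blinfun_apply (\<phi>' (x + a))) (at x)" for x
    by (rule has_derivative_compose[of "\<lambda>x. x + a" "\<lambda>h. h" x UNIV \<phi>, OF _ d]) (auto intro!: derivative_eq_intros)
  have \<psi>: "compactly_supported_C1 ?\<psi>"
    unfolding compactly_supported_C1_def
  proof (intro conjI exI[of _ "\<lambda>x. \<phi>' (x + a)"] allI d\<psi>)
    show "continuous_on UNIV (\<lambda>x. \<phi>' (x + a))"
      by (rule continuous_on_compose2[OF c]) (auto intro!: continuous_intros)
    have "{x. ?\<psi> x \<noteq> 0} = (+) (- a) ` {x. \<phi> x \<noteq> 0}"
    proof (intro equalityI subsetI)
      fix x assume "x \<in> {x. ?\<psi> x \<noteq> 0}"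
      then show "x \<in> (+) (- a) ` {x. \<phi> x \<noteq> 0}" by (intro image_eqI[of _ _ "x + a"]) auto
    qed auto
    then have "closure {x. ?\<psi> x \<noteq> 0} = (+) (- a) ` closure {x. \<phi> x \<noteq> 0}" by (simp only: closure_translation)
    then show "compact (closure {x. ?\<psi> x \<noteq> 0})" using compact_translation[OF K, of "- a"] by (simp only:)
  qed
  note [measurable] = divergence_integrable(1)[OF \<phi>(1)]
  have "(LINT x:(+) a ` E|lebesgue. divergence \<phi> x) = (\<integral>x. indicator ((+) a ` E) x * divergence \<phi> x \<partial>lborel)"
    by (rule set_integral_divergence[OF \<phi>(1) assms(2)])
  also have "\<dots> = (\<integral>x. indicator ((+) a ` E) (x + a) * divergence \<phi> (x + a) \<partial>lborel)"
    by (rule integral_translate[symmetric]) measurable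
  also have "\<dots> = (\<integral>x. indicator E x * divergence ?\<psi> x \<partial>lborel)"
  proof (intro Bochner_Integration.integral_cong refl)
    fix x
    have "divergence \<phi> (x + a) = divergence ?\<psi> x" unfolding divergence_eq[OF d] divergence_eq[OF d\<psi>] ..
    moreover have "x + a \<in> (+) a ` E \<longleftrightarrow> x \<in> E" by (auto simp: add.commute)
    ultimately show "indicator ((+) a ` E) (x + a) * divergence \<phi> (x + a) = indicator E x * divergence ?\<psi> x"
      by (simp add: indicator_def)
  qed
  also have "\<dots> = (LINT x:E|lebesgue. divergence ?\<psi> x)" by (rule set_integral_divergence[OF \<psi> assms(1), symmetric])
  finally have "ennreal (LINT x:(+) a ` E|lebesgue. divergence \<phi> x) = ennreal (LINT x:E|lebesgue. divergence ?\<psi> x)" by simp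
  also have "\<dots> \<le> perimeter E"
    unfolding perimeter_def using \<psi> \<phi>(2) by (intro SUP_upper) simp
  finally show "ennreal (LINT x:(+) a ` E|lebesgue. divergence \<phi> x) \<le> perimeter E" .
qed

text \<open>For the Riesz part, a translation is an expanding map with \<open>l = 1\<close>. The
  inequality squeezes the energies of a translated minimising sequence between the infimum and their
  old values.\<close>

lemma charged_energy_translation_le:
  fixes E :: "'a::euclidean_space set"
  assumes "closed E" "\<alpha> > 0"
  shows "charged_energy \<alpha> Q ((+) a ` E) \<le> charged_energy \<alpha> Q E"
proof -
  have b: "E \<in> sets borel" "(+) a ` E \<in> sets borel"
    using assms closed_translation[of E a] by (auto intro: borel_closed)
  have "ennreal (1 powr \<alpha>) * riesz_energy \<alpha> ((+) a ` E) \<le> riesz_energy \<alpha> E"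
    by (rule riesz_energy_expanding[where T="(+) a"]) (use b assms in auto)
  then have "riesz_energy \<alpha> ((+) a ` E) \<le> riesz_energy \<alpha> E" by simp
  then show ?thesis
    unfolding charged_energy_def using perimeter_translation_le[OF b] by (intro add_mono mult_left_mono) auto
qed

lemma ball_domain_translation:
  assumes "ball_domain E \<delta>"
  shows "ball_domain ((+) a ` E) \<delta>"
proof -
  interpret ball_domain E \<delta> by fact
  show ?thesis
  proof
    show "closed ((+) a ` E)" using closed by (rule closed_translation)
    show "ball_condition \<delta> ((+) a ` E)"
      unfolding ball_condition_def
    proof
      fix x assume "x \<in> frontier ((+) a ` E)"
      then obtain u where u: "u \<in> frontier E" "x = a + u" unfolding frontier_translation by (elim imageE)
      have tr: "(+) a ` ball y \<delta> = ball (a + y) \<delta>" for y :: 'a by (rule ball_translation[symmetric])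
      have 1: "ball (a + (u - \<delta> *\<^sub>R \<nu> u)) \<delta> \<subseteq> (+) a ` E"
        unfolding tr[symmetric] by (rule image_mono[OF normal(2)[OF u(1)]])
      have "(+) a ` (- E) = - (+) a ` E" by (rule bij_image_Compl_eq[OF bij_plus])
      then have 2: "ball (a + (u + \<delta> *\<^sub>R \<nu> u)) \<delta> \<subseteq> - (+) a ` E"
        using image_mono[OF normal(3)[OF u(1)], of "(+) a"] unfolding tr by simp
      have 3: "norm (x - (a + (u - \<delta> *\<^sub>R \<nu> u))) = \<delta>" "norm (x - (a + (u + \<delta> *\<^sub>R \<nu> u))) = \<delta>"
        using normal(1)[OF u(1)] \<delta> unfolding u(2) by simp_all
      show "(\<exists>y. ball y \<delta> \<subseteq> (+) a ` E \<and> norm (x - y) = \<delta>) \<and> (\<exists>z. ball z \<delta> \<subseteq> - (+) a ` E \<and> norm (x - z) = \<delta>)"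
        using 1 2 3 by (intro conjI exI)
    qed
  qed (rule \<delta>)
qed

lemma ball_domain_cball:
  assumes "0 < \<delta>" "\<delta> \<le> R"
  shows "ball_domain (cball (0::'a::euclidean_space) R) \<delta>"
proof
  show "ball_condition \<delta> (cball (0::'a) R)"
    unfolding ball_condition_def
  proof
    fix x :: 'a assume "x \<in> frontier (cball 0 R)"
    then have x: "norm x = R" using assms by (simp add: frontier_cball)
    have 1: "ball ((1 - \<delta> / R) *\<^sub>R x) \<delta> \<subseteq> cball 0 R"
    proof
      fix v assume v: "v \<in> ball ((1 - \<delta> / R) *\<^sub>R x) \<delta>"
      have "norm ((1 - \<delta> / R) *\<^sub>R x) = R - \<delta>" using assms x by (simp add: abs_of_nonneg field_simps)
      moreover have "norm v \<le> norm ((1 - \<delta> / R) *\<^sub>R x) + dist ((1 - \<delta> / R) *\<^sub>R x) v"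
        using norm_triangle_sub[of v "(1 - \<delta> / R) *\<^sub>R x"] by (simp add: dist_norm norm_minus_commute)
      ultimately show "v \<in> cball 0 R" using v by simp
    qed
    have 2: "ball ((1 + \<delta> / R) *\<^sub>R x) \<delta> \<subseteq> - cball 0 R"
    proof
      fix v assume v: "v \<in> ball ((1 + \<delta> / R) *\<^sub>R x) \<delta>"
      have "norm ((1 + \<delta> / R) *\<^sub>R x) = R + \<delta>" using assms x by (simp add: abs_of_nonneg field_simps)
      moreover have "norm ((1 + \<delta> / R) *\<^sub>R x) \<le> norm v + dist ((1 + \<delta> / R) *\<^sub>R x) v"
        using norm_triangle_sub[of "(1 + \<delta> / R) *\<^sub>R x" v] by (simp add: dist_norm)
      ultimately show "v \<in> - cball 0 R" using v by simp
    qed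
    have "x - (1 - \<delta> / R) *\<^sub>R x = (\<delta> / R) *\<^sub>R x" "x - (1 + \<delta> / R) *\<^sub>R x = (- (\<delta> / R)) *\<^sub>R x"
      by (simp_all add: algebra_simps)
    then have 3: "norm (x - (1 - \<delta> / R) *\<^sub>R x) = \<delta>" "norm (x - (1 + \<delta> / R) *\<^sub>R x) = \<delta>"
      using assms x by simp_all
    show "(\<exists>y. ball y \<delta> \<subseteq> cball 0 R \<and> norm (x - y) = \<delta>) \<and> (\<exists>z. ball z \<delta> \<subseteq> - cball 0 R \<and> norm (x - z) = \<delta>)"
      using 1 2 3 by (intro conjI exI)
  qed
qed (use assms in auto)

text \<open>Dilation by \<open>R\<close> is an expanding map with \<open>l = R\<close> from the unit
  ball onto \<open>cball 0 R\<close>.\<close>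

lemma riesz_energy_cball_le:
  assumes "R > 0" "\<alpha> > 0" and I: "riesz_energy \<alpha> (cball (0::'a::euclidean_space) 1) \<le> ennreal I" "I \<ge> 0"
  shows "riesz_energy \<alpha> (cball (0::'a) R) \<le> ennreal (R powr (- \<alpha>) * I)"
proof -
  have "ennreal (R powr \<alpha>) * riesz_energy \<alpha> (cball (0::'a) R) \<le> riesz_energy \<alpha> (cball (0::'a) 1)"
  proof (rule riesz_energy_expanding[where T="\<lambda>x. R *\<^sub>R x"])
    show "(*\<^sub>R) R ` cball (0::'a) 1 \<subseteq> cball 0 R" using assms by (auto simp: mult_left_le)
    show "R * norm (x - y) \<le> norm (R *\<^sub>R x - R *\<^sub>R y)" for x y :: 'a
      using assms by (simp flip: scaleR_diff_right)
  qed (use assms in auto)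
  then have "ennreal (R powr \<alpha>) * riesz_energy \<alpha> (cball (0::'a) R) \<le> ennreal I" using I(1) by (rule order_trans)
  then have "ennreal (R powr (- \<alpha>)) * (ennreal (R powr \<alpha>) * riesz_energy \<alpha> (cball (0::'a) R)) \<le> ennreal (R powr (- \<alpha>)) * ennreal I"
    by (rule mult_left_mono) simp
  also have "ennreal (R powr (- \<alpha>)) * (ennreal (R powr \<alpha>) * riesz_energy \<alpha> (cball (0::'a) R)) = riesz_energy \<alpha> (cball (0::'a) R)"
    using assms by (simp add: mult.assoc[symmetric] ennreal_mult[symmetric] powr_add[symmetric])
  finally show ?thesis using assms by (simp add: ennreal_mult)
qed

text \<open>The two sides are the Riesz energy of the ball of volume \<open>m\<close> and the isoperimetric gap of
  disconnected competitors.\<close>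

lemma charge_smallness:
  fixes w \<alpha> \<kappa> I \<delta> m Q R :: real
  assumes d: "d \<ge> 1" and pos: "w > 0" "\<kappa> > 0" "I \<ge> 0" "\<delta> > 0" "\<delta> \<le> R" "Q > 0" and m: "m = w * R ^ d"
    and Q: "Q / m powr ((real d - 1 + \<alpha>) / (2 * real d)) \<le> sqrt (d * w * \<kappa> * w\<^sup>2 / (w powr ((real d - 1 + \<alpha>) / d) * (I + 1))) * (\<delta> ^ d / m)"
  shows "Q\<^sup>2 * (R powr (- \<alpha>) * I) \<le> d * w * \<kappa> * \<delta> ^ (d - 1)"
proof -
  let ?p = "(real d - 1 + \<alpha>) / d"
  \<comment> \<open>The square of the constant in the hypothesis. Its powers of \<open>w\<close>
    cancel those produced by \<open>(\<delta> ^ d / m)\<^sup>2\<close> and \<open>m powr ?p\<close>,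
    and \<open>I + 1\<close> in place of \<open>I\<close> covers the value
    \<open>I = 0\<close>.\<close>
  let ?c = "d * w * \<kappa> * w\<^sup>2 / (w powr ?p * (I + 1))"
  have R: "R > 0" using pos by linarith
  have m0: "m > 0" using m pos R by simp
  have c: "?c \<ge> 0" using pos by simp
  have half: "(real d - 1 + \<alpha>) / (2 * real d) = ?p / 2" by simp
  have "Q \<le> sqrt ?c * (\<delta> ^ d / m) * m powr (?p / 2)" using Q m0 unfolding half by (simp add: divide_le_eq)
  then have "Q\<^sup>2 \<le> (sqrt ?c * (\<delta> ^ d / m) * m powr (?p / 2))\<^sup>2" using pos by (intro power_mono) auto
  also have "\<dots> = ?c * (\<delta> ^ d / m)\<^sup>2 * (m powr (?p / 2))\<^sup>2" by (simp only: power_mult_distrib real_sqrt_pow2[OF c])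
  also have "(m powr (?p / 2))\<^sup>2 = m powr ?p" using m0 by (simp add: power2_eq_square flip: powr_add)
  also have "m powr ?p = w powr ?p * (R ^ (d - 1) * R powr \<alpha>)"
  proof -
    have "(R ^ d) powr ?p = R powr (real d * ?p)" using R by (simp add: powr_powr flip: powr_realpow)
    also have "real d * ?p = real (d - 1) + \<alpha>" using d by (simp add: of_nat_diff)
    also have "R powr (real (d - 1) + \<alpha>) = R ^ (d - 1) * R powr \<alpha>" using R by (simp add: powr_add powr_realpow)
    finally show ?thesis unfolding m using pos R by (simp add: powr_mult)
  qed
  finally have Q2: "Q\<^sup>2 \<le> ?c * (\<delta> ^ d / m)\<^sup>2 * (w powr ?p * (R ^ (d - 1) * R powr \<alpha>))" .
  have "Q\<^sup>2 * (R powr (- \<alpha>) * I) \<le> ?c * (\<delta> ^ d / m)\<^sup>2 * (w powr ?p * (R ^ (d - 1) * R powr \<alpha>)) * (R powr (- \<alpha>) * I)"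
    using Q2 pos by (intro mult_right_mono) auto
  also have "\<dots> = (?c * w powr ?p * I) * ((\<delta> ^ d / m)\<^sup>2 * R ^ (d - 1)) * (R powr \<alpha> * R powr (- \<alpha>))"
    by (simp only: mult_ac)
  also have "R powr \<alpha> * R powr (- \<alpha>) = 1" using R by (simp flip: powr_add)
  also have "?c * w powr ?p * I = d * w * \<kappa> * w\<^sup>2 * (I / (I + 1))"
  proof -
    have "X / (u * (I + 1)) * u * I = X * (I / (I + 1))" if "u \<noteq> 0" for X u
      using that by simp
    then show ?thesis using pos by simp
  qed
  also have "(\<delta> ^ d / m)\<^sup>2 * R ^ (d - 1) = (\<delta> ^ d * \<delta> ^ d * R ^ (d - 1) / (R ^ d * R ^ d)) / w\<^sup>2"
    using pos R by (simp add: m power2_eq_square field_simps)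
  also have "d * w * \<kappa> * w\<^sup>2 * (I / (I + 1)) * ((\<delta> ^ d * \<delta> ^ d * R ^ (d - 1) / (R ^ d * R ^ d)) / w\<^sup>2) * 1
     = d * w * \<kappa> * ((I / (I + 1)) * (\<delta> ^ d * \<delta> ^ d * R ^ (d - 1) / (R ^ d * R ^ d)))"
    using pos by simp
  also have "\<dots> \<le> d * w * \<kappa> * (1 * \<delta> ^ (d - 1))"
  proof (intro mult_left_mono mult_mono)
    have e: "x ^ d = x * x ^ (d - 1)" for x :: real using d by (cases d) auto
    \<comment> \<open>The quotient to be bounded is
      \<open>\<delta> ^ (d - 1) * (\<delta> / R) ^ (d + 1)\<close>, so \<delta> \<le>
      \<open>R\<close> settles it.\<close>
    have "\<delta> * \<delta> * \<delta> ^ (d - 1) \<le> R * R * R ^ (d - 1)"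
      using pos by (intro mult_mono power_mono) auto
    then have "(\<delta> * \<delta> * \<delta> ^ (d - 1)) * (\<delta> ^ (d - 1) * R ^ (d - 1)) \<le> (R * R * R ^ (d - 1)) * (\<delta> ^ (d - 1) * R ^ (d - 1))"
      using pos R by (intro mult_right_mono) auto
    then have "\<delta> ^ d * \<delta> ^ d * R ^ (d - 1) \<le> \<delta> ^ (d - 1) * (R ^ d * R ^ d)" unfolding e by (simp only: mult_ac)
    then show "\<delta> ^ d * \<delta> ^ d * R ^ (d - 1) / (R ^ d * R ^ d) \<le> \<delta> ^ (d - 1)" using R by (simp add: divide_le_eq)
  qed (use pos R in auto)
  finally show ?thesis by simp
qed

section \<open>Passage to the limit and existence of a minimiser\<close>

lemma ball_class_iff: "0 < \<delta> \<Longrightarrow> E \<in> ball_class \<delta> \<longleftrightarrow> ball_domain E \<delta>"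
  by (simp add: ball_class_def ball_domain_def)

text \<open>The perimeter is a supremum of functionals that converge along the sequence. For a fixed
  test field and a fixed \<epsilon> both parts of the energy have convergent lower bounds; only then
  does \<epsilon> tend to 0, and the supremum over test fields comes last.\<close>

lemma charged_energy_le_of_limit:
  fixes E :: "nat \<Rightarrow> 'a::euclidean_space set"
  assumes F: "ball_domain F \<delta>" "F \<noteq> {}" "F \<subseteq> cball 0 D"
    and E: "\<And>n. closed (E n)" "\<And>n. E n \<subseteq> cball 0 D"
    and conv: "\<And>h :: 'a \<Rightarrow> real. integrable lborel h \<Longrightarrow>
       (\<lambda>n. \<integral>x. indicator (E n) x * h x \<partial>lborel) \<longlonglongrightarrow> (\<integral>x. indicator F x * h x \<partial>lborel)"
    and hull: "\<And>s. s > 0 \<Longrightarrow> \<forall>\<^sub>F n in sequentially. \<forall>x\<in>E n. infdist x F \<le> s"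
    and J: "(\<lambda>n. charged_energy \<alpha> Q (E n)) \<longlonglongrightarrow> J" "J < \<infinity>" and "\<alpha> > 0" "Q > 0"
  shows "charged_energy \<alpha> Q F \<le> J"
proof -
  let ?A = "{\<phi> :: 'a \<Rightarrow> 'a. compactly_supported_C1 \<phi> \<and> (\<forall>x. norm (\<phi> x) \<le> 1)}"
  let ?X = "ennreal (Q\<^sup>2) * riesz_energy \<alpha> F"
  have bF: "F \<in> sets borel" using ball_domain.closed[OF F(1)] by (rule borel_closed)
  have bE: "E n \<in> sets borel" for n using E(1) by (rule borel_closed)
  have step: "ennreal ((1 - \<epsilon>) powr \<alpha>) * (ennreal (LINT x:F|lebesgue. divergence \<phi> x) + ?X) \<le> J"
    if \<phi>: "\<phi> \<in> ?A" and \<epsilon>: "0 < \<epsilon>" "\<epsilon> < 1" for \<phi> \<epsilon>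
  proof -
    let ?l = "ennreal ((1 - \<epsilon>) powr \<alpha>)"
    have C1: "compactly_supported_C1 \<phi>" using \<phi> by simp
    let ?a = "\<lambda>G. ennreal (LINT x:G|lebesgue. divergence \<phi> x)"
    have "(\<lambda>n. LINT x:E n|lebesgue. divergence \<phi> x) \<longlonglongrightarrow> (LINT x:F|lebesgue. divergence \<phi> x)"
      unfolding set_integral_divergence[OF C1 bF] set_integral_divergence[OF C1 bE]
      by (rule conv[OF divergence_integrable(2)[OF C1]])
    then have a: "(\<lambda>n. ?a (E n)) \<longlonglongrightarrow> ?a F" by (rule tendsto_ennrealI)
    obtain s where s: "s > 0" "\<forall>G. G \<in> sets borel \<and> G \<subseteq> cball 0 D \<and> (\<forall>x\<in>G. infdist x F \<le> s)
        \<longrightarrow> ?l * riesz_energy \<alpha> F \<le> riesz_energy \<alpha> G"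
      using ball_domain.riesz_energy_lower_semicontinuous[OF F(1,2,3) \<open>\<alpha> > 0\<close> \<epsilon>] by (elim exE conjE)
    have ev: "\<forall>\<^sub>F n in sequentially. ?a (E n) + ?l * ?X \<le> charged_energy \<alpha> Q (E n)"
      using hull[OF s(1)]
    proof eventually_elim
      case (elim n)
      have "?l * riesz_energy \<alpha> F \<le> riesz_energy \<alpha> (E n)" using s(2) bE E(2) elim by simp
      then have "ennreal (Q\<^sup>2) * (?l * riesz_energy \<alpha> F) \<le> ennreal (Q\<^sup>2) * riesz_energy \<alpha> (E n)" by (rule mult_left_mono) simp
      moreover have "?a (E n) \<le> perimeter (E n)" unfolding perimeter_def by (rule SUP_upper[OF \<phi>])
      ultimately show ?case unfolding charged_energy_def by (intro add_mono) (simp_all add: mult.left_commute)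
    qed
    have "(\<lambda>n. ?a (E n) + ?l * ?X) \<longlonglongrightarrow> ?a F + ?l * ?X" by (intro tendsto_add a tendsto_const)
    then have le: "?a F + ?l * ?X \<le> J" by (rule tendsto_le[OF sequentially_bot J(1) _ ev])
    \<comment> \<open>Weakening the perimeter term by the same factor reduces the limit in
      \<epsilon> to that of one scalar factor.\<close>
    have "(1 - \<epsilon>) powr \<alpha> \<le> 1 powr \<alpha>" using \<epsilon> \<open>\<alpha> > 0\<close> by (intro powr_mono2) auto
    then have "?l \<le> 1" by (simp add: ennreal_le_1)
    then have "?l * ?a F \<le> 1 * ?a F" by (rule mult_right_mono) simp
    then have "?l * (?a F + ?X) \<le> ?a F + ?l * ?X" unfolding distrib_left by (intro add_mono) simp_all
    then show ?thesis using le by (rule order_trans)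
  qed
  have key: "ennreal (LINT x:F|lebesgue. divergence \<phi> x) + ?X \<le> J" if \<phi>: "\<phi> \<in> ?A" for \<phi>
  proof -
    let ?Y = "ennreal (LINT x:F|lebesgue. divergence \<phi> x) + ?X"
    show ?thesis
    proof (cases ?Y)
      case top
      have "ennreal ((1 - 1/2) powr \<alpha>) * top \<le> J" using step[OF \<phi>, of "1/2"] unfolding top by simp
      then have "J = top" by (simp add: ennreal_mult_top top_unique)
      then show ?thesis by simp
    next
      case (real y)
      have "((\<lambda>\<epsilon>. ennreal ((1 - \<epsilon>) powr \<alpha> * y)) \<longlongrightarrow> ennreal ((1 - 0) powr \<alpha> * y)) (at_right 0)"
        by (intro tendsto_ennrealI tendsto_intros) auto
      moreover have "\<forall>\<^sub>F \<epsilon> in at_right 0. ennreal ((1 - \<epsilon>) powr \<alpha> * y) \<le> J"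
        using step[OF \<phi>] real by (intro eventually_at_rightI[of 0 1]) (auto simp: ennreal_mult)
      ultimately have "ennreal ((1 - 0) powr \<alpha> * y) \<le> J" by (rule tendsto_upperbound) simp
      then show ?thesis using real by simp
    qed
  qed
  \<comment> \<open>The zero field makes the index set nonempty and bounds the Riesz term by
    \<open>J\<close>. So this term is finite and can be moved under the supremum.\<close>
  have zero: "(\<lambda>_. 0) \<in> ?A"
    unfolding compactly_supported_C1_def
    by (auto intro!: exI[of _ "\<lambda>_. 0"] derivative_eq_intros continuous_intros)
  have "?X \<le> J" using key[OF zero] by (rule order_trans[rotated]) simp
  then have Xfin: "?X \<noteq> top" using J(2) by (auto simp: top_unique)
  have "charged_energy \<alpha> Q F = (SUP \<phi>\<in>?A. ennreal (LINT x:F|lebesgue. divergence \<phi> x) + ?X)"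
    unfolding charged_energy_def perimeter_def using zero Xfin by (intro ennreal_SUP_add_left[symmetric]) auto
  also have "\<dots> \<le> J" by (rule SUP_least) (rule key)
  finally show ?thesis .
qed

text \<open>Either the ball attains the infimum, or a minimising sequence eventually lies strictly
  below the energy of the ball. In the second case \<open>small\<close> and the isoperimetric gap
  rule out disconnected members.\<close>

lemma charged_energy_minimizer_exists:
  fixes \<delta> m Q \<alpha> R :: real
  assumes \<delta>: "0 < \<delta>" "\<delta> \<le> R" and "\<alpha> > 0" "Q > 0"
    and m: "m = unit_ball_vol (real DIM('a::euclidean_space)) * R ^ DIM('a)"
    and I: "riesz_energy \<alpha> (cball (0::'a) 1) \<le> ennreal I" "I \<ge> 0"
    and small: "Q\<^sup>2 * (R powr (- \<alpha>) * I) \<le> DIM('a) * unit_ball_vol (real DIM('a)) * (1 - 2 powr (- 1 / DIM('a))) * \<delta> ^ (DIM('a) - 1)"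
  shows "\<exists>E :: 'a set. is_arg_min (charged_energy \<alpha> Q) (\<lambda>F. emeasure lebesgue F = ennreal m \<and> F \<in> ball_class \<delta>) E"
proof -
  let ?d = "DIM('a)" and ?w = "unit_ball_vol (real DIM('a))" and ?B = "cball (0::'a) R"
  let ?P = "\<lambda>F :: 'a set. emeasure lebesgue F = ennreal m \<and> ball_domain F \<delta>"
  let ?E = "charged_energy \<alpha> Q :: 'a set \<Rightarrow> ennreal"
  have w: "?w > 0" by (rule unit_ball_vol_pos) simp
  have R: "R > 0" using \<delta> by linarith
  have m0: "m > 0" unfolding m using w R by simp
  have lm: "F \<in> lmeasurable" "measure lebesgue F = m" if "?P F" for F
  proof -
    have "closed F" by (rule ball_domain.closed[OF conjunct2[OF that]])
    then have "F \<in> sets lebesgue" using borel_closed by simp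
    then show "F \<in> lmeasurable" using conjunct1[OF that] by (intro fmeasurableI) simp_all
    show "measure lebesgue F = m" unfolding measure_def conjunct1[OF that] using m0 by simp
  qed
  have PB: "?P ?B"
    using ball_domain_cball[OF \<delta>] emeasure_cball[of R "0::'a"] R by (simp add: m)
  have EB: "?E ?B \<le> ennreal (?d * ?w * (R ^ (?d - 1) + (1 - 2 powr (- 1 / ?d)) * \<delta> ^ (?d - 1)))"
  proof -
    have "ennreal (Q\<^sup>2) * riesz_energy \<alpha> ?B \<le> ennreal (Q\<^sup>2) * ennreal (R powr (- \<alpha>) * I)"
      by (rule mult_left_mono[OF riesz_energy_cball_le[OF R \<open>\<alpha> > 0\<close> I]]) simp
    also have "\<dots> = ennreal (Q\<^sup>2 * (R powr (- \<alpha>) * I))" using I by (intro ennreal_mult[symmetric]) auto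
    finally have "?E ?B \<le> ennreal (?d * ?w * R ^ (?d - 1)) + ennreal (Q\<^sup>2 * (R powr (- \<alpha>) * I))"
      unfolding charged_energy_def by (intro add_mono perimeter_cball_le[OF R])
    also have "\<dots> = ennreal (?d * ?w * R ^ (?d - 1) + Q\<^sup>2 * (R powr (- \<alpha>) * I))"
      using w R I by (intro ennreal_plus[symmetric]) auto
    also have "\<dots> \<le> ennreal (?d * ?w * (R ^ (?d - 1) + (1 - 2 powr (- 1 / ?d)) * \<delta> ^ (?d - 1)))"
      using small by (intro ennreal_leI) (simp add: distrib_left mult.assoc)
    finally show ?thesis .
  qed
  have disc: "?E ?B \<le> ?E F" if F: "?P F" "\<not> connected F" for F
  proof -
    have "?E ?B \<le> perimeter F"
      using EB ball_domain.perimeter_disconnected_ge[OF conjunct2[OF F(1)] lm(1)[OF F(1)] F(2) R] lm(2)[OF F(1)] m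
      by (auto intro: order_trans)
    also have "\<dots> \<le> ?E F" unfolding charged_energy_def by simp
    finally show ?thesis .
  qed
  define J where "J = Inf (?E ` {F. ?P F})"
  have Jle: "J \<le> ?E F" if "?P F" for F unfolding J_def using that by (intro INF_lower) simp
  have ex: "\<exists>F. ?P F \<and> ?E F \<le> J"
  proof (cases "?E ?B \<le> J")
    case False
    then have JB: "J < ?E ?B" by simp
    have mem: "?E ?B \<in> ?E ` {F. ?P F}" using PB by (intro imageI CollectI)
    have "?E ` {F. ?P F} \<noteq> {}"
    proof
      assume "?E ` {F. ?P F} = {}"
      with mem show False by (simp only: empty_iff)
    qed
    from Inf_as_limit[OF this] obtain u where u: "\<forall>n. u n \<in> ?E ` {F. ?P F}" "u \<longlonglongrightarrow> J" unfolding J_def by (elim exE conjE)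
    have "\<forall>\<^sub>F n in sequentially. u n < ?E ?B" by (rule order_tendstoD(2)[OF u(2) JB])
    then obtain N where N: "\<And>n. n \<ge> N \<Longrightarrow> u n < ?E ?B" unfolding eventually_sequentially by auto
    have "\<exists>F. ?P F \<and> u (n + N) = ?E F" for n using u(1)[rule_format, of "n + N"] by auto
    then obtain G where G: "\<And>n. ?P (G n)" "\<And>n. u (n + N) = ?E (G n)" by metis
    have conn: "connected (G n)" for n
    proof (rule ccontr)
      assume "\<not> connected (G n)"
      then have "?E ?B \<le> ?E (G n)" by (rule disc[OF G(1)])
      then show False using N[of "n + N"] G(2)[of n] by simp
    qed
    obtain k :: nat where k: "m < k * (?w * \<delta> ^ ?d)"
    proof -
      have "0 < ?w * \<delta> ^ ?d" using w \<delta> by simp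
      from spec[OF reals_Archimedean3[OF this], of m] show thesis by (rule exE) (rule that)
    qed
    define D where "D = 6 * \<delta> * k"
    have "G n \<noteq> {}" for n using G(1)[of n] m0 by auto
    then have "\<exists>a. a \<in> G n" for n by auto
    then obtain a where a: "\<And>n. a n \<in> G n" by metis
    \<comment> \<open>A point of \<open>G n\<close> is moved to the origin, so the uniform diameter
      bound puts all sets into the single ball \<open>cball 0 D\<close>.\<close>
    define E where "E n = (+) (- a n) ` G n" for n
    have PE: "?P (E n)" for n
    proof
      have "(+) (- a n) ` G n = (\<lambda>x. 1 *\<^sub>R x + (- a n)) ` G n" by (intro image_cong) simp_all
      then have "emeasure lebesgue (E n) = emeasure lebesgue (G n)"
        unfolding E_def using emeasure_lebesgue_affine[of 1 "- a n" "G n"] by (simp only: abs_one power_one ennreal_1 mult_1)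
      then show "emeasure lebesgue (E n) = ennreal m" using conjunct1[OF G(1)[of n]] by (rule trans)
      show "ball_domain (E n) \<delta>" unfolding E_def by (rule ball_domain_translation[OF conjunct2[OF G(1)]])
    qed
    have ED: "E n \<subseteq> cball 0 D" for n
    proof
      fix x assume "x \<in> E n"
      then obtain y where y: "y \<in> G n" "x = - a n + y" unfolding E_def by auto
      have "dist (a n) y < 6 * \<delta> * k"
        using ball_domain.connected_dist_less[OF conjunct2[OF G(1)] lm(1)[OF G(1)] conn a y(1)] lm(2)[OF G(1)] k by simp
      then show "x \<in> cball 0 D" using y(2) by (simp add: D_def dist_norm norm_minus_commute)
    qed
    have Ene: "E n \<noteq> {}" for n using a[of n] by (auto simp: E_def)
    have Elim: "(\<lambda>n. ?E (E n)) \<longlonglongrightarrow> J"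
    proof (rule tendsto_sandwich)
      show "(\<lambda>_. J) \<longlonglongrightarrow> J" by simp
      show "(\<lambda>n. u (n + N)) \<longlonglongrightarrow> J" using u(2) by (rule LIMSEQ_ignore_initial_segment)
      show "\<forall>\<^sub>F n in sequentially. J \<le> ?E (E n)" using Jle[OF PE] by simp
      have "?E (E n) \<le> u (n + N)" for n
        unfolding G(2) E_def using ball_domain.closed[OF conjunct2[OF G(1)]] \<open>\<alpha> > 0\<close> by (rule charged_energy_translation_le)
      then show "\<forall>\<^sub>F n in sequentially. ?E (E n) \<le> u (n + N)" by simp
    qed
    from ball_domain_compactness[of E, OF conjunct2[OF PE] Ene ED]
    obtain F r where r: "strict_mono (r :: nat \<Rightarrow> nat)" and F: "ball_domain F \<delta>" "F \<subseteq> cball 0 D"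
      and conv: "\<forall>h :: 'a \<Rightarrow> real. integrable lborel h \<longrightarrow>
        (\<lambda>n. \<integral>x. indicator (E (r n)) x * h x \<partial>lborel) \<longlonglongrightarrow> (\<integral>x. indicator F x * h x \<partial>lborel)"
      and hull: "\<forall>s>0. \<forall>\<^sub>F n in sequentially. \<forall>x\<in>E (r n). infdist x F \<le> s"
      by (elim exE conjE)
    \<comment> \<open>All sets lie in \<open>cball 0 D\<close>; testing the convergence with the
      indicator of this ball therefore gives convergence of the volumes.\<close>
    have vol: "(\<integral>x. indicator A x * indicator (cball 0 D) x \<partial>lborel) = measure lebesgue A" if A: "closed A" "A \<subseteq> cball 0 D" for A :: "'a set"
    proof -
      have "(\<lambda>x. indicator A x * indicator (cball 0 D) x :: real) = indicator A"
        using A(2) by (auto simp: fun_eq_iff indicator_def)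
      then show ?thesis using A(1) by simp
    qed
    have clE: "closed (E n)" for n by (rule ball_domain.closed[OF conjunct2[OF PE]])
    have clF: "closed F" by (rule ball_domain.closed[OF F(1)])
    have "integrable lborel (indicator (cball 0 D) :: 'a \<Rightarrow> real)"
      using emeasure_lborel_cball_finite[of "0::'a" D] by (intro integrable_real_indicator) auto
    from conv[rule_format, OF this] have "(\<lambda>n. m) \<longlonglongrightarrow> measure lebesgue F"
      unfolding vol[OF clE ED] vol[OF clF F(2)] lm(2)[OF PE] .
    then have mF: "measure lebesgue F = m" by (simp only: LIMSEQ_const_iff)
    have "F \<in> lmeasurable"
      using clF bounded_subset[OF bounded_cball F(2)] by (intro lmeasurable_compact) (simp add: compact_eq_bounded_closed)
    then have "emeasure lebesgue F = ennreal m" using emeasure_eq_measure2 mF by metis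
    then have PF: "?P F" using F(1) by blast
    have Fne: "F \<noteq> {}" using mF m0 by auto
    have "?E F \<le> J"
    proof (rule charged_energy_le_of_limit[where E="\<lambda>n. E (r n)", OF F(1) Fne F(2) clE ED])
      show "(\<lambda>n. ?E (E (r n))) \<longlonglongrightarrow> J" using LIMSEQ_subseq_LIMSEQ[OF Elim r] by (simp add: o_def)
      show "J < \<infinity>" using JB by (rule order.strict_trans2) simp
    qed (use conv hull \<open>\<alpha> > 0\<close> \<open>Q > 0\<close> in auto)
    then show ?thesis using PF by blast
  qed (use PB in blast)
  then obtain F where F: "?P F" "?E F \<le> J" by (elim exE conjE) blast
  show ?thesis
    unfolding is_arg_min_def ball_class_iff[OF \<delta>(1)]
  proof (intro exI[of _ F] conjI notI)
    assume "\<exists>G. (emeasure lebesgue G = ennreal m \<and> ball_domain G \<delta>) \<and> ?E G < ?E F"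
    then obtain G where G: "?P G" "?E G < ?E F" by (elim exE conjE) blast
    have "?E F \<le> ?E G" by (rule order_trans[OF F(2) Jle[OF G(1)]])
    then show False using G(2) by simp
  qed (use F(1) in auto)
qed

theorem theorem1p6:
  fixes \<alpha> :: real
  assumes "CARD('n::finite) \<ge> 2"
    and "0 < \<alpha>" and "\<alpha> < real CARD('n)"
  shows "\<exists>Q\<^sub>0 > 0. \<forall>\<delta> m Q :: real.
    0 < \<delta> \<longrightarrow>
    m \<ge> measure lebesgue (ball (0 :: real ^ 'n) 1) * \<delta> ^ CARD('n) \<longrightarrow>
    0 < Q \<longrightarrow>
    Q / m powr ((real CARD('n) - 1 + \<alpha>) / (2 * real CARD('n))) \<le> Q\<^sub>0 * (\<delta> ^ CARD('n) / m) \<longrightarrow>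
    (\<exists>E :: (real ^ 'n) set.
       is_arg_min (charged_energy \<alpha> Q)
         (\<lambda>F. emeasure lebesgue F = ennreal m \<and> F \<in> ball_class \<delta>) E)"
proof -
  let ?d = "CARD('n)" and ?w = "unit_ball_vol (real CARD('n))"
  have dim: "DIM(real ^ 'n) = ?d" by simp
  have d: "?d \<ge> 1" using assms(1) by linarith
  have w: "?w > 0" by (rule unit_ball_vol_pos) simp
  have ball1: "measure lebesgue (ball (0 :: real ^ 'n) 1) = ?w"
    using measure_ball[of 1 "0 :: real ^ 'n"] unfolding dim by simp
  define I where "I = enn2real (riesz_energy \<alpha> (cball (0 :: real ^ 'n) 1))"
  have "riesz_energy \<alpha> (cball (0 :: real ^ 'n) 1) < \<infinity>"
    using assms(2,3) by (intro riesz_energy_unit_ball_finite) simp_all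
  then have I: "riesz_energy \<alpha> (cball (0 :: real ^ 'n) 1) \<le> ennreal I" "I \<ge> 0"
    by (simp_all add: I_def ennreal_enn2real_if less_top[symmetric])
  define \<kappa> where "\<kappa> = 1 - 2 powr (- 1 / real ?d)"
  have "2 powr (- 1 / real ?d) < 2 powr 0" using d by (intro powr_less_mono) auto
  then have \<kappa>: "\<kappa> > 0" by (simp add: \<kappa>_def)
  \<comment> \<open>The constant of \<open>charge_smallness\<close> for the gap factor \<kappa> and
    the energy \<open>I\<close> of the unit ball, which is finite because \<alpha> is less than the
    dimension. Neither depends on \<delta>, \<open>m\<close> or \<open>Q\<close>.\<close>
  define Q0 where "Q0 = sqrt (?d * ?w * \<kappa> * ?w\<^sup>2 / (?w powr ((real ?d - 1 + \<alpha>) / ?d) * (I + 1)))"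
  have w0: "?w \<noteq> 0" using w by linarith
  have "Q0 > 0" unfolding Q0_def using d w \<kappa> I(2)
    by (intro real_sqrt_gt_zero divide_pos_pos mult_pos_pos) (auto simp: w0)
  moreover have "\<exists>E :: (real ^ 'n) set. is_arg_min (charged_energy \<alpha> Q) (\<lambda>F. emeasure lebesgue F = ennreal m \<and> F \<in> ball_class \<delta>) E"
    if \<delta>: "0 < \<delta>" and m: "m \<ge> measure lebesgue (ball (0 :: real ^ 'n) 1) * \<delta> ^ ?d" and Q: "0 < Q"
      "Q / m powr ((real ?d - 1 + \<alpha>) / (2 * real ?d)) \<le> Q0 * (\<delta> ^ ?d / m)" for \<delta> m Q
  proof -
    \<comment> \<open>The radius of the ball of volume \<open>m\<close>. The lower bound on
      \<open>m\<close> amounts to \<delta> \<le> \<open>R\<close>, which makes this ball a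
      competitor.\<close>
    define R where "R = (m / ?w) powr (1 / real ?d)"
    have mw: "\<delta> ^ ?d \<le> m / ?w" using m w unfolding ball1 by (simp add: le_divide_eq mult.commute)
    have pow: "0 \<le> \<delta> ^ ?d" using \<delta> by simp
    have "R ^ ?d = m / ?w" unfolding R_def using mw pow d by (intro powr_inverse_power(1)) auto
    then have mR: "m = ?w * R ^ ?d" using less_imp_neq[OF w] by (metis nonzero_mult_div_cancel_left times_divide_eq_right)
    have "\<delta> = (\<delta> ^ ?d) powr (1 / real ?d)" using \<delta> d by (simp add: powr_inverse_power)
    also have "\<dots> \<le> R" unfolding R_def using mw pow by (intro powr_mono2) auto
    finally have \<delta>R: "\<delta> \<le> R" .
    have small: "Q\<^sup>2 * (R powr (- \<alpha>) * I) \<le> ?d * ?w * \<kappa> * \<delta> ^ (?d - 1)"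
      by (rule charge_smallness[OF d w \<kappa> I(2) \<delta> \<delta>R Q(1) mR Q(2)[unfolded Q0_def]])
    show ?thesis
      by (rule charged_energy_minimizer_exists[OF \<delta> \<delta>R assms(2) Q(1) _ I])
        (use mR small in \<open>simp_all add: \<kappa>_def\<close>)
  qed
  ultimately show ?thesis by blast
qed

end
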